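(* Let $\lambda,\rho$ be $\sigma$-finite measures on a measurable space $(\mathbb X,\mathcal X)$ such that $\lambda\ll\rho$ with density $h_\lambda$, and let $h:\mathbb X\to\mathbb R$ be measurable. Assume that $$\int(1-h_\lambda)^2\,\mathrm d\rho+\int h^2\,\mathrm d\rho<\infty.$$ Let $\theta_0\in\mathbb R$ and let $I\subset\mathbb R$ be an interval with non-empty interior such that $\theta_0\in I$. For any $\theta\in I$ let $R_\theta:\mathbb X\to\mathbb R$ be a measurable function such that: (i) for all $\theta\in I$, $h_\lambda+(\theta-\theta_0)(h+R_\theta)\ge0$ $\rho$-a.e.; (ii) $\lim_{\theta\to\theta_0}R_\theta=0$ $\rho$-a.e.; (iii) there is a measurable function $R:\mathbb X\to[0,\infty)$ such that $|R_\theta|\le R$ $\rho$-a.e. for all $\theta\in I$ and $\int R^2\,\mathrm d\rho<\infty$. For $\theta\in I$ let $\lambda_\theta$ denote the measure with density $h_\lambda+(\theta-\theta_0)(h+R_\theta)$ with respect to $\rho$. Let $f:\mathbf N\to\mathbb R$ be a measurable function such that $\mathbb E_\rho f(\Phi)^2<\infty$. Then $$\frac{\mathrm d}{\mathrm d\theta}\mathbb E_{\lambda_\theta}f(\Phi)\Big|_{\theta=\theta_0}=\int\big(\mathbb E_\lambda D_xf(\Phi)\big)h(x)\,\rho(\mathrm dx).$$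
   Context: $\mathbf N$ is the space of $\sigma$-finite measures $\varphi$ on $\mathbb X$ with values in $\{0,1,2,\ldots\}\cup\{\infty\}$, equipped with the smallest $\sigma$-field making all maps $\varphi\mapsto\varphi(B)$, $B\in\mathcal X$, measurable. For a $\sigma$-finite measure $\lambda$ on $\mathbb X$, $\Pi_\lambda$ denotes the distribution (on $\mathbf N$) of a Poisson process with intensity measure $\lambda$. $\Phi:\Omega\to\mathbf N$ is a fixed measurable map on a measurable space $\Omega$, and $\mathbb P_\lambda$ is a probability measure on $\Omega$ with $\mathbb P_\lambda(\Phi\in\cdot)=\Pi_\lambda$; $\mathbb E_\lambda$ is the corresponding expectation. For measurable $f:\mathbf N\to\mathbb R$ and $x\in\mathbb X$, $D_xf(\varphi):=f(\varphi+\delta_x)-f(\varphi)$. The function $x\mapsto\mathbb E_\lambda D_xf(\Phi)$ is understood almost everywhere with respect to the (total variation of the) measure against which it is integrated. If $\theta_0$ is an endpoint of $I$, limit and derivative at $\theta_0$ are one-sided. *)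

theory Defs
  imports "HOL-Probability.Probability"
begin

text \<open>
  A measurable space is represented by a measure \<open>X\<close> of which only \<open>space X\<close> and \<open>sets X\<close> are used.
\<close>

definition point_measures :: "'a measure \<Rightarrow> 'a measure set" where
  "point_measures X =
    {\<phi>. sets \<phi> = sets X \<and> sigma_finite_measure \<phi> \<and>
        (\<forall>B\<in>sets X. emeasure \<phi> B \<in> range ennreal_of_enat)}"

text \<open>
  The smallest sigma-algebra making all evaluation maps \<open>\<phi> \<mapsto> \<phi> B\<close> measurable, in the style of
  \<^const>\<open>subprob_algebra\<close>.
\<close>

definition point_measure_algebra :: "'a measure \<Rightarrow> 'a measure measure" where
  "point_measure_algebra X =
    (SUP B \<in> sets X. vimage_algebra (point_measures X) (\<lambda>\<phi>. emeasure \<phi> B) borel)"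

definition add_measure :: "'a measure \<Rightarrow> 'a measure \<Rightarrow> 'a measure" where
  "add_measure \<phi> \<psi> =
    measure_of (space \<phi>) (sets \<phi>) (\<lambda>B. emeasure \<phi> B + emeasure \<psi> B)"

text \<open>Here \<open>return X x\<close> is the Dirac measure at \<open>x\<close>.\<close>

definition diff_op :: "'a measure \<Rightarrow> 'a \<Rightarrow> ('a measure \<Rightarrow> real) \<Rightarrow> 'a measure \<Rightarrow> real" where
  "diff_op X x f \<phi> = f (add_measure \<phi> (return X x)) - f \<phi>"

text \<open>
  \<open>\<eta>\<close> is a Poisson process on \<open>X\<close> with intensity measure \<open>\<mu>\<close>, defined on the probability space \<open>M\<close>;
  equivalently, the distribution of \<open>\<eta>\<close> under \<open>M\<close> is \<open>\<Pi>\<^sub>\<mu>\<close>.  The Poisson distribution with infinite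
  mean is the point mass at infinity, and the one with mean 0 is the point mass at 0 (as \<open>0 ^ 0 = 1\<close>).
\<close>

definition poisson_process ::
  "'w measure \<Rightarrow> 'a measure \<Rightarrow> 'a measure \<Rightarrow> ('w \<Rightarrow> 'a measure) \<Rightarrow> bool" where
  "poisson_process M X \<mu> \<eta> \<longleftrightarrow>
    prob_space M \<and>
    \<eta> \<in> measurable M (point_measure_algebra X) \<and>
    (\<forall>B\<in>sets X. emeasure \<mu> B < \<infinity> \<longrightarrow>
      (\<forall>n. measure M {\<omega>\<in>space M. emeasure (\<eta> \<omega>) B = of_nat n} =
            exp (- measure \<mu> B) * measure \<mu> B ^ n / fact n)) \<and>
    (\<forall>B\<in>sets X. emeasure \<mu> B = \<infinity> \<longrightarrow> (AE \<omega> in M. emeasure (\<eta> \<omega>) B = \<infinity>)) \<and>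
    (\<forall>(m::nat) B. B ` {..<m} \<subseteq> sets X \<and> disjoint_family_on B {..<m} \<longrightarrow>
      prob_space.indep_vars M (\<lambda>_. borel) (\<lambda>i \<omega>. emeasure (\<eta> \<omega>) (B i)) {..<m})"

text \<open>
  The standing setting: one measurable map \<open>\<Phi>\<close> on a measurable space \<open>\<Omega>\<close>, and for each
  sigma-finite \<open>\<mu>\<close> a probability measure \<open>P \<mu>\<close> on \<open>\<Omega>\<close> under which \<open>\<Phi>\<close> has distribution \<open>\<Pi>\<^sub>\<mu>\<close>.
\<close>

definition poisson_family ::
  "'w measure \<Rightarrow> 'a measure \<Rightarrow> ('w \<Rightarrow> 'a measure) \<Rightarrow> ('a measure \<Rightarrow> 'w measure) \<Rightarrow> bool" where
  "poisson_family \<Omega> X \<Phi> P \<longleftrightarrow>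
    \<Phi> \<in> measurable \<Omega> (point_measure_algebra X) \<and>
    (\<forall>\<mu>. sets \<mu> = sets X \<and> sigma_finite_measure \<mu> \<longrightarrow>
      sets (P \<mu>) = sets \<Omega> \<and> poisson_process (P \<mu>) X \<mu> \<Phi>)"

lemma space_point_measure_algebra: "space (point_measure_algebra X) = point_measures X"
  unfolding point_measure_algebra_def by (subst space_Sup_eq_UN) auto

lemma measurable_emeasure_point_measure [measurable]:
  "B \<in> sets X \<Longrightarrow> (\<lambda>\<phi>. emeasure \<phi> B) \<in> borel_measurable (point_measure_algebra X)"
  unfolding point_measure_algebra_def
  by (auto intro!: measurable_Sup1 measurable_vimage_algebra1)

lemma space_add_measure [simp]: "space (add_measure \<phi> \<psi>) = space \<phi>"
  and sets_add_measure [simp]: "sets (add_measure \<phi> \<psi>) = sets \<phi>"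
  by (simp_all add: add_measure_def)

lemma emeasure_add_measure:
  assumes "sets \<psi> = sets \<phi>" "B \<in> sets \<phi>"
  shows "emeasure (add_measure \<phi> \<psi>) B = emeasure \<phi> B + emeasure \<psi> B"
  unfolding add_measure_def
proof (rule emeasure_measure_of_sigma)
  show "sigma_algebra (space \<phi>) (sets \<phi>)" ..
  show "positive (sets \<phi>) (\<lambda>B. emeasure \<phi> B + emeasure \<psi> B)"
    by (simp add: positive_def)
  show "countably_additive (sets \<phi>) (\<lambda>B. emeasure \<phi> B + emeasure \<psi> B)"
    using assms(1)
    by (auto simp: countably_additive_def suminf_add[symmetric] suminf_emeasure)
qed (fact assms(2))

lemma add_return_in_point_measures:
  assumes \<phi>: "\<phi> \<in> point_measures X" and x: "x \<in> space X"
  shows "add_measure \<phi> (return X x) \<in> point_measures X"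
proof -
  have s: "sets \<phi> = sets X" and sf: "sigma_finite_measure \<phi>"
    and e: "\<And>B. B \<in> sets X \<Longrightarrow> emeasure \<phi> B \<in> range ennreal_of_enat"
    using \<phi> by (auto simp: point_measures_def)
  have em: "emeasure (add_measure \<phi> (return X x)) B = emeasure \<phi> B + indicator B x"
    if "B \<in> sets X" for B
    using that s by (subst emeasure_add_measure) auto
  obtain A where A: "countable A" "A \<subseteq> sets \<phi>" "\<Union>A = space \<phi>" "\<forall>a\<in>A. emeasure \<phi> a \<noteq> \<infinity>"
    using sigma_finite_measure.sigma_finite_countable[OF sf] by blast
  have "sigma_finite_measure (add_measure \<phi> (return X x))"
  proof (unfold_locales, intro exI[of _ A] conjI ballI)
    fix a assume "a \<in> A"
    then show "emeasure (add_measure \<phi> (return X x)) a \<noteq> \<infinity>"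
      using A s by (subst em) (auto simp: indicator_def)
  qed (use A in auto)
  moreover have "emeasure (add_measure \<phi> (return X x)) B \<in> range ennreal_of_enat"
    if B: "B \<in> sets X" for B
  proof -
    obtain n where n: "emeasure \<phi> B = ennreal_of_enat n" using e[OF B] by auto
    have "emeasure \<phi> B + indicator B x = ennreal_of_enat (n + (if x \<in> B then 1 else 0))"
      unfolding n by (cases n) (auto simp: one_enat_def plus_enat_simps add.commute)
    then show ?thesis using em[OF B] by (metis rangeI)
  qed
  ultimately show ?thesis by (simp add: point_measures_def s)
qed

end

theory Submission
  imports Defs
begin

text \<open>
  Write the intensity as \<open>(1 + u) \<rho>\<close> with \<open>u \<in> L\<^sup>2(\<rho>)\<close>.  For a simple function \<open>w \<ge> 0\<close> supported on a
  set of finite measure, the functional \<open>e\<^sub>w(\<phi>) = exp (- \<integral> w d\<phi>)\<close> has mean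
  \<open>exp (\<integral> v d\<rho>) exp \<langle>u, v\<rangle>\<close> with \<open>v = exp (- w) - 1\<close>, and the second moments of linear combinations
  of such functionals under the intensity \<open>\<rho>\<close> are given by the same kernel \<open>exp \<langle>v, v'\<rangle>\<close>.  This kernel is
  positive definite on all of \<open>L\<^sup>2(\<rho>)\<close>, so a combination of laws and of derivatives of laws, tested
  against \<open>f\<close> in the span of the \<open>e\<^sub>w\<close>, is bounded by its norm in the reproducing kernel Hilbert space
  times the \<open>L\<^sup>2\<close> norm of \<open>f\<close> under the intensity \<open>\<rho>\<close>.  The span is dense in \<open>L\<^sup>2\<close> of any finite family of
  finite measures, which extends the bound to all square integrable \<open>f\<close>; neither densities of the laws
  nor the Mecke equation nor chaos expansions are needed.  The bound puts \<open>x \<mapsto> E D\<^sub>x f\<close> into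
  \<open>L\<^sup>2(\<rho>)\<close>, and the kernel norm of difference quotient minus candidate derivative tends to \<open>0\<close>.
\<close>

section \<open>Square integrable functions and the exponential kernel\<close>

definition square_integrable :: "'a measure \<Rightarrow> ('a \<Rightarrow> real) \<Rightarrow> bool" where
  "square_integrable M u \<longleftrightarrow> u \<in> borel_measurable M \<and> integrable M (\<lambda>x. (u x)\<^sup>2)"

definition inner_on :: "'a measure \<Rightarrow> ('a \<Rightarrow> real) \<Rightarrow> ('a \<Rightarrow> real) \<Rightarrow> real" where
  "inner_on M u v = (\<integral>x. u x * v x \<partial>M)"

lemma square_integrable_mult:
  assumes "square_integrable M u" "square_integrable M v"
  shows "integrable M (\<lambda>x. u x * v x)"
proof (rule Bochner_Integration.integrable_bound)
  show "integrable M (\<lambda>x. (u x)\<^sup>2 + (v x)\<^sup>2)"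
    and "(\<lambda>x. u x * v x) \<in> borel_measurable M"
    using assms by (auto simp: square_integrable_def)
  have "\<bar>a * b\<bar> \<le> a\<^sup>2 + b\<^sup>2" for a b :: real
    using sum_squares_bound[of "\<bar>a\<bar>" "\<bar>b\<bar>"] mult_nonneg_nonneg[OF abs_ge_zero abs_ge_zero, of a b]
    unfolding power2_abs abs_mult by linarith
  then show "AE x in M. norm (u x * v x) \<le> norm ((u x)\<^sup>2 + (v x)\<^sup>2)"
    by (intro AE_I2) (simp)
qed

lemma square_integrable_cmult:
  "square_integrable M u \<Longrightarrow> square_integrable M (\<lambda>x. c * u x)"
  by (auto simp: square_integrable_def power_mult_distrib)

lemma square_integrable_add:
  assumes "square_integrable M u" "square_integrable M v"
  shows "square_integrable M (\<lambda>x. u x + v x)"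
  using assms square_integrable_mult[OF assms]
  by (auto simp: square_integrable_def power2_sum mult.assoc)

lemma square_integrable_bound:
  assumes "square_integrable M u" "v \<in> borel_measurable M" "AE x in M. \<bar>v x\<bar> \<le> \<bar>u x\<bar>"
  shows "square_integrable M v"
  unfolding square_integrable_def
proof (intro conjI)
  show "integrable M (\<lambda>x. (v x)\<^sup>2)"
    by (rule Bochner_Integration.integrable_bound[of _ "\<lambda>x. (u x)\<^sup>2"])
      (use assms in \<open>auto simp: square_integrable_def abs_le_square_iff\<close>)
qed fact

lemma inner_on_commute: "inner_on M u v = inner_on M v u"
  by (simp add: inner_on_def mult.commute)

lemma inner_on_add_right:
  assumes "square_integrable M u" "square_integrable M v" "square_integrable M w"
  shows "inner_on M u (\<lambda>x. v x + c * w x) = inner_on M u v + c * inner_on M u w"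
  using square_integrable_mult[OF assms(1,2)] square_integrable_mult[OF assms(1,3)]
  by (simp add: inner_on_def distrib_left mult.left_commute[of "u _" c])

lemma inner_on_add_left:
  assumes "square_integrable M u" "square_integrable M v" "square_integrable M w"
  shows "inner_on M (\<lambda>x. v x + c * w x) u = inner_on M v u + c * inner_on M w u"
  using inner_on_add_right[OF assms, of c] by (simp add: inner_on_commute)

lemma inner_on_self_nonneg: "0 \<le> inner_on M u u"
  by (simp add: inner_on_def)

lemma discriminant_bound:
  fixes A B C :: real
  assumes "\<And>x. 0 \<le> x\<^sup>2 * A + 2 * x * B + C"
  shows "B\<^sup>2 \<le> A * C"
proof (cases "A = 0")
  case True
  have "B = 0"
  proof (rule ccontr)
    assume "B \<noteq> 0"
    then have "2 * (- (\<bar>C\<bar> + 1) / (2 * B)) * B = - (\<bar>C\<bar> + 1)" by simp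
    then show False using assms[of "- (\<bar>C\<bar> + 1) / (2 * B)"] True by simp
  qed
  then show ?thesis using True by simp
next
  case False
  have "0 \<le> A"
  proof (rule ccontr)
    assume "\<not> 0 \<le> A"
    define x where "x = (2 * \<bar>B\<bar> + \<bar>C\<bar> + 1) / (- A) + 1"
    have x: "1 \<le> x" and xA: "x * A = - (2 * \<bar>B\<bar> + \<bar>C\<bar> + 1) + A"
      using \<open>\<not> 0 \<le> A\<close> by (auto simp: x_def field_simps)
    have "x\<^sup>2 * A + 2 * x * B + C = x * (x * A + 2 * B) + C"
      by (simp add: power2_eq_square algebra_simps)
    also have "\<dots> \<le> 1 * (x * A + 2 * B) + C"
      using x xA \<open>\<not> 0 \<le> A\<close> by (intro add_right_mono mult_right_mono_neg) auto
    also have "\<dots> < 0" using xA \<open>\<not> 0 \<le> A\<close> by auto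
    finally show False using assms[of x] by simp
  qed
  then show ?thesis using assms[of "- B / A"] False
    by (simp add: field_simps power2_eq_square)
qed

lemma inner_on_Cauchy_Schwarz:
  assumes "square_integrable M u" "square_integrable M v"
  shows "(inner_on M u v)\<^sup>2 \<le> inner_on M u u * inner_on M v v"
proof (rule discriminant_bound)
  fix x :: real
  have "0 \<le> inner_on M (\<lambda>y. v y + x * u y) (\<lambda>y. v y + x * u y)"
    by (rule inner_on_self_nonneg)
  also have "\<dots> = x\<^sup>2 * inner_on M u u + 2 * x * inner_on M u v + inner_on M v v"
    using assms by (simp add: inner_on_add_right inner_on_add_left square_integrable_add
        square_integrable_cmult inner_on_commute[of M v u] power2_eq_square algebra_simps)
  finally show "0 \<le> x\<^sup>2 * inner_on M u u + 2 * x * inner_on M u v + inner_on M v v" .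
qed

lemma inner_power_psd:
  assumes "finite J" "\<And>j. j \<in> J \<Longrightarrow> square_integrable M (z j)"
  shows "0 \<le> (\<Sum>i\<in>J. \<Sum>j\<in>J. c i * c j * inner_on M (z i) (z j) ^ n)"
proof (induction n arbitrary: c)
  case 0
  have "(\<Sum>i\<in>J. \<Sum>j\<in>J. c i * c j) = (\<Sum>i\<in>J. c i)\<^sup>2"
    by (simp add: power2_eq_square sum_product)
  then show ?case by simp
next
  case (Suc n)
  let ?k = "\<lambda>i j. inner_on M (z i) (z j) ^ n"
  have "0 \<le> (\<integral>x. (\<Sum>i\<in>J. \<Sum>j\<in>J. (c i * z i x) * (c j * z j x) * ?k i j) \<partial>M)"
    by (intro integral_nonneg_AE AE_I2 Suc)
  also have "\<dots> = (\<integral>x. (\<Sum>i\<in>J. \<Sum>j\<in>J. (c i * c j * ?k i j) * (z i x * z j x)) \<partial>M)"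
    by (intro Bochner_Integration.integral_cong refl sum.cong) (simp add: algebra_simps)
  also have "\<dots> = (\<Sum>i\<in>J. \<Sum>j\<in>J. (c i * c j * ?k i j) * inner_on M (z i) (z j))"
    using assms by (simp add: inner_on_def square_integrable_mult)
  finally show ?case by (simp add: mult_ac)
qed

lemma exp_inner_psd:
  assumes "finite J" "\<And>j. j \<in> J \<Longrightarrow> square_integrable M (z j)"
  shows "0 \<le> (\<Sum>i\<in>J. \<Sum>j\<in>J. c i * c j * exp (inner_on M (z i) (z j)))"
proof (rule sums_le[OF _ sums_zero])
  show "(\<lambda>n. \<Sum>i\<in>J. \<Sum>j\<in>J. c i * c j * (inner_on M (z i) (z j) ^ n /\<^sub>R fact n))
      sums (\<Sum>i\<in>J. \<Sum>j\<in>J. c i * c j * exp (inner_on M (z i) (z j)))"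
    by (intro sums_sum sums_mult exp_converges)
  show "0 \<le> (\<Sum>i\<in>J. \<Sum>j\<in>J. c i * c j * (inner_on M (z i) (z j) ^ n /\<^sub>R fact n))" for n
  proof -
    have "(\<Sum>i\<in>J. \<Sum>j\<in>J. c i * c j * (inner_on M (z i) (z j) ^ n /\<^sub>R fact n))
        = (\<Sum>i\<in>J. \<Sum>j\<in>J. c i * c j * inner_on M (z i) (z j) ^ n) / fact n"
      by (simp add: sum_divide_distrib sum_distrib_left divide_inverse mult_ac)
    then show ?thesis using inner_power_psd[OF assms] by simp
  qed
qed

lemma exp_inner_Cauchy_Schwarz:
  assumes "finite J" "\<And>j. j \<in> J \<Longrightarrow> square_integrable M (y j)"
    and "finite K" "\<And>k. k \<in> K \<Longrightarrow> square_integrable M (v k)"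
  shows "(\<Sum>j\<in>J. \<Sum>k\<in>K. a j * b k * exp (inner_on M (y j) (v k)))\<^sup>2
    \<le> (\<Sum>i\<in>J. \<Sum>j\<in>J. a i * a j * exp (inner_on M (y i) (y j))) *
      (\<Sum>k\<in>K. \<Sum>l\<in>K. b k * b l * exp (inner_on M (v k) (v l)))"
proof (rule discriminant_bound)
  fix x :: real
  define z where "z = case_sum y v"
  define c where "c = case_sum (\<lambda>j. x * a j) b"
  have "0 \<le> (\<Sum>i\<in>J <+> K. \<Sum>j\<in>J <+> K. c i * c j * exp (inner_on M (z i) (z j)))"
    using assms by (intro exp_inner_psd) (auto simp: z_def)
  also have "\<dots> = x\<^sup>2 * (\<Sum>i\<in>J. \<Sum>j\<in>J. a i * a j * exp (inner_on M (y i) (y j)))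
      + x * (\<Sum>j\<in>J. \<Sum>k\<in>K. a j * b k * exp (inner_on M (y j) (v k)))
      + x * (\<Sum>k\<in>K. \<Sum>j\<in>J. a j * b k * exp (inner_on M (y j) (v k)))
      + (\<Sum>k\<in>K. \<Sum>l\<in>K. b k * b l * exp (inner_on M (v k) (v l)))"
    using assms(1,3)
    by (simp add: sum.Plus z_def c_def sum.distrib sum_distrib_left power2_eq_square mult_ac
        inner_on_commute[of M "v _" "y _"])
  also have "(\<Sum>k\<in>K. \<Sum>j\<in>J. a j * b k * exp (inner_on M (y j) (v k)))
      = (\<Sum>j\<in>J. \<Sum>k\<in>K. a j * b k * exp (inner_on M (y j) (v k)))" by (rule sum.swap)
  finally show "0 \<le> x\<^sup>2 * (\<Sum>i\<in>J. \<Sum>j\<in>J. a i * a j * exp (inner_on M (y i) (y j)))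
      + 2 * x * (\<Sum>j\<in>J. \<Sum>k\<in>K. a j * b k * exp (inner_on M (y j) (v k)))
      + (\<Sum>k\<in>K. \<Sum>l\<in>K. b k * b l * exp (inner_on M (v k) (v l)))" by simp
qed

section \<open>Exponential functionals of point measures\<close>

definition exp_neg :: "ennreal \<Rightarrow> real" where
  "exp_neg t = (if t = \<infinity> then 0 else exp (- enn2real t))"

lemma exp_neg_measurable [measurable]: "exp_neg \<in> borel_measurable borel"
  unfolding exp_neg_def[abs_def] by measurable

lemma exp_neg_nonneg: "0 \<le> exp_neg t" and exp_neg_le_1: "exp_neg t \<le> 1"
  by (auto simp: exp_neg_def)

lemma exp_neg_0 [simp]: "exp_neg 0 = 1"
  by (simp add: exp_neg_def)

lemma exp_neg_ennreal: "0 \<le> r \<Longrightarrow> exp_neg (ennreal r) = exp (- r)"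
  by (simp add: exp_neg_def)

lemma exp_neg_add: "exp_neg (s + t) = exp_neg s * exp_neg t"
  by (cases s; cases t) (auto simp: exp_neg_def exp_add[symmetric] simp flip: ennreal_plus)

lemma exp_neg_sum: "finite A \<Longrightarrow> exp_neg (\<Sum>i\<in>A. g i) = (\<Prod>i\<in>A. exp_neg (g i))"
  by (induction A rule: finite_induct) (auto simp: exp_neg_add)

definition exp_functional :: "('a \<Rightarrow> real) \<Rightarrow> 'a measure \<Rightarrow> real" where
  "exp_functional w \<phi> = exp_neg (\<integral>\<^sup>+x. ennreal (w x) \<partial>\<phi>)"

definition test_functions :: "'a measure \<Rightarrow> ('a \<Rightarrow> real) set" where
  "test_functions \<rho> = {w. simple_function \<rho> w \<and> (\<forall>x. 0 \<le> w x) \<and>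
     emeasure \<rho> {x\<in>space \<rho>. w x \<noteq> 0} < \<infinity>}"

lemma exp_functional_nonneg: "0 \<le> exp_functional w \<phi>"
  and exp_functional_le_1: "exp_functional w \<phi> \<le> 1"
  by (auto simp: exp_functional_def exp_neg_nonneg exp_neg_le_1)

lemma simple_function_cong_sets:
  assumes "sets M = sets N" shows "simple_function M w = simple_function N w"
  using assms sets_eq_imp_space_eq[OF assms] by (simp add: simple_function_def)

lemma nn_integral_simple_levels:
  assumes "simple_function M w" "\<And>x. 0 \<le> w x"
  shows "(\<integral>\<^sup>+x. ennreal (w x) \<partial>M) =
    (\<Sum>y\<in>w ` space M. ennreal y * emeasure M (w -` {y} \<inter> space M))"
proof -
  have fin: "finite (w ` space M)" and s: "\<And>y. w -` {y} \<inter> space M \<in> sets M"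
    using assms(1) by (auto simp: simple_functionD)
  have "(\<integral>\<^sup>+x. ennreal (w x) \<partial>M)
      = (\<integral>\<^sup>+x. (\<Sum>y\<in>w ` space M. ennreal y * indicator (w -` {y} \<inter> space M) x) \<partial>M)"
  proof (intro nn_integral_cong)
    fix x assume x: "x \<in> space M"
    have "(\<Sum>y\<in>w ` space M. ennreal y * indicator (w -` {y} \<inter> space M) x)
        = (\<Sum>y\<in>w ` space M. if y = w x then ennreal y else 0)"
      using x by (intro sum.cong) (auto simp: indicator_def)
    then show "ennreal (w x) = (\<Sum>y\<in>w ` space M. ennreal y * indicator (w -` {y} \<inter> space M) x)"
      using x fin by simp
  qed
  also have "\<dots> = (\<Sum>y\<in>w ` space M. ennreal y * emeasure M (w -` {y} \<inter> space M))"
    using s by (simp add: nn_integral_sum nn_integral_cmult_indicator)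
  finally show ?thesis .
qed

lemma exp_functional_levels:
  assumes "simple_function X w" "\<And>x. 0 \<le> w x" "sets \<phi> = sets X"
  shows "exp_functional w \<phi> =
    (\<Prod>y\<in>w ` space X. exp_neg (ennreal y * emeasure \<phi> (w -` {y} \<inter> space X)))"
proof -
  have "simple_function \<phi> w" "space \<phi> = space X"
    using assms simple_function_cong_sets[OF assms(3)] sets_eq_imp_space_eq[OF assms(3)] by auto
  then show ?thesis
    unfolding exp_functional_def using assms simple_functionD(1)[OF assms(1)]
    by (simp add: nn_integral_simple_levels exp_neg_sum)
qed

lemma exp_functional_measurable:
  assumes "simple_function X w" "\<And>x. 0 \<le> w x"
  shows "exp_functional w \<in> borel_measurable (point_measure_algebra X)"
proof -
  have [measurable]: "w -` {y} \<inter> space X \<in> sets X" for y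
    using assms(1) by (simp add: simple_functionD)
  have "(\<lambda>\<phi>. \<Prod>y\<in>w ` space X. exp_neg (ennreal y * emeasure \<phi> (w -` {y} \<inter> space X)))
      \<in> borel_measurable (point_measure_algebra X)"
    by measurable
  then show ?thesis
    by (rule measurable_cong[THEN iffD1, rotated])
      (use exp_functional_levels[OF assms] in
        \<open>auto simp: space_point_measure_algebra point_measures_def\<close>)
qed

lemma exp_functional_add_return:
  assumes w: "simple_function X w" "\<And>x. 0 \<le> w x" and \<phi>: "sets \<phi> = sets X" and x: "x \<in> space X"
  shows "exp_functional w (add_measure \<phi> (return X x)) = exp_functional w \<phi> * exp (- w x)"
proof -
  have s: "w -` {y} \<inter> space X \<in> sets X" for y
    using w(1) by (simp add: simple_functionD)
  have "(\<Prod>y\<in>w ` space X. exp_neg (ennreal y * indicator (w -` {y} \<inter> space X) x))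
      = (\<Prod>y\<in>w ` space X. if y = w x then exp (- y) else 1)"
    using x w(2) by (intro prod.cong) (auto simp: indicator_def exp_neg_ennreal)
  also have "\<dots> = exp (- w x)"
    using x simple_functionD(1)[OF w(1)] by simp
  finally show ?thesis
    using s \<phi> w by (subst (1 2) exp_functional_levels[of X])
      (auto simp: emeasure_add_measure distrib_left exp_neg_add prod.distrib)
qed

lemma exp_functional_add:
  assumes "simple_function X w" "\<And>x. 0 \<le> w x" "simple_function X w'" "\<And>x. 0 \<le> w' x"
    and "sets \<phi> = sets X"
  shows "exp_functional (\<lambda>x. w x + w' x) \<phi> = exp_functional w \<phi> * exp_functional w' \<phi>"
proof -
  have "w \<in> borel_measurable \<phi>" "w' \<in> borel_measurable \<phi>"
    using assms(1,3) measurable_cong_sets[OF assms(5) refl]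
    by (auto intro: borel_measurable_simple_function)
  then show ?thesis
    using assms by (simp add: exp_functional_def nn_integral_add exp_neg_add)
qed

lemma Poisson_exp_neg:
  assumes P: "poisson_process M X \<mu> \<eta>" and A: "A \<in> sets X" "emeasure \<mu> A < \<infinity>" and y: "0 \<le> y"
  shows "(\<integral>\<omega>. exp_neg (ennreal y * emeasure (\<eta> \<omega>) A) \<partial>M) = exp ((exp (- y) - 1) * measure \<mu> A)"
proof -
  interpret prob_space M using P by (simp add: poisson_process_def)
  have [measurable]: "\<eta> \<in> measurable M (point_measure_algebra X)"
    using P by (simp add: poisson_process_def)
  note A(1)[measurable]
  define S where "S n = {\<omega>\<in>space M. emeasure (\<eta> \<omega>) A = of_nat n}" for n :: nat
  have S [measurable]: "S n \<in> sets M" for n unfolding S_def by measurable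
  have pS: "measure M (S n) = exp (- measure \<mu> A) * measure \<mu> A ^ n / fact n" for n
    using P A by (auto simp: poisson_process_def S_def)
  have exps: "(\<lambda>n. exp (- measure \<mu> A) * (z * measure \<mu> A) ^ n / fact n)
      sums (exp (- measure \<mu> A) * exp (z * measure \<mu> A))" for z
    using sums_mult[OF exp_converges[of "z * measure \<mu> A"], of "exp (- measure \<mu> A)"]
    by (simp add: divide_inverse mult_ac)
  have disj: "disjoint_family S" by (auto simp: disjoint_family_on_def S_def)
  have "(\<lambda>n. measure M (S n)) sums measure M (\<Union>n. S n)"
    by (rule finite_measure_UNION) (use disj in auto)
  moreover have "(\<lambda>n. measure M (S n)) sums 1"
    using exps[of 1] by (simp add: pS flip: exp_add)
  ultimately have "measure M (\<Union>n. S n) = 1" by (rule sums_unique2)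
  then have AE: "AE \<omega> in M. \<omega> \<in> (\<Union>n. S n)"
    by (subst prob_eq_1[symmetric]) auto
  have "(\<integral>\<^sup>+\<omega>. exp_neg (ennreal y * emeasure (\<eta> \<omega>) A) \<partial>M)
      = (\<integral>\<^sup>+\<omega>. (\<Sum>n. ennreal (exp (- y) ^ n) * indicator (S n) \<omega>) \<partial>M)"
    using AE
  proof (intro nn_integral_cong_AE, eventually_elim)
    fix \<omega> assume "\<omega> \<in> (\<Union>n. S n)"
    then obtain k where k: "\<omega> \<in> S k" by auto
    have "(\<Sum>n. ennreal (exp (- y) ^ n) * indicator (S n) \<omega>)
        = (\<Sum>n. if n = k then ennreal (exp (- y) ^ n) else 0)"
      by (intro suminf_cong) (use k in \<open>auto simp: S_def indicator_def\<close>)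
    also have "\<dots> = ennreal (exp (- y) ^ k)"
      by (rule sums_unique[symmetric]) (rule sums_single)
    also have "exp (- y) ^ k = exp_neg (ennreal y * emeasure (\<eta> \<omega>) A)"
    proof -
      have "ennreal y * emeasure (\<eta> \<omega>) A = ennreal (y * real k)"
        using k y by (simp add: S_def ennreal_of_nat_eq_real_of_nat ennreal_mult)
      then show ?thesis using y by (simp add: exp_neg_ennreal exp_of_nat_mult[symmetric] mult.commute)
    qed
    finally show "ennreal (exp_neg (ennreal y * emeasure (\<eta> \<omega>) A))
        = (\<Sum>n. ennreal (exp (- y) ^ n) * indicator (S n) \<omega>)" by simp
  qed
  also have "\<dots> = (\<Sum>n. ennreal (exp (- measure \<mu> A) * (exp (- y) * measure \<mu> A) ^ n / fact n))"
  proof -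
    have "(\<integral>\<^sup>+\<omega>. ennreal (exp (- y) ^ n) * indicator (S n) \<omega> \<partial>M)
        = ennreal (exp (- measure \<mu> A) * (exp (- y) * measure \<mu> A) ^ n / fact n)" for n
      by (subst nn_integral_cmult_indicator)
        (simp_all add: emeasure_eq_measure pS power_mult_distrib mult_ac flip: ennreal_mult)
    then show ?thesis by (simp add: nn_integral_suminf)
  qed
  also have "\<dots> = ennreal (exp (- measure \<mu> A) * exp (exp (- y) * measure \<mu> A))"
    by (intro suminf_ennreal_eq exps) simp
  also have "exp (- measure \<mu> A) * exp (exp (- y) * measure \<mu> A) = exp ((exp (- y) - 1) * measure \<mu> A)"
    by (simp add: algebra_simps flip: exp_add)
  finally show ?thesis
    by (subst integral_eq_nn_integral) (auto simp: exp_neg_nonneg)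
qed

lemma Poisson_exp_functional:
  assumes P: "poisson_process M X \<mu> \<eta>" and sets: "sets \<mu> = sets X" and w: "w \<in> test_functions \<mu>"
  shows "(\<integral>\<omega>. exp_functional w (\<eta> \<omega>) \<partial>M) = exp (\<integral>x. (exp (- w x) - 1) \<partial>\<mu>)"
proof -
  interpret prob_space M using P by (simp add: poisson_process_def)
  have \<eta>[measurable]: "\<eta> \<in> measurable M (point_measure_algebra X)"
    using P by (simp add: poisson_process_def)
  have sp: "space \<mu> = space X" using sets by (rule sets_eq_imp_space_eq)
  have w': "simple_function X w" "\<And>x. 0 \<le> w x" "emeasure \<mu> {x\<in>space X. w x \<noteq> 0} < \<infinity>"
    using w simple_function_cong_sets[OF sets] by (auto simp: test_functions_def sp)
  have fin: "finite (w ` space X)" using w'(1) by (rule simple_functionD)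
  then obtain v where v: "bij_betw v {..<card (w ` space X)} (w ` space X)"
    using ex_bij_betw_nat_finite[OF fin] by (auto simp: atLeast0LessThan)
  define m where "m = card (w ` space X)"
  define A where "A i = w -` {v i} \<inter> space X" for i
  note v = v[folded m_def]
  have A[measurable]: "A i \<in> sets X" for i using w'(1) by (simp add: simple_functionD A_def)
  have A\<mu>: "A i \<in> sets \<mu>" for i using A sets by simp
  have v0: "0 \<le> v i" if "i < m" for i
  proof -
    have "v i \<in> w ` space X" using bij_betwE[OF v] that by blast
    then show ?thesis using w'(2) by auto
  qed
  have Afin: "emeasure \<mu> (A i) < \<infinity>" if "v i \<noteq> 0" for i
  proof -
    have "{x\<in>space X. w x \<noteq> 0} \<in> sets \<mu>"
      using sets borel_measurable_simple_function[OF w'(1)] by measurable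
    then have "emeasure \<mu> (A i) \<le> emeasure \<mu> {x\<in>space X. w x \<noteq> 0}"
      using that by (intro emeasure_mono) (auto simp: A_def)
    then show ?thesis using w'(3) by (rule le_less_trans)
  qed
  have disj: "disjoint_family_on A {..<m}"
    using v by (auto simp: disjoint_family_on_def A_def bij_betw_def inj_on_def)
  have indep: "indep_vars (\<lambda>_. borel) (\<lambda>i \<omega>. emeasure (\<eta> \<omega>) (A i)) {..<m}"
    using P disj A unfolding poisson_process_def by blast
  have indep': "indep_vars (\<lambda>_. borel) (\<lambda>i \<omega>. exp_neg (ennreal (v i) * emeasure (\<eta> \<omega>) (A i))) {..<m}"
    by (rule indep_vars_compose2[OF indep, where Y = "\<lambda>i t. exp_neg (ennreal (v i) * t)"]) simp
  have "(\<integral>\<omega>. exp_functional w (\<eta> \<omega>) \<partial>M)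
      = (\<integral>\<omega>. (\<Prod>i<m. exp_neg (ennreal (v i) * emeasure (\<eta> \<omega>) (A i))) \<partial>M)"
  proof (intro Bochner_Integration.integral_cong refl)
    fix \<omega> assume "\<omega> \<in> space M"
    then have "\<eta> \<omega> \<in> space (point_measure_algebra X)" by (rule measurable_space[OF \<eta>])
    then have "sets (\<eta> \<omega>) = sets X" by (simp add: space_point_measure_algebra point_measures_def)
    then show "exp_functional w (\<eta> \<omega>) = (\<Prod>i<m. exp_neg (ennreal (v i) * emeasure (\<eta> \<omega>) (A i)))"
      using w' by (simp add: exp_functional_levels[of X] A_def
          prod.reindex_bij_betw[OF v, of "\<lambda>y. exp_neg (ennreal y * emeasure (\<eta> \<omega>) (w -` {y} \<inter> space X))"])
  qed
  also have "\<dots> = (\<Prod>i<m. \<integral>\<omega>. exp_neg (ennreal (v i) * emeasure (\<eta> \<omega>) (A i)) \<partial>M)"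
    by (intro indep_vars_lebesgue_integral indep' finite_lessThan integrable_const_bound[of _ 1])
      (auto simp: exp_neg_nonneg exp_neg_le_1)
  also have "\<dots> = (\<Prod>i<m. exp ((exp (- v i) - 1) * measure \<mu> (A i)))"
  proof (intro prod.cong refl)
    fix i assume "i \<in> {..<m}"
    then show "(\<integral>\<omega>. exp_neg (ennreal (v i) * emeasure (\<eta> \<omega>) (A i)) \<partial>M)
        = exp ((exp (- v i) - 1) * measure \<mu> (A i))"
      using Poisson_exp_neg[OF P A Afin v0] by (cases "v i = 0") (auto simp: prob_space)
  qed
  also have "\<dots> = exp (\<Sum>i<m. (exp (- v i) - 1) * measure \<mu> (A i))"
    by (simp add: exp_sum)
  also have "(\<Sum>i<m. (exp (- v i) - 1) * measure \<mu> (A i))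
      = (\<integral>x. (\<Sum>i<m. (exp (- v i) - 1) * indicator (A i) x) \<partial>\<mu>)"
  proof (subst Bochner_Integration.integral_sum)
    fix i
    show "integrable \<mu> (\<lambda>x. (exp (- v i) - 1) * indicator (A i) x)"
      using Afin[of i] A\<mu> by (cases "v i = 0") auto
  qed (use A\<mu> sets.sets_into_space[OF A\<mu>] in \<open>simp add: Int_absorb2\<close>)
  also have "\<dots> = (\<integral>x. (exp (- w x) - 1) \<partial>\<mu>)"
  proof (intro Bochner_Integration.integral_cong refl)
    fix x assume x: "x \<in> space \<mu>"
    have "(\<Sum>i<m. (exp (- v i) - 1) * indicator (A i) x)
        = (\<Sum>y\<in>w ` space X. (exp (- y) - 1) * indicator (w -` {y} \<inter> space X) x)"
      unfolding A_def by (rule sum.reindex_bij_betw[OF v])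
    also have "\<dots> = (\<Sum>y\<in>w ` space X. if y = w x then exp (- y) - 1 else 0)"
      using x sp by (intro sum.cong) (auto simp: indicator_def)
    also have "\<dots> = exp (- w x) - 1" using x sp fin by simp
    finally show "(\<Sum>i<m. (exp (- v i) - 1) * indicator (A i) x) = exp (- w x) - 1" .
  qed
  finally show ?thesis .
qed

section \<open>Density in \<open>L\<^sup>2\<close> of algebras of bounded functions\<close>

locale function_algebra =
  fixes N :: "'b measure" and Ms :: "'b measure set" and A :: "('b \<Rightarrow> real) set"
  assumes finite_Ms: "finite Ms"
    and finite_measure_Ms: "M \<in> Ms \<Longrightarrow> finite_measure M"
    and sets_Ms: "M \<in> Ms \<Longrightarrow> sets M = sets N"
    and A_measurable: "f \<in> A \<Longrightarrow> f \<in> borel_measurable N"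
    and A_bounded: "f \<in> A \<Longrightarrow> \<exists>C. \<forall>x\<in>space N. \<bar>f x\<bar> \<le> C"
    and A_const: "(\<lambda>_. c) \<in> A"
    and A_add: "f \<in> A \<Longrightarrow> g \<in> A \<Longrightarrow> (\<lambda>x. f x + g x) \<in> A"
    and A_mult: "f \<in> A \<Longrightarrow> g \<in> A \<Longrightarrow> (\<lambda>x. f x * g x) \<in> A"
begin

definition bfun :: "('b \<Rightarrow> real) set" where
  "bfun = {f \<in> borel_measurable N. \<exists>C. \<forall>x\<in>space N. \<bar>f x\<bar> \<le> C}"

definition L2_closure :: "('b \<Rightarrow> real) set" where
  "L2_closure = {f \<in> bfun. \<forall>\<epsilon>>0. \<exists>g\<in>A. \<forall>M\<in>Ms. (\<integral>x. (f x - g x)\<^sup>2 \<partial>M) < \<epsilon>}"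

lemma bfun_bound:
  assumes "f \<in> bfun"
  shows "\<exists>C\<ge>0. \<forall>x\<in>space N. \<bar>f x\<bar> \<le> C"
proof -
  obtain C where C: "\<forall>x\<in>space N. \<bar>f x\<bar> \<le> C"
    using assms by (auto simp: bfun_def)
  have "\<bar>f x\<bar> \<le> \<bar>C\<bar>" if "x \<in> space N" for x
    using C[rule_format, OF that] by linarith
  then show ?thesis by (intro exI[of _ "\<bar>C\<bar>"]) auto
qed

lemma bfun_measurable: "f \<in> bfun \<Longrightarrow> f \<in> borel_measurable N"
  by (simp add: bfun_def)

lemma bfun_add: assumes "f \<in> bfun" "g \<in> bfun" shows "(\<lambda>x. f x + g x) \<in> bfun"
proof -
  obtain C where f: "\<forall>x\<in>space N. \<bar>f x\<bar> \<le> C"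
    using bfun_bound[OF assms(1)] by auto
  obtain D where g: "\<forall>x\<in>space N. \<bar>g x\<bar> \<le> D"
    using bfun_bound[OF assms(2)] by auto
  have "\<bar>f x + g x\<bar> \<le> C + D" if "x \<in> space N" for x
    using f[rule_format, OF that] g[rule_format, OF that] by linarith
  then show ?thesis using assms[THEN bfun_measurable] by (auto simp: bfun_def)
qed

lemma bfun_mult: assumes "f \<in> bfun" "g \<in> bfun" shows "(\<lambda>x. f x * g x) \<in> bfun"
proof -
  obtain C where "0 \<le> C" and f: "\<forall>x\<in>space N. \<bar>f x\<bar> \<le> C"
    using bfun_bound[OF assms(1)] by auto
  obtain D where g: "\<forall>x\<in>space N. \<bar>g x\<bar> \<le> D"
    using bfun_bound[OF assms(2)] by auto
  have "\<bar>f x * g x\<bar> \<le> C * D" if "x \<in> space N" for x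
    unfolding abs_mult using f that g \<open>0 \<le> C\<close> by (intro mult_mono) auto
  then show ?thesis using assms[THEN bfun_measurable] by (auto simp: bfun_def)
qed

lemma bfun_const: "(\<lambda>_. c) \<in> bfun"
  by (auto simp: bfun_def)

lemma bfun_minus: "f \<in> bfun \<Longrightarrow> g \<in> bfun \<Longrightarrow> (\<lambda>x. f x - g x) \<in> bfun"
  using bfun_add[of f "\<lambda>x. -1 * g x"] bfun_mult[of "\<lambda>_. -1" g] bfun_const[of "-1"] by simp

lemma A_bfun: "f \<in> A \<Longrightarrow> f \<in> bfun"
  using A_measurable A_bounded by (auto simp: bfun_def)

lemma space_Ms: "M \<in> Ms \<Longrightarrow> space M = space N"
  by (rule sets_eq_imp_space_eq) (rule sets_Ms)

lemma bfun_integrable: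
  assumes "f \<in> bfun" "M \<in> Ms" shows "integrable M f"
proof -
  interpret finite_measure M using assms(2) by (rule finite_measure_Ms)
  obtain C where "\<forall>x\<in>space N. \<bar>f x\<bar> \<le> C"
    using bfun_bound[OF assms(1)] by auto
  then show ?thesis
    using bfun_measurable[OF assms(1)] space_Ms[OF assms(2)] measurable_cong_sets[OF sets_Ms[OF assms(2)] refl]
    by (intro integrable_const_bound[of _ C]) auto
qed

lemma bfun_square_integrable:
  assumes "f \<in> bfun" "M \<in> Ms" shows "integrable M (\<lambda>x. (f x)\<^sup>2)"
  using bfun_integrable[OF bfun_mult[OF assms(1,1)] assms(2)] by (simp add: power2_eq_square)

lemma L2_closure_bfun: "f \<in> L2_closure \<Longrightarrow> f \<in> bfun"
  by (simp add: L2_closure_def)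

lemma L2_closureD:
  "f \<in> L2_closure \<Longrightarrow> 0 < \<epsilon> \<Longrightarrow> \<exists>g\<in>A. \<forall>M\<in>Ms. (\<integral>x. (f x - g x)\<^sup>2 \<partial>M) < \<epsilon>"
  by (simp add: L2_closure_def)

lemma integral_square_triangle:
  assumes "f \<in> bfun" "g \<in> bfun" "M \<in> Ms"
  shows "(\<integral>x. (f x + g x)\<^sup>2 \<partial>M) \<le> 2 * (\<integral>x. (f x)\<^sup>2 \<partial>M) + 2 * (\<integral>x. (g x)\<^sup>2 \<partial>M)"
proof -
  have "(\<integral>x. (f x + g x)\<^sup>2 \<partial>M) \<le> (\<integral>x. 2 * (f x)\<^sup>2 + 2 * (g x)\<^sup>2 \<partial>M)"
  proof (rule integral_mono)
    show "(f x + g x)\<^sup>2 \<le> 2 * (f x)\<^sup>2 + 2 * (g x)\<^sup>2" for x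
      using sum_squares_bound[of "f x" "g x"] by (simp add: power2_sum)
  qed (use assms in \<open>auto intro!: bfun_square_integrable bfun_add\<close>)
  then show ?thesis using assms by (simp add: bfun_square_integrable)
qed

lemma L2_closure_approx:
  assumes f: "f \<in> bfun"
    and approx: "\<And>\<epsilon>. 0 < \<epsilon> \<Longrightarrow> \<exists>g\<in>L2_closure. \<forall>M\<in>Ms. (\<integral>x. (f x - g x)\<^sup>2 \<partial>M) < \<epsilon>"
  shows "f \<in> L2_closure"
  unfolding L2_closure_def
proof (intro CollectI conjI f allI impI)
  fix \<epsilon> :: real assume "0 < \<epsilon>"
  then obtain g where g: "g \<in> L2_closure" "\<forall>M\<in>Ms. (\<integral>x. (f x - g x)\<^sup>2 \<partial>M) < \<epsilon> / 4"
    using approx[of "\<epsilon> / 4"] by auto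
  obtain e where e: "e \<in> A" "\<forall>M\<in>Ms. (\<integral>x. (g x - e x)\<^sup>2 \<partial>M) < \<epsilon> / 4"
    using L2_closureD[OF g(1), of "\<epsilon> / 4"] \<open>0 < \<epsilon>\<close> by auto
  have "(\<integral>x. (f x - e x)\<^sup>2 \<partial>M) < \<epsilon>" if M: "M \<in> Ms" for M
    using integral_square_triangle[of "\<lambda>x. f x - g x" "\<lambda>x. g x - e x" M] M g e f
    by (force simp: bfun_minus A_bfun L2_closure_bfun)
  then show "\<exists>g\<in>A. \<forall>M\<in>Ms. (\<integral>x. (f x - g x)\<^sup>2 \<partial>M) < \<epsilon>" using e(1) by blast
qed

lemma A_L2_closure: "f \<in> A \<Longrightarrow> f \<in> L2_closure"
  unfolding L2_closure_def by (auto intro!: A_bfun bexI[of _ f])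

lemma L2_closure_limit:
  assumes g: "\<And>n. g n \<in> L2_closure" and f: "f \<in> borel_measurable N"
    and bound: "\<And>n x. x \<in> space N \<Longrightarrow> \<bar>g n x\<bar> \<le> C"
    and lim: "\<And>x. x \<in> space N \<Longrightarrow> (\<lambda>n. g n x) \<longlonglongrightarrow> f x"
  shows "f \<in> L2_closure"
proof (rule L2_closure_approx)
  have fC: "\<bar>f x\<bar> \<le> C" if "x \<in> space N" for x
    using lim[OF that, THEN tendsto_rabs] bound[OF that] by (intro LIMSEQ_le_const2) auto
  then show fb: "f \<in> bfun" using f by (auto simp: bfun_def)
  fix \<epsilon> :: real assume \<epsilon>: "0 < \<epsilon>"
  have "(\<lambda>n. \<integral>x. (f x - g n x)\<^sup>2 \<partial>M) \<longlonglongrightarrow> 0" if M: "M \<in> Ms" for M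
  proof -
    interpret finite_measure M using M by (rule finite_measure_Ms)
    have meas: "(\<lambda>x. (f x - g n x)\<^sup>2) \<in> borel_measurable M" for n
      by (rule borel_measurable_integrable)
        (intro bfun_square_integrable bfun_minus fb L2_closure_bfun g M)
    have "(\<lambda>n. \<integral>x. (f x - g n x)\<^sup>2 \<partial>M) \<longlonglongrightarrow> (\<integral>x. 0 \<partial>M)"
    proof (rule integral_dominated_convergence[where w = "\<lambda>_. (2 * C)\<^sup>2"])
      show "AE x in M. (\<lambda>n. (f x - g n x)\<^sup>2) \<longlonglongrightarrow> 0"
      proof (intro AE_I2)
        fix x assume "x \<in> space M"
        then have "(\<lambda>n. (f x - g n x)\<^sup>2) \<longlonglongrightarrow> (f x - f x)\<^sup>2"
          using space_Ms[OF M] by (intro tendsto_intros lim) auto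
        then show "(\<lambda>n. (f x - g n x)\<^sup>2) \<longlonglongrightarrow> 0" by simp
      qed
      show "AE x in M. norm ((f x - g n x)\<^sup>2) \<le> (2 * C)\<^sup>2" for n
      proof (intro AE_I2)
        fix x assume "x \<in> space M"
        then have "x \<in> space N" using space_Ms[OF M] by simp
        then have "\<bar>f x - g n x\<bar> \<le> \<bar>2 * C\<bar>" using fC[of x] bound[of x n] by linarith
        then show "norm ((f x - g n x)\<^sup>2) \<le> (2 * C)\<^sup>2" by (simp add: abs_le_square_iff)
      qed
    qed (use meas in auto)
    then show ?thesis by simp
  qed
  then have "\<forall>\<^sub>F n in sequentially. \<forall>M\<in>Ms. (\<integral>x. (f x - g n x)\<^sup>2 \<partial>M) < \<epsilon>"
    using finite_Ms \<epsilon> by (intro eventually_ball_finite ballI order_tendstoD(2)[where y = 0])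
  then show "\<exists>g\<in>L2_closure. \<forall>M\<in>Ms. (\<integral>x. (f x - g x)\<^sup>2 \<partial>M) < \<epsilon>"
    using g unfolding eventually_sequentially by blast
qed

lemma L2_closure_add:
  assumes "f \<in> L2_closure" "g \<in> L2_closure" shows "(\<lambda>x. f x + g x) \<in> L2_closure"
  unfolding L2_closure_def
proof (intro CollectI conjI allI impI)
  show "(\<lambda>x. f x + g x) \<in> bfun" using assms by (intro bfun_add L2_closure_bfun)
  fix \<epsilon> :: real assume "0 < \<epsilon>"
  then obtain e e' where e: "e \<in> A" "\<forall>M\<in>Ms. (\<integral>x. (f x - e x)\<^sup>2 \<partial>M) < \<epsilon> / 4"
    "e' \<in> A" "\<forall>M\<in>Ms. (\<integral>x. (g x - e' x)\<^sup>2 \<partial>M) < \<epsilon> / 4"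
    using L2_closureD[OF assms(1), of "\<epsilon> / 4"] L2_closureD[OF assms(2), of "\<epsilon> / 4"] by auto
  have "(\<integral>x. (f x + g x - (e x + e' x))\<^sup>2 \<partial>M) < \<epsilon>" if M: "M \<in> Ms" for M
    using integral_square_triangle[of "\<lambda>x. f x - e x" "\<lambda>x. g x - e' x" M] M e assms
    by (force simp: bfun_minus A_bfun L2_closure_bfun algebra_simps)
  then show "\<exists>h\<in>A. \<forall>M\<in>Ms. (\<integral>x. (f x + g x - h x)\<^sup>2 \<partial>M) < \<epsilon>"
    by (intro bexI[OF _ A_add[OF e(1,3)]] ballI)
qed

lemma L2_closure_mult_aux:
  assumes f: "f \<in> bfun" and g: "g \<in> L2_closure"
    and A: "\<And>e. e \<in> A \<Longrightarrow> (\<lambda>x. f x * e x) \<in> L2_closure"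
  shows "(\<lambda>x. f x * g x) \<in> L2_closure"
proof (rule L2_closure_approx)
  show "(\<lambda>x. f x * g x) \<in> bfun" by (rule bfun_mult[OF f L2_closure_bfun[OF g]])
  fix \<epsilon> :: real assume "0 < \<epsilon>"
  obtain C where C: "0 \<le> C" "\<forall>x\<in>space N. \<bar>f x\<bar> \<le> C"
    using bfun_bound[OF f] by auto
  obtain e where e: "e \<in> A" "\<forall>M\<in>Ms. (\<integral>x. (g x - e x)\<^sup>2 \<partial>M) < \<epsilon> / (C\<^sup>2 + 1)"
    using L2_closureD[OF g, of "\<epsilon> / (C\<^sup>2 + 1)"] \<open>0 < \<epsilon>\<close> by (auto simp: add_nonneg_pos)
  have "(\<integral>x. (f x * g x - f x * e x)\<^sup>2 \<partial>M) < \<epsilon>" if M: "M \<in> Ms" for M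
  proof -
    have "(\<integral>x. (f x * g x - f x * e x)\<^sup>2 \<partial>M) \<le> (\<integral>x. C\<^sup>2 * (g x - e x)\<^sup>2 \<partial>M)"
    proof (rule integral_mono)
      fix x assume "x \<in> space M"
      then have "(f x)\<^sup>2 \<le> C\<^sup>2"
        using C space_Ms[OF M] by (metis abs_le_square_iff abs_of_nonneg)
      then show "(f x * g x - f x * e x)\<^sup>2 \<le> C\<^sup>2 * (g x - e x)\<^sup>2"
        unfolding right_diff_distrib[symmetric] power_mult_distrib by (rule mult_right_mono) simp
    next
      show "integrable M (\<lambda>x. (f x * g x - f x * e x)\<^sup>2)"
        by (rule bfun_square_integrable[OF bfun_minus M])
          (rule bfun_mult f L2_closure_bfun[OF g] A_bfun[OF e(1)])+
      show "integrable M (\<lambda>x. C\<^sup>2 * (g x - e x)\<^sup>2)"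
        by (intro integrable_mult_right bfun_square_integrable[OF bfun_minus M]
            L2_closure_bfun[OF g] A_bfun[OF e(1)])
    qed
    also have "\<dots> = C\<^sup>2 * (\<integral>x. (g x - e x)\<^sup>2 \<partial>M)" by simp
    also have "\<dots> \<le> C\<^sup>2 * (\<epsilon> / (C\<^sup>2 + 1))"
      using e M by (intro mult_left_mono) (auto intro: less_imp_le)
    also have "\<dots> < \<epsilon>" using \<open>0 < \<epsilon>\<close> by (simp add: divide_simps add_nonneg_pos)
    finally show ?thesis .
  qed
  then show "\<exists>h\<in>L2_closure. \<forall>M\<in>Ms. (\<integral>x. (f x * g x - h x)\<^sup>2 \<partial>M) < \<epsilon>"
    by (intro bexI[OF _ A[OF e(1)]] ballI)
qed

lemma L2_closure_mult:
  assumes "f \<in> L2_closure" "g \<in> L2_closure" shows "(\<lambda>x. f x * g x) \<in> L2_closure"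
proof (rule L2_closure_mult_aux[OF L2_closure_bfun[OF assms(1)] assms(2)])
  fix e assume e: "e \<in> A"
  have "(\<lambda>x. e x * f x) \<in> L2_closure"
    by (rule L2_closure_mult_aux[OF A_bfun[OF e] assms(1)]) (intro A_L2_closure A_mult e)
  then show "(\<lambda>x. f x * e x) \<in> L2_closure" by (simp add: mult.commute)
qed

lemma L2_closure_const: "(\<lambda>_. c) \<in> L2_closure"
  by (intro A_L2_closure A_const)

lemma L2_closure_minus:
  assumes "f \<in> L2_closure" "g \<in> L2_closure" shows "(\<lambda>x. f x - g x) \<in> L2_closure"
proof -
  have "(\<lambda>x. f x + - 1 * g x) \<in> L2_closure"
    by (intro L2_closure_add L2_closure_mult[of "\<lambda>_. - 1"] L2_closure_const assms)
  then show ?thesis by simp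
qed

lemma L2_closure_power: "f \<in> L2_closure \<Longrightarrow> (\<lambda>x. f x ^ n) \<in> L2_closure"
proof (induction n)
  case (Suc n)
  then show ?case using L2_closure_mult[of f "\<lambda>x. f x ^ n"] by simp
qed (simp add: L2_closure_const)

lemma L2_closure_sum:
  "finite K \<Longrightarrow> (\<And>k. k \<in> K \<Longrightarrow> f k \<in> L2_closure) \<Longrightarrow> (\<lambda>x. \<Sum>k\<in>K. f k x) \<in> L2_closure"
proof (induction K rule: finite_induct)
  case (insert k K)
  then show ?case using L2_closure_add[of "f k" "\<lambda>x. \<Sum>k\<in>K. f k x"] by simp
qed (simp add: L2_closure_const)

definition L2_sets :: "'b set set" where
  "L2_sets = {S \<in> sets N. indicator S \<in> L2_closure}"

lemma sigma_algebra_L2_sets: "sigma_algebra (space N) L2_sets"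
proof -
  have cong: "f \<in> L2_closure"
    if g: "g \<in> L2_closure" and f: "f \<in> borel_measurable N" and eq: "\<And>x. x \<in> space N \<Longrightarrow> g x = f x" for f g
  proof -
    obtain C where "\<forall>x\<in>space N. \<bar>g x\<bar> \<le> C"
      using bfun_bound[OF L2_closure_bfun[OF g]] by auto
    then show ?thesis using g f eq by (intro L2_closure_limit[of "\<lambda>_. g" f C]) auto
  qed
  have Int: "a \<inter> b \<in> L2_sets" if "a \<in> L2_sets" "b \<in> L2_sets" for a b
    using that L2_closure_mult[of "indicator a" "indicator b"]
    by (auto simp: L2_sets_def indicator_inter_arith[abs_def])
  have Compl: "space N - a \<in> L2_sets" if "a \<in> L2_sets" for a
  proof -
    have "(\<lambda>x. 1 - indicator a x) \<in> L2_closure"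
      using that by (intro L2_closure_minus L2_closure_const) (simp add: L2_sets_def)
    then have "indicator (space N - a) \<in> L2_closure"
      by (rule cong) (use that in \<open>auto simp: L2_sets_def indicator_def\<close>)
    then show ?thesis using that by (auto simp: L2_sets_def)
  qed
  have empty: "{} \<in> L2_sets"
    using L2_closure_const[of 0] by (simp add: L2_sets_def indicator_def[abs_def])
  have "algebra (space N) L2_sets"
    unfolding algebra_iff_Int
  proof (intro conjI ballI)
    show "L2_sets \<subseteq> Pow (space N)"
      using sets.sets_into_space[of _ N] by (auto simp: L2_sets_def)
  qed (use Int Compl empty in auto)
  then interpret algebra "space N" L2_sets .
  show ?thesis
  proof
    fix B :: "nat \<Rightarrow> 'b set" assume B: "range B \<subseteq> L2_sets"
    have "indicator (\<Union>i. B i) \<in> L2_closure"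
    proof (rule L2_closure_limit[where C = 1 and g = "\<lambda>n. indicator (\<Union>i<n. B i)"])
      fix n
      have "(\<Union>i<n. B i) \<in> L2_sets" using B by (intro finite_UN) auto
      then show "indicator (\<Union>i<n. B i) \<in> L2_closure" by (simp add: L2_sets_def)
    next
      have "(\<Union>i. B i) \<in> sets N" using B by (intro sets.countable_UN) (auto simp: L2_sets_def)
      then show "(indicator (\<Union>i. B i) :: 'b \<Rightarrow> real) \<in> borel_measurable N" by simp
    qed (simp_all add: LIMSEQ_indicator_UN)
    moreover have "(\<Union>i. B i) \<in> sets N" using B by (intro sets.countable_UN) (auto simp: L2_sets_def)
    ultimately show "(\<Union>i. B i) \<in> L2_sets" by (simp add: L2_sets_def)
  qed
qed

lemma bfun_subset_L2_closure:
  assumes "sets N \<subseteq> L2_sets" "f \<in> bfun"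
  shows "f \<in> L2_closure"
proof -
  note bfun_measurable[OF assms(2), measurable]
  obtain C where C: "0 \<le> C" "\<And>x. x \<in> space N \<Longrightarrow> \<bar>f x\<bar> \<le> C"
    using bfun_bound[OF assms(2)] by auto
  define g where "g n x = (\<Sum>k\<in>{- \<lceil>real (Suc n) * C\<rceil> - 1..\<lceil>real (Suc n) * C\<rceil>}.
      real_of_int k / Suc n * indicator {x\<in>space N. \<lfloor>Suc n * f x\<rfloor> = k} x)" for n x
  have g: "g n x = \<lfloor>Suc n * f x\<rfloor> / Suc n" if x: "x \<in> space N" for n x
  proof -
    have "\<bar>Suc n * f x\<bar> \<le> Suc n * C"
      unfolding abs_mult using C(2)[OF x] by (intro mult_mono) auto
    then have "\<lfloor>Suc n * f x\<rfloor> \<in> {- \<lceil>real (Suc n) * C\<rceil> - 1..\<lceil>real (Suc n) * C\<rceil>}"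
      unfolding atLeastAtMost_iff by linarith
    moreover have "g n x = (\<Sum>k\<in>{- \<lceil>real (Suc n) * C\<rceil> - 1..\<lceil>real (Suc n) * C\<rceil>}.
        if k = \<lfloor>Suc n * f x\<rfloor> then real_of_int k / Suc n else 0)"
      unfolding g_def using x by (intro sum.cong) (auto simp: indicator_def)
    ultimately show ?thesis by simp
  qed
  have near: "\<bar>g n x - f x\<bar> \<le> 1 / Suc n" if "x \<in> space N" for n x
  proof -
    have "\<bar>\<lfloor>Suc n * f x\<rfloor> - Suc n * f x\<bar> \<le> 1" by linarith
    then have "\<bar>(\<lfloor>Suc n * f x\<rfloor> - Suc n * f x) / Suc n\<bar> \<le> 1 / Suc n"
      by (subst abs_divide) (simp add: divide_right_mono)
    then show ?thesis using g[OF that] by (simp add: diff_divide_distrib)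
  qed
  show ?thesis
  proof (rule L2_closure_limit[of g f "C + 1"])
    show "g n \<in> L2_closure" for n
    proof -
      have "{x\<in>space N. \<lfloor>Suc n * f x\<rfloor> = k} \<in> L2_sets" for k
        by (rule subsetD[OF assms(1)]) measurable
      then show ?thesis unfolding g_def[abs_def]
        by (intro L2_closure_sum L2_closure_mult L2_closure_const) (auto simp: L2_sets_def)
    qed
    show "\<bar>g n x\<bar> \<le> C + 1" if "x \<in> space N" for n x
    proof -
      have "1 / real (Suc n) \<le> 1" by simp
      then show ?thesis using near[OF that, of n] C(2)[OF that] by linarith
    qed
    show "(\<lambda>n. g n x) \<longlonglongrightarrow> f x" if "x \<in> space N" for x
    proof (rule Lim_null[THEN iffD2], rule Lim_null_comparison)
      show "\<forall>\<^sub>F n in sequentially. norm (g n x - f x) \<le> 1 / Suc n"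
        using near[OF that] by simp
      show "(\<lambda>n. 1 / real (Suc n)) \<longlonglongrightarrow> 0" by (rule LIMSEQ_Suc[OF lim_1_over_n])
    qed
  qed fact
qed

end

section \<open>Density of the exponential functionals\<close>

lemma test_functions_iff:
  assumes "sets \<rho> = sets X"
  shows "w \<in> test_functions \<rho> \<longleftrightarrow>
    simple_function X w \<and> (\<forall>x. 0 \<le> w x) \<and> emeasure \<rho> {x\<in>space X. w x \<noteq> 0} < \<infinity>"
  by (simp only: test_functions_def mem_Collect_eq sets_eq_imp_space_eq[OF assms]
      simple_function_cong_sets[OF assms])

lemma test_functions_add:
  assumes "w \<in> test_functions \<rho>" "w' \<in> test_functions \<rho>"
  shows "(\<lambda>x. w x + w' x) \<in> test_functions \<rho>"
proof -
  have w: "simple_function \<rho> w" "simple_function \<rho> w'"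
    using assms by (auto simp: test_functions_def)
  note [measurable] = w[THEN borel_measurable_simple_function]
  have "emeasure \<rho> {x\<in>space \<rho>. w x + w' x \<noteq> 0}
      \<le> emeasure \<rho> ({x\<in>space \<rho>. w x \<noteq> 0} \<union> {x\<in>space \<rho>. w' x \<noteq> 0})"
    by (intro emeasure_mono) auto
  also have "\<dots> \<le> emeasure \<rho> {x\<in>space \<rho>. w x \<noteq> 0} + emeasure \<rho> {x\<in>space \<rho>. w' x \<noteq> 0}"
    by (intro emeasure_subadditive) auto
  also have "\<dots> < \<infinity>" using assms by (auto simp: test_functions_def)
  finally show ?thesis using assms by (auto simp: test_functions_def intro!: simple_function_add)
qed

lemma test_functions_indicator:
  assumes "B \<in> sets \<rho>" "emeasure \<rho> B < \<infinity>"
  shows "indicator B \<in> test_functions \<rho>"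
proof -
  have "{x\<in>space \<rho>. indicator B x \<noteq> (0::real)} = B"
    using sets.sets_into_space[OF assms(1)] by (auto simp: indicator_def)
  then show ?thesis using assms by (auto simp: test_functions_def)
qed

definition exp_span :: "'a measure \<Rightarrow> 'a measure \<Rightarrow> ('a measure \<Rightarrow> real) set" where
  "exp_span X \<rho> = {f. \<exists>L. (\<forall>(b, w)\<in>set L. w \<in> test_functions \<rho>) \<and>
     (\<forall>\<phi>\<in>point_measures X. f \<phi> = (\<Sum>(b, w)\<leftarrow>L. b * exp_functional w \<phi>))}"

lemma point_measures_sets: "\<phi> \<in> point_measures X \<Longrightarrow> sets \<phi> = sets X"
  by (simp add: point_measures_def)

lemma exp_span_single:
  assumes "w \<in> test_functions \<rho>" shows "exp_functional w \<in> exp_span X \<rho>"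
  using assms unfolding exp_span_def by (auto intro!: exI[of _ "[(1, w)]"])

lemma exp_span_const: "(\<lambda>_. c) \<in> exp_span X \<rho>"
proof -
  have "(\<lambda>_. 0) \<in> test_functions \<rho>" by (simp add: test_functions_def)
  moreover have "exp_functional (\<lambda>_. 0) \<phi> = 1" for \<phi> :: "'a measure"
    by (simp add: exp_functional_def)
  ultimately show ?thesis
    unfolding exp_span_def by (auto intro!: exI[of _ "[(c, \<lambda>_. 0)]"])
qed

lemma exp_span_add:
  assumes "f \<in> exp_span X \<rho>" "g \<in> exp_span X \<rho>"
  shows "(\<lambda>\<phi>. f \<phi> + g \<phi>) \<in> exp_span X \<rho>"
proof -
  obtain L L' where
    "\<forall>(b, w)\<in>set L. w \<in> test_functions \<rho>" "\<forall>(b, w)\<in>set L'. w \<in> test_functions \<rho>"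
    "\<forall>\<phi>\<in>point_measures X. f \<phi> = (\<Sum>(b, w)\<leftarrow>L. b * exp_functional w \<phi>)"
    "\<forall>\<phi>\<in>point_measures X. g \<phi> = (\<Sum>(b, w)\<leftarrow>L'. b * exp_functional w \<phi>)"
    using assms unfolding exp_span_def by blast
  then show ?thesis
    unfolding exp_span_def by (intro CollectI exI[of _ "L @ L'"]) auto
qed

lemma exp_span_mult:
  assumes \<rho>: "sets \<rho> = sets X" and f: "f \<in> exp_span X \<rho>" and g: "g \<in> exp_span X \<rho>"
  shows "(\<lambda>\<phi>. f \<phi> * g \<phi>) \<in> exp_span X \<rho>"
proof -
  obtain L L' where L: "\<forall>(b, w)\<in>set L. w \<in> test_functions \<rho>" "\<forall>(b, w)\<in>set L'. w \<in> test_functions \<rho>"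
    "\<forall>\<phi>\<in>point_measures X. f \<phi> = (\<Sum>(b, w)\<leftarrow>L. b * exp_functional w \<phi>)"
    "\<forall>\<phi>\<in>point_measures X. g \<phi> = (\<Sum>(b, w)\<leftarrow>L'. b * exp_functional w \<phi>)"
    using f g unfolding exp_span_def by blast
  define m where "m b w L = map (\<lambda>(b', w'). (b * b', \<lambda>x. w x + w' x)) L"
    for b :: real and w :: "'a \<Rightarrow> real" and L
  define K where "K = concat (map (\<lambda>(b, w). m b w L') L)"
  have "\<forall>(b, w)\<in>set K. w \<in> test_functions \<rho>"
    using L(1,2) by (auto simp: K_def m_def intro!: test_functions_add)
  moreover have "f \<phi> * g \<phi> = (\<Sum>(b, w)\<leftarrow>K. b * exp_functional w \<phi>)" if \<phi>: "\<phi> \<in> point_measures X" for \<phi>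
  proof -
    have m: "(\<Sum>(b, w)\<leftarrow>m b w L''. b * exp_functional w \<phi>)
        = b * exp_functional w \<phi> * (\<Sum>(b, w)\<leftarrow>L''. b * exp_functional w \<phi>)"
      if "w \<in> test_functions \<rho>" "\<forall>(b, w)\<in>set L''. w \<in> test_functions \<rho>" for b w L''
      using that(2)
    proof (induction L'')
      case (Cons p L'')
      obtain b' w' where p: "p = (b', w')" by (cases p)
      have "exp_functional (\<lambda>x. w x + w' x) \<phi> = exp_functional w \<phi> * exp_functional w' \<phi>"
        using that(1) Cons.prems p point_measures_sets[OF \<phi>] test_functions_iff[OF \<rho>]
        by (intro exp_functional_add) auto
      then show ?case using Cons p by (simp add: m_def algebra_simps)
    qed (simp add: m_def)
    have "(\<Sum>(b, w)\<leftarrow>concat (map (\<lambda>(b, w). m b w L') L''). b * exp_functional w \<phi>)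
        = (\<Sum>(b, w)\<leftarrow>L''. b * exp_functional w \<phi>) * (\<Sum>(b, w)\<leftarrow>L'. b * exp_functional w \<phi>)"
      if "\<forall>(b, w)\<in>set L''. w \<in> test_functions \<rho>" for L''
      using that
    proof (induction L'')
      case (Cons p L'')
      obtain b w where p: "p = (b, w)" by (cases p)
      then show ?case using Cons L(2) by (simp add: m distrib_right)
    qed simp
    then show ?thesis using L \<phi> by (simp add: K_def)
  qed
  ultimately show ?thesis unfolding exp_span_def by blast
qed

lemma exp_span_measurable:
  assumes "sets \<rho> = sets X" "f \<in> exp_span X \<rho>"
  shows "f \<in> borel_measurable (point_measure_algebra X)"
proof -
  obtain L where L: "\<forall>(b, w)\<in>set L. w \<in> test_functions \<rho>"
    "\<forall>\<phi>\<in>point_measures X. f \<phi> = (\<Sum>(b, w)\<leftarrow>L. b * exp_functional w \<phi>)"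
    using assms unfolding exp_span_def by blast
  have "(\<lambda>\<phi>. \<Sum>(b, w)\<leftarrow>L. b * exp_functional w \<phi>) \<in> borel_measurable (point_measure_algebra X)"
    using L(1)
  proof (induction L)
    case (Cons p L)
    then show ?case using test_functions_iff[OF assms(1)]
      by (cases p) (auto intro!: borel_measurable_add borel_measurable_times exp_functional_measurable)
  qed simp
  then show ?thesis
    by (rule measurable_cong[THEN iffD1, rotated]) (use L in \<open>simp add: space_point_measure_algebra\<close>)
qed

lemma exp_span_bounded:
  assumes "f \<in> exp_span X \<rho>"
  shows "\<exists>C. \<forall>\<phi>\<in>point_measures X. \<bar>f \<phi>\<bar> \<le> C"
proof -
  obtain L where L: "\<forall>\<phi>\<in>point_measures X. f \<phi> = (\<Sum>(b, w)\<leftarrow>L. b * exp_functional w \<phi>)"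
    using assms unfolding exp_span_def by blast
  have "\<bar>\<Sum>(b, w)\<leftarrow>L'. b * exp_functional w \<phi>\<bar> \<le> (\<Sum>(b, w)\<leftarrow>L'. \<bar>b\<bar>)"
    for L' :: "(real \<times> ('a \<Rightarrow> real)) list" and \<phi>
  proof (induction L')
    case (Cons p L')
    obtain b w where p: "p = (b, w)" by (cases p)
    have "\<bar>b * exp_functional w \<phi>\<bar> \<le> \<bar>b\<bar>"
      unfolding abs_mult using exp_functional_nonneg[of w \<phi>] exp_functional_le_1[of w \<phi>]
      by (intro mult_left_le) auto
    then show ?case using Cons p by simp
  qed simp
  then show ?thesis using L by (intro exI[of _ "\<Sum>(b, w)\<leftarrow>L. \<bar>b\<bar>"]) auto
qed

lemma exp_span_function_algebra:
  assumes "sets \<rho> = sets X" "finite Ms" "\<And>M. M \<in> Ms \<Longrightarrow> finite_measure M"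
    and "\<And>M. M \<in> Ms \<Longrightarrow> sets M = sets (point_measure_algebra X)"
  shows "function_algebra (point_measure_algebra X) Ms (exp_span X \<rho>)"
proof (rule function_algebra.intro)
  show "f \<in> borel_measurable (point_measure_algebra X)" if "f \<in> exp_span X \<rho>" for f
    using assms(1) that by (rule exp_span_measurable)
  show "\<exists>C. \<forall>\<phi>\<in>space (point_measure_algebra X). \<bar>f \<phi>\<bar> \<le> C" if "f \<in> exp_span X \<rho>" for f
    unfolding space_point_measure_algebra using that by (rule exp_span_bounded)
qed (rule assms exp_span_const exp_span_add exp_span_mult[OF assms(1)]; assumption?)+

text \<open>
  The event \<open>\<phi> B = k\<close> is recovered from \<open>z = exp (- \<phi> B)\<close> by successively splitting off the
  largest possible values \<open>1, exp (-1), exp (-2), \<dots>\<close> of \<open>z\<close> and taking high powers.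
\<close>
lemma (in function_algebra) counting_event_L2_sets:
  assumes Z: "Z \<in> borel_measurable N" "(\<lambda>x. exp_neg (Z x)) \<in> L2_closure"
    and range: "\<And>x. x \<in> space N \<Longrightarrow> Z x \<in> range ennreal_of_enat"
  shows "{x\<in>space N. Z x = of_nat k} \<in> L2_sets"
proof (induction k rule: less_induct)
  case (less k)
  define g where "g x = (exp_neg (Z x) - (\<Sum>j<k. exp (- real j) * indicator {x\<in>space N. Z x = of_nat j} x)) * exp (real k)" for x
  have gL: "g \<in> L2_closure"
    unfolding g_def[abs_def] using less Z
    by (intro L2_closure_mult L2_closure_minus L2_closure_sum L2_closure_const finite_lessThan)
      (auto simp: L2_sets_def)
  have Zx: "(\<exists>j. Z x = of_nat j) \<or> Z x = \<infinity>" if x: "x \<in> space N" for x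
  proof -
    obtain e where "Z x = ennreal_of_enat e" using range[OF x] by auto
    then show ?thesis by (cases e) auto
  qed
  have g_nat: "g x = (if j < k then 0 else exp (real k - real j))" if x: "x \<in> space N" and j: "Z x = of_nat j" for x j
  proof -
    have "(\<Sum>i<k. exp (- real i) * indicator {x\<in>space N. Z x = of_nat i} x)
        = (\<Sum>i<k. if i = j then exp (- real i) else 0)"
      using x j by (intro sum.cong) auto
    then show ?thesis using j
      by (simp add: g_def ennreal_of_nat_eq_real_of_nat exp_neg_ennreal exp_diff exp_minus divide_inverse mult.commute)
  qed
  have g_inf: "g x = 0" if x: "x \<in> space N" and j: "Z x = \<infinity>" for x
    using j by (simp add: g_def exp_neg_def)
  have cases: "g x = (if Z x = of_nat k then 1 else g x) \<and> 0 \<le> g x \<and> g x \<le> 1 \<and> (Z x \<noteq> of_nat k \<longrightarrow> g x < 1)"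
    if x: "x \<in> space N" for x
    using Zx[OF x]
  proof
    assume "\<exists>j. Z x = of_nat j"
    then obtain j where j: "Z x = of_nat j" by auto
    then show ?thesis using g_nat[OF x j] by auto
  qed (use g_inf[OF x] in auto)
  have "indicator {x\<in>space N. Z x = of_nat k} \<in> L2_closure"
  proof (rule L2_closure_limit[where C = 1])
    show "(\<lambda>x. g x ^ n) \<in> L2_closure" for n by (intro L2_closure_power gL)
    show "(indicator {x \<in> space N. Z x = of_nat k} :: _ \<Rightarrow> real) \<in> borel_measurable N"
      using Z(1) by measurable
    show "\<bar>g x ^ n\<bar> \<le> 1" if "x \<in> space N" for n x
      using cases[OF that] by (simp add: power_abs power_le_one)
    show "(\<lambda>n. g x ^ n) \<longlonglongrightarrow> indicator {x\<in>space N. Z x = of_nat k} x" if x: "x \<in> space N" for x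
    proof (cases "Z x = of_nat k")
      case True
      then have "g x = 1" using cases[OF x] by simp
      then show ?thesis using True x by simp
    next
      case False
      then show ?thesis using cases[OF x] by (simp add: LIMSEQ_realpow_zero)
    qed
  qed
  then show ?case using Z(1) by (simp add: L2_sets_def)
qed

lemma exp_span_L2_dense:
  assumes \<rho>: "sets \<rho> = sets X" "sigma_finite_measure \<rho>"
    and Ms: "finite Ms" "\<And>M. M \<in> Ms \<Longrightarrow> finite_measure M"
      "\<And>M. M \<in> Ms \<Longrightarrow> sets M = sets (point_measure_algebra X)"
    and f: "f \<in> borel_measurable (point_measure_algebra X)"
      "\<And>\<phi>. \<phi> \<in> point_measures X \<Longrightarrow> \<bar>f \<phi>\<bar> \<le> C"
    and "0 < \<epsilon>"
  shows "\<exists>g\<in>exp_span X \<rho>. \<forall>M\<in>Ms. (\<integral>\<phi>. (f \<phi> - g \<phi>)\<^sup>2 \<partial>M) < \<epsilon>"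
proof -
  let ?N = "point_measure_algebra X"
  interpret function_algebra ?N Ms "exp_span X \<rho>"
    using \<rho>(1) Ms by (rule exp_span_function_algebra)
  interpret sigma_algebra "space ?N" L2_sets by (rule sigma_algebra_L2_sets)
  define T where "T = sigma (space ?N) L2_sets"
  have T: "space T = space ?N" "sets T = L2_sets"
    using space_closed by (auto simp: T_def sigma_sets_eq)
  have finite_eval: "(\<lambda>\<phi>. emeasure \<phi> B) \<in> borel_measurable T"
    if B: "B \<in> sets X" "emeasure \<rho> B < \<infinity>" for B
  proof -
    have lev: "{\<phi>\<in>space ?N. emeasure \<phi> B = of_nat k} \<in> L2_sets" for k
    proof (rule counting_event_L2_sets)
      show "(\<lambda>\<phi>. emeasure \<phi> B) \<in> borel_measurable ?N" using B by measurable
      have "exp_functional (indicator B) \<in> L2_closure"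
        using B \<rho> by (intro A_L2_closure exp_span_single test_functions_indicator) auto
      then show "(\<lambda>\<phi>. exp_neg (emeasure \<phi> B)) \<in> L2_closure"
      proof (rule L2_closure_limit[of "\<lambda>_. exp_functional (indicator B)" _ 1])
        show "\<bar>exp_functional (indicator B) \<phi>\<bar> \<le> 1" for \<phi>
          using exp_functional_nonneg[of _ \<phi>] exp_functional_le_1[of _ \<phi>] by (simp add: abs_of_nonneg)
        show "(\<lambda>\<phi>. exp_neg (emeasure \<phi> B)) \<in> borel_measurable ?N" using B by measurable
        fix \<phi> assume "\<phi> \<in> space ?N"
        then have "B \<in> sets \<phi>" using B point_measures_sets by (auto simp: space_point_measure_algebra)
        then have "exp_functional (indicator B) \<phi> = exp_neg (emeasure \<phi> B)"
          by (simp add: exp_functional_def ennreal_indicator)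
        then show "(\<lambda>_. exp_functional (indicator B) \<phi>) \<longlonglongrightarrow> exp_neg (emeasure \<phi> B)" by simp
      qed
      show "emeasure \<phi> B \<in> range ennreal_of_enat" if "\<phi> \<in> space ?N" for \<phi>
        using that B(1) by (simp add: space_point_measure_algebra point_measures_def)
    qed
    show ?thesis
    proof (rule measurableI)
      fix S :: "ennreal set" assume "S \<in> sets borel"
      have val: "emeasure \<phi> B = \<infinity> \<or> (\<exists>k. emeasure \<phi> B = of_nat k)" if \<phi>: "\<phi> \<in> space ?N" for \<phi>
      proof -
        obtain e where "emeasure \<phi> B = ennreal_of_enat e"
          using \<phi> B(1) by (auto simp: space_point_measure_algebra point_measures_def)
        then show ?thesis by (cases e) auto
      qed
      have "(\<lambda>\<phi>. emeasure \<phi> B) -` S \<inter> space T =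
        (\<Union>k\<in>{k. of_nat k \<in> S}. {\<phi>\<in>space ?N. emeasure \<phi> B = of_nat k}) \<union>
        (if \<infinity> \<in> S then space ?N - (\<Union>k. {\<phi>\<in>space ?N. emeasure \<phi> B = of_nat k}) else {})"
        (is "?L = ?R")
      proof (rule set_eqI)
        fix \<phi> show "\<phi> \<in> ?L \<longleftrightarrow> \<phi> \<in> ?R" unfolding T using val[of \<phi>] by auto
      qed
      also have "\<dots> \<in> sets T"
        unfolding T using lev by (intro Un countable_UN' Diff) auto
      finally show "(\<lambda>\<phi>. emeasure \<phi> B) -` S \<inter> space T \<in> sets T" .
    qed simp
  qed
  obtain F :: "nat \<Rightarrow> 'a set" where F: "range F \<subseteq> sets \<rho>" "(\<Union>i. F i) = space \<rho>"
    "\<And>i. emeasure \<rho> (F i) \<noteq> \<infinity>" "incseq F"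
    using sigma_finite_measure.sigma_finite_incseq[OF \<rho>(2)] by metis
  have eval: "(\<lambda>\<phi>. emeasure \<phi> B) \<in> borel_measurable T" if B: "B \<in> sets X" for B
  proof -
    have "(\<lambda>\<phi>. SUP i. emeasure \<phi> (B \<inter> F i)) \<in> borel_measurable T"
    proof (intro borel_measurable_SUP finite_eval)
      fix i
      show "B \<inter> F i \<in> sets X" using B F(1) \<rho>(1) by auto
      have "emeasure \<rho> (B \<inter> F i) \<le> emeasure \<rho> (F i)" using F(1) by (intro emeasure_mono) auto
      then show "emeasure \<rho> (B \<inter> F i) < \<infinity>" using F(3)[of i] by (auto simp: top.not_eq_extremum)
    qed auto
    then show ?thesis
    proof (rule measurable_cong[THEN iffD1, rotated])
      fix \<phi> assume "\<phi> \<in> space T"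
      then have s: "sets \<phi> = sets X" using T by (simp add: space_point_measure_algebra point_measures_sets)
      have "(SUP i. emeasure \<phi> (B \<inter> F i)) = emeasure \<phi> (\<Union>i. B \<inter> F i)"
      proof (rule SUP_emeasure_incseq)
        show "incseq (\<lambda>i. B \<inter> F i)"
          using F(4) unfolding incseq_def by blast
      qed (use B F(1) \<rho>(1) s in auto)
      also have "(\<Union>i. B \<inter> F i) = B"
        using F(2) sets.sets_into_space[of B \<rho>] B \<rho>(1) by auto
      finally show "(SUP i. emeasure \<phi> (B \<inter> F i)) = emeasure \<phi> B" .
    qed
  qed
  have "(\<lambda>\<phi>. \<phi>) \<in> measurable T ?N"
    unfolding point_measure_algebra_def
  proof (rule measurable_SUP2)
    fix B assume "B \<in> sets X"
    then show "(\<lambda>\<phi>. \<phi>) \<in> T \<rightarrow>\<^sub>M vimage_algebra (point_measures X) (\<lambda>\<phi>. emeasure \<phi> B) borel"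
      using eval by (intro measurable_vimage_algebra2) (auto simp: T space_point_measure_algebra)
  qed auto
  then have "sets ?N \<subseteq> L2_sets"
    using T measurable_sets[of "\<lambda>\<phi>. \<phi>" T ?N] sets.sets_into_space[of _ ?N]
    by (auto simp: Int_absorb2)
  then have "f \<in> L2_closure"
    using f by (intro bfun_subset_L2_closure) (auto simp: bfun_def space_point_measure_algebra)
  then show ?thesis using \<open>0 < \<epsilon>\<close> by (rule L2_closureD)
qed

section \<open>Laws determined by their Laplace transform\<close>

text \<open>
  Laplace transform of a point process law whose intensity has density \<open>1 + u\<close> with respect
  to \<open>\<rho>\<close>; only square integrability of \<open>u\<close> is needed for it to make sense.
\<close>
definition exp_law :: "'a measure \<Rightarrow> 'a measure \<Rightarrow> ('a \<Rightarrow> real) \<Rightarrow> 'a measure measure \<Rightarrow> bool" where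
  "exp_law X \<rho> u Q \<longleftrightarrow> finite_measure Q \<and> sets Q = sets (point_measure_algebra X) \<and>
    (\<forall>w\<in>test_functions \<rho>. (\<integral>\<phi>. exp_functional w \<phi> \<partial>Q) =
      exp (\<integral>x. (exp (- w x) - 1) \<partial>\<rho>) * exp (inner_on \<rho> u (\<lambda>x. exp (- w x) - 1)))"

text \<open>
  Laplace transform of the image of \<open>g \<rho> \<otimes> Q\<close> under \<open>(x, \<phi>) \<mapsto> \<phi> + \<delta>\<^sub>x\<close>, where \<open>Q\<close> satisfies
  \<open>exp_law X \<rho> u Q\<close>.
\<close>
definition shift_law ::
  "'a measure \<Rightarrow> 'a measure \<Rightarrow> ('a \<Rightarrow> real) \<Rightarrow> ('a \<Rightarrow> real) \<Rightarrow> 'a measure measure \<Rightarrow> bool" where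
  "shift_law X \<rho> u g Q \<longleftrightarrow> finite_measure Q \<and> sets Q = sets (point_measure_algebra X) \<and>
    (\<forall>w\<in>test_functions \<rho>. (\<integral>\<phi>. exp_functional w \<phi> \<partial>Q) =
      (\<integral>x. exp (- w x) * g x \<partial>\<rho>) *
      (exp (\<integral>x. (exp (- w x) - 1) \<partial>\<rho>) * exp (inner_on \<rho> u (\<lambda>x. exp (- w x) - 1))))"

lemma test_functions_support:
  assumes "w \<in> test_functions \<rho>"
  shows "{x\<in>space \<rho>. w x \<noteq> 0} \<in> sets \<rho>" "emeasure \<rho> {x\<in>space \<rho>. w x \<noteq> 0} < \<infinity>"
    "w \<in> borel_measurable \<rho>" "\<And>x. 0 \<le> w x"
proof -
  show w [measurable]: "w \<in> borel_measurable \<rho>"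
    using assms by (auto simp: test_functions_def intro: borel_measurable_simple_function)
  show "{x\<in>space \<rho>. w x \<noteq> 0} \<in> sets \<rho>" by measurable
qed (use assms in \<open>auto simp: test_functions_def\<close>)

lemma test_function_exp_bound:
  assumes "w \<in> test_functions \<rho>" "x \<in> space \<rho>"
  shows "\<bar>exp (- w x) - 1\<bar> \<le> indicator {x\<in>space \<rho>. w x \<noteq> 0} x"
  using test_functions_support(4)[OF assms(1), of x] assms(2) by (auto simp: indicator_def)

lemma test_function_exp_integrable:
  assumes "w \<in> test_functions \<rho>"
  shows "integrable \<rho> (\<lambda>x. exp (- w x) - 1)"
proof (rule Bochner_Integration.integrable_bound)
  show "integrable \<rho> (indicator {x\<in>space \<rho>. w x \<noteq> 0} :: _ \<Rightarrow> real)"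
    using test_functions_support[OF assms] by simp
  show "(\<lambda>x. exp (- w x) - 1) \<in> borel_measurable \<rho>"
    using test_functions_support(3)[OF assms] by measurable
  show "AE x in \<rho>. norm (exp (- w x) - 1) \<le> norm (indicator {x\<in>space \<rho>. w x \<noteq> 0} x :: real)"
    using test_function_exp_bound[OF assms] by (intro AE_I2) (simp add: abs_of_nonneg)
qed

lemma test_function_exp_square_integrable:
  assumes "w \<in> test_functions \<rho>"
  shows "square_integrable \<rho> (\<lambda>x. exp (- w x) - 1)"
proof (rule square_integrable_bound)
  have "(\<lambda>x. (indicator {x\<in>space \<rho>. w x \<noteq> 0} x :: real)\<^sup>2) = indicator {x\<in>space \<rho>. w x \<noteq> 0}"
    by (auto simp: indicator_def)
  then show "square_integrable \<rho> (indicator {x\<in>space \<rho>. w x \<noteq> 0})"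
    using test_functions_support[OF assms] by (simp add: square_integrable_def)
  show "(\<lambda>x. exp (- w x) - 1) \<in> borel_measurable \<rho>"
    using test_functions_support(3)[OF assms] by measurable
  show "AE x in \<rho>. \<bar>exp (- w x) - 1\<bar> \<le> \<bar>indicator {x\<in>space \<rho>. w x \<noteq> 0} x\<bar>"
    using test_function_exp_bound[OF assms] by (intro AE_I2) (simp add: abs_of_nonneg)
qed

lemma finite_density_test_set:
  assumes \<rho>: "A \<in> sets \<rho>" "emeasure \<rho> A < \<infinity>" and h: "h \<in> borel_measurable \<rho>"
    and u: "square_integrable \<rho> (\<lambda>x. h x - 1)"
  shows "emeasure (density \<rho> (\<lambda>x. ennreal (h x))) A < \<infinity>"
proof -
  have [measurable]: "(\<lambda>x. (h x - 1)\<^sup>2) \<in> borel_measurable \<rho>"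
    using h by measurable
  have "emeasure (density \<rho> (\<lambda>x. ennreal (h x))) A = (\<integral>\<^sup>+x. ennreal (h x) * indicator A x \<partial>\<rho>)"
    using h \<rho> by (intro emeasure_density) auto
  also have "\<dots> \<le> (\<integral>\<^sup>+x. (ennreal 2 * indicator A x + ennreal ((h x - 1)\<^sup>2)) \<partial>\<rho>)"
  proof (rule nn_integral_mono)
    fix x
    have "h x \<le> 2 + (h x - 1)\<^sup>2"
    proof -
      have "0 \<le> (h x - 1 - 1/2)\<^sup>2" by simp
      then show ?thesis by (simp add: power2_eq_square algebra_simps)
    qed
    then have "ennreal (h x) \<le> ennreal 2 + ennreal ((h x - 1)\<^sup>2)"
      by (subst ennreal_plus[symmetric]) (auto intro: ennreal_leI simp del: ennreal_plus)
    then show "ennreal (h x) * indicator A x \<le> ennreal 2 * indicator A x + ennreal ((h x - 1)\<^sup>2)"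
      by (auto simp: indicator_def)
  qed
  also have "\<dots> = 2 * emeasure \<rho> A + (\<integral>\<^sup>+x. ennreal ((h x - 1)\<^sup>2) \<partial>\<rho>)"
    using \<rho> by (subst nn_integral_add) (auto simp: nn_integral_cmult_indicator)
  also have "\<dots> < \<infinity>"
    using \<rho>(2) u by (auto simp: square_integrable_def integrable_iff_bounded ennreal_mult_less_top)
  finally show ?thesis .
qed

lemma poisson_process_exp_law:
  assumes P: "poisson_process M X (density \<rho> (\<lambda>x. ennreal (h x))) \<eta>"
    and \<rho>: "sets \<rho> = sets X" and h: "h \<in> borel_measurable \<rho>" "AE x in \<rho>. 0 \<le> h x"
    and u: "square_integrable \<rho> (\<lambda>x. h x - 1)"
  shows "exp_law X \<rho> (\<lambda>x. h x - 1) (distr M (point_measure_algebra X) \<eta>)"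
  unfolding exp_law_def
proof (intro conjI ballI)
  have \<eta>: "\<eta> \<in> measurable M (point_measure_algebra X)" and M: "prob_space M"
    using P by (auto simp: poisson_process_def)
  show "finite_measure (distr M (point_measure_algebra X) \<eta>)"
    using prob_space.prob_space_distr[OF M \<eta>] by (simp add: prob_space_def)
  fix w assume w: "w \<in> test_functions \<rho>"
  let ?v = "\<lambda>x. exp (- w x) - 1"
  have w': "w \<in> test_functions (density \<rho> (\<lambda>x. ennreal (h x)))"
    using w finite_density_test_set[OF test_functions_support(1,2)[OF w] h(1) u]
    by (simp add: test_functions_def simple_function_def)
  have "(\<integral>\<phi>. exp_functional w \<phi> \<partial>distr M (point_measure_algebra X) \<eta>) = (\<integral>\<omega>. exp_functional w (\<eta> \<omega>) \<partial>M)"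
    using \<eta> w test_functions_iff[OF \<rho>] by (intro integral_distr exp_functional_measurable) auto
  also have "\<dots> = exp (\<integral>x. ?v x \<partial>density \<rho> (\<lambda>x. ennreal (h x)))"
    by (rule Poisson_exp_functional[OF P _ w']) (simp add: \<rho>)
  also have "(\<integral>x. ?v x \<partial>density \<rho> (\<lambda>x. ennreal (h x))) = (\<integral>x. h x * ?v x \<partial>\<rho>)"
    using test_functions_support(3)[OF w] h by (subst integral_density) auto
  also have "\<dots> = (\<integral>x. ?v x + (h x - 1) * ?v x \<partial>\<rho>)"
    by (intro Bochner_Integration.integral_cong) (auto simp: algebra_simps)
  also have "\<dots> = (\<integral>x. ?v x \<partial>\<rho>) + inner_on \<rho> (\<lambda>x. h x - 1) ?v"
    unfolding inner_on_def
    by (intro Bochner_Integration.integral_add test_function_exp_integrable[OF w]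
        square_integrable_mult[OF u test_function_exp_square_integrable[OF w]])
  finally show "(\<integral>\<phi>. exp_functional w \<phi> \<partial>distr M (point_measure_algebra X) \<eta>) =
      exp (\<integral>x. ?v x \<partial>\<rho>) * exp (inner_on \<rho> (\<lambda>x. h x - 1) ?v)"
    by (simp add: exp_add)
qed simp

lemma exp_functional_integrable:
  assumes "sets \<rho> = sets X" "w \<in> test_functions \<rho>" "finite_measure Q"
    and "sets Q = sets (point_measure_algebra X)"
  shows "integrable Q (exp_functional w)"
proof -
  interpret finite_measure Q by fact
  have "exp_functional w \<in> borel_measurable (point_measure_algebra X)"
    using assms(2) test_functions_iff[OF assms(1)] by (intro exp_functional_measurable) auto
  then have "exp_functional w \<in> borel_measurable Q"
    by (simp only: measurable_cong_sets[OF assms(4) refl])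
  then show ?thesis
    by (intro integrable_const_bound[of _ 1])
      (auto simp: abs_of_nonneg exp_functional_nonneg exp_functional_le_1)
qed

text \<open>
  On the span of the exponential functionals, the expectation under the law of intensity
  \<open>(1 + u) \<rho>\<close> extends to a function \<open>F u\<close> of an arbitrary square integrable \<open>u\<close>; the final bound is
  positive definiteness of the kernel \<open>exp \<langle>u, v\<rangle>\<close>.
\<close>
lemma exp_span_extension:
  assumes \<rho>: "sets \<rho> = sets X" and f: "f \<in> exp_span X \<rho>"
  obtains F DF where
    "\<And>u Q. exp_law X \<rho> u Q \<Longrightarrow> (\<integral>\<phi>. f \<phi> \<partial>Q) = F u"
    "\<And>u g Q. shift_law X \<rho> u g Q \<Longrightarrow> square_integrable \<rho> g \<Longrightarrow> integrable \<rho> g \<Longrightarrow>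
      (\<integral>\<phi>. f \<phi> \<partial>Q) = (\<integral>x. g x \<partial>\<rho>) * F u + DF u g"
    "\<And>u g. square_integrable \<rho> u \<Longrightarrow> square_integrable \<rho> g \<Longrightarrow>
      ((\<lambda>s. F (\<lambda>x. u x + s * g x)) has_real_derivative DF u g) (at 0)"
    "\<And>u g h c. square_integrable \<rho> g \<Longrightarrow> square_integrable \<rho> h \<Longrightarrow>
      DF u (\<lambda>x. g x + c * h x) = DF u g + c * DF u h"
    "\<And>Q (J :: nat set) a y. exp_law X \<rho> (\<lambda>_. 0) Q \<Longrightarrow> finite J \<Longrightarrow> (\<And>j. j \<in> J \<Longrightarrow> square_integrable \<rho> (y j)) \<Longrightarrow>
      (\<Sum>j\<in>J. a j * F (y j))\<^sup>2 \<le>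
        (\<Sum>i\<in>J. \<Sum>j\<in>J. a i * a j * exp (inner_on \<rho> (y i) (y j))) * (\<integral>\<phi>. (f \<phi>)\<^sup>2 \<partial>Q)"
proof -
  obtain L where L: "\<forall>(b, w)\<in>set L. w \<in> test_functions \<rho>"
    "\<forall>\<phi>\<in>point_measures X. f \<phi> = (\<Sum>(b, w)\<leftarrow>L. b * exp_functional w \<phi>)"
    using f unfolding exp_span_def by auto
  define n b w where "n = length L" and "b k = fst (L ! k)" and "w k = snd (L ! k)" for k
  define v where "v k x = exp (- w k x) - 1" for k x
  define c where "c k = b k * exp (\<integral>x. v k x \<partial>\<rho>)" for k
  define F where "F u = (\<Sum>k<n. c k * exp (inner_on \<rho> u (v k)))" for u
  define DF where "DF u g = (\<Sum>k<n. c k * (inner_on \<rho> g (v k) * exp (inner_on \<rho> u (v k))))" for u g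
  have w: "w k \<in> test_functions \<rho>" if "k < n" for k
    using bspec[OF L(1) nth_mem[of k L]] that by (simp add: n_def w_def case_prod_beta)
  have v: "square_integrable \<rho> (v k)" "integrable \<rho> (v k)" if "k < n" for k
    using test_function_exp_square_integrable[OF w[OF that]] test_function_exp_integrable[OF w[OF that]]
    by (simp_all add: v_def[abs_def])
  have f_eq: "f \<phi> = (\<Sum>k<n. b k * exp_functional (w k) \<phi>)" if "\<phi> \<in> space (point_measure_algebra X)" for \<phi>
    using L(2) that
    by (simp add: space_point_measure_algebra sum_list_sum_nth n_def b_def w_def case_prod_beta atLeast0LessThan)
  have f_int: "(\<integral>\<phi>. f \<phi> \<partial>Q) = (\<Sum>k<n. b k * (\<integral>\<phi>. exp_functional (w k) \<phi> \<partial>Q))"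
    if Q: "finite_measure Q" "sets Q = sets (point_measure_algebra X)" for Q
  proof -
    have "(\<integral>\<phi>. f \<phi> \<partial>Q) = (\<integral>\<phi>. (\<Sum>k<n. b k * exp_functional (w k) \<phi>) \<partial>Q)"
      using sets_eq_imp_space_eq[OF Q(2)] by (intro Bochner_Integration.integral_cong refl) (simp add: f_eq)
    also have "\<dots> = (\<Sum>k<n. b k * (\<integral>\<phi>. exp_functional (w k) \<phi> \<partial>Q))"
      using exp_functional_integrable[OF \<rho> w Q] by (subst Bochner_Integration.integral_sum) auto
    finally show ?thesis .
  qed
  show thesis
  proof
    show "(\<integral>\<phi>. f \<phi> \<partial>Q) = F u" if Q: "exp_law X \<rho> u Q" for u Q
    proof -
      have "(\<integral>\<phi>. f \<phi> \<partial>Q) = (\<Sum>k<n. b k * (\<integral>\<phi>. exp_functional (w k) \<phi> \<partial>Q))"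
        using Q by (intro f_int) (auto simp: exp_law_def)
      also have "\<dots> = F u"
        unfolding F_def using Q w
        by (intro sum.cong) (auto simp: exp_law_def c_def v_def[abs_def])
      finally show ?thesis .
    qed
    show "(\<integral>\<phi>. f \<phi> \<partial>Q) = (\<integral>x. g x \<partial>\<rho>) * F u + DF u g"
      if Q: "shift_law X \<rho> u g Q" and g: "square_integrable \<rho> g" "integrable \<rho> g" for u g Q
    proof -
      have e: "(\<integral>x. exp (- w k x) * g x \<partial>\<rho>) = (\<integral>x. g x \<partial>\<rho>) + inner_on \<rho> g (v k)" if "k < n" for k
      proof -
        have "(\<integral>x. exp (- w k x) * g x \<partial>\<rho>) = (\<integral>x. g x + g x * v k x \<partial>\<rho>)"
          by (intro Bochner_Integration.integral_cong) (auto simp: v_def algebra_simps)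
        then show ?thesis
          unfolding inner_on_def using square_integrable_mult[OF g(1) v(1)[OF that]] g(2) by simp
      qed
      have "(\<integral>\<phi>. f \<phi> \<partial>Q) = (\<Sum>k<n. b k * (\<integral>\<phi>. exp_functional (w k) \<phi> \<partial>Q))"
        using Q by (intro f_int) (auto simp: shift_law_def)
      also have "\<dots> = (\<Sum>k<n. (\<integral>x. g x \<partial>\<rho>) * (c k * exp (inner_on \<rho> u (v k)))
          + c k * (inner_on \<rho> g (v k) * exp (inner_on \<rho> u (v k))))"
      proof (intro sum.cong refl)
        fix k assume "k \<in> {..<n}"
        then have k: "k < n" by simp
        have "(\<integral>\<phi>. exp_functional (w k) \<phi> \<partial>Q) = ((\<integral>x. g x \<partial>\<rho>) + inner_on \<rho> g (v k)) *
            (exp (\<integral>x. v k x \<partial>\<rho>) * exp (inner_on \<rho> u (v k)))"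
          using Q w[OF k] unfolding e[OF k, symmetric] by (simp add: shift_law_def v_def[abs_def])
        then show "b k * (\<integral>\<phi>. exp_functional (w k) \<phi> \<partial>Q) = (\<integral>x. g x \<partial>\<rho>) * (c k * exp (inner_on \<rho> u (v k)))
          + c k * (inner_on \<rho> g (v k) * exp (inner_on \<rho> u (v k)))"
          by (simp add: c_def algebra_simps)
      qed
      also have "\<dots> = (\<integral>x. g x \<partial>\<rho>) * F u + DF u g"
        by (simp add: F_def DF_def sum.distrib sum_distrib_left)
      finally show ?thesis .
    qed
    show "((\<lambda>s. F (\<lambda>x. u x + s * g x)) has_real_derivative DF u g) (at 0)"
      if u: "square_integrable \<rho> u" and g: "square_integrable \<rho> g" for u g
    proof -
      have "F (\<lambda>x. u x + s * g x) = (\<Sum>k<n. c k * exp (inner_on \<rho> u (v k) + s * inner_on \<rho> g (v k)))" for s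
        unfolding F_def using v u g by (intro sum.cong) (auto simp: inner_on_add_left)
      moreover have "((\<lambda>s. \<Sum>k<n. c k * exp (inner_on \<rho> u (v k) + s * inner_on \<rho> g (v k)))
          has_real_derivative DF u g) (at 0)"
        unfolding DF_def by (auto intro!: derivative_eq_intros sum.cong simp: mult_ac)
      ultimately show ?thesis by simp
    qed
    show "DF u (\<lambda>x. g x + c * h x) = DF u g + c * DF u h"
      if "square_integrable \<rho> g" "square_integrable \<rho> h" for u g h c
      unfolding DF_def using that v
      by (simp add: inner_on_add_left sum_distrib_left sum.distrib[symmetric] algebra_simps)
    show "(\<Sum>j\<in>J. a j * F (y j))\<^sup>2 \<le>
        (\<Sum>i\<in>J. \<Sum>j\<in>J. a i * a j * exp (inner_on \<rho> (y i) (y j))) * (\<integral>\<phi>. (f \<phi>)\<^sup>2 \<partial>Q)"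
      if Q: "exp_law X \<rho> (\<lambda>_. 0) Q" and J: "finite J" "\<And>j. j \<in> J \<Longrightarrow> square_integrable \<rho> (y j)"
      for Q and J :: "nat set" and a y
    proof -
      have fin: "finite_measure Q" and sQ: "sets Q = sets (point_measure_algebra X)"
        using Q by (auto simp: exp_law_def)
      have pair: "(\<integral>\<phi>. exp_functional (w k) \<phi> * exp_functional (w l) \<phi> \<partial>Q)
          = exp (\<integral>x. v k x \<partial>\<rho>) * exp (\<integral>x. v l x \<partial>\<rho>) * exp (inner_on \<rho> (v k) (v l))"
        and pair_int: "integrable Q (\<lambda>\<phi>. exp_functional (w k) \<phi> * exp_functional (w l) \<phi>)"
        if kl: "k < n" "l < n" for k l
      proof -
        let ?w = "\<lambda>x. w k x + w l x"
        have t: "?w \<in> test_functions \<rho>" using w kl by (intro test_functions_add) auto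
        have prod: "exp_functional (w k) \<phi> * exp_functional (w l) \<phi> = exp_functional ?w \<phi>"
          if "\<phi> \<in> space Q" for \<phi>
        proof (rule exp_functional_add[symmetric])
          show "sets \<phi> = sets X"
            using that sets_eq_imp_space_eq[OF sQ]
            by (simp add: space_point_measure_algebra point_measures_sets)
        qed (use w kl test_functions_iff[OF \<rho>] in auto)
        show "integrable Q (\<lambda>\<phi>. exp_functional (w k) \<phi> * exp_functional (w l) \<phi>)"
          using exp_functional_integrable[OF \<rho> t fin sQ] prod
          by (subst Bochner_Integration.integrable_cong[OF refl, of _ _ "exp_functional ?w"]) auto
        have "(\<integral>\<phi>. exp_functional (w k) \<phi> * exp_functional (w l) \<phi> \<partial>Q) = (\<integral>\<phi>. exp_functional ?w \<phi> \<partial>Q)"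
          by (intro Bochner_Integration.integral_cong refl prod)
        also have "\<dots> = exp (\<integral>x. (exp (- ?w x) - 1) \<partial>\<rho>)"
          using Q t by (auto simp: exp_law_def inner_on_def)
        also have "(\<integral>x. (exp (- ?w x) - 1) \<partial>\<rho>) = (\<integral>x. v k x + v l x + v k x * v l x \<partial>\<rho>)"
          by (intro Bochner_Integration.integral_cong) (auto simp: v_def algebra_simps exp_add exp_diff exp_minus divide_inverse)
        also have "\<dots> = (\<integral>x. v k x \<partial>\<rho>) + (\<integral>x. v l x \<partial>\<rho>) + inner_on \<rho> (v k) (v l)"
          unfolding inner_on_def using v kl square_integrable_mult[OF v(1) v(1), of k l] by simp
        finally show "(\<integral>\<phi>. exp_functional (w k) \<phi> * exp_functional (w l) \<phi> \<partial>Q)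
          = exp (\<integral>x. v k x \<partial>\<rho>) * exp (\<integral>x. v l x \<partial>\<rho>) * exp (inner_on \<rho> (v k) (v l))"
          by (simp add: exp_add)
      qed
      have "(\<integral>\<phi>. (f \<phi>)\<^sup>2 \<partial>Q) = (\<integral>\<phi>. (\<Sum>k<n. \<Sum>l<n. b k * b l * (exp_functional (w k) \<phi> * exp_functional (w l) \<phi>)) \<partial>Q)"
        using sets_eq_imp_space_eq[OF sQ]
        by (intro Bochner_Integration.integral_cong refl)
          (simp add: f_eq power2_eq_square sum_product mult_ac)
      also have "\<dots> = (\<Sum>k<n. \<Sum>l<n. b k * b l * (\<integral>\<phi>. exp_functional (w k) \<phi> * exp_functional (w l) \<phi> \<partial>Q))"
      proof -
        have int: "integrable Q (\<lambda>\<phi>. b k * b l * (exp_functional (w k) \<phi> * exp_functional (w l) \<phi>))"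
          if "k < n" "l < n" for k l
          by (intro integrable_mult_right pair_int that)
        have "(\<integral>\<phi>. (\<Sum>k<n. \<Sum>l<n. b k * b l * (exp_functional (w k) \<phi> * exp_functional (w l) \<phi>)) \<partial>Q)
            = (\<Sum>k<n. \<integral>\<phi>. (\<Sum>l<n. b k * b l * (exp_functional (w k) \<phi> * exp_functional (w l) \<phi>)) \<partial>Q)"
          by (intro Bochner_Integration.integral_sum Bochner_Integration.integrable_sum int) auto
        also have "\<dots> = (\<Sum>k<n. \<Sum>l<n. \<integral>\<phi>. b k * b l * (exp_functional (w k) \<phi> * exp_functional (w l) \<phi>) \<partial>Q)"
          by (intro sum.cong refl Bochner_Integration.integral_sum int) auto
        finally show ?thesis by (simp only: integral_mult_right_zero)
      qed
      also have "\<dots> = (\<Sum>k<n. \<Sum>l<n. c k * c l * exp (inner_on \<rho> (v k) (v l)))"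
        by (intro sum.cong refl) (simp add: pair c_def)
      finally have f2: "(\<integral>\<phi>. (f \<phi>)\<^sup>2 \<partial>Q) = (\<Sum>k<n. \<Sum>l<n. c k * c l * exp (inner_on \<rho> (v k) (v l)))" .
      have "(\<Sum>j\<in>J. a j * F (y j)) = (\<Sum>j\<in>J. \<Sum>k<n. a j * c k * exp (inner_on \<rho> (y j) (v k)))"
        by (simp add: F_def sum_distrib_left mult_ac)
      then show ?thesis
        using exp_inner_Cauchy_Schwarz[OF J finite_lessThan[of n], where v = v and a = a and b = c] v f2 by simp
    qed
  qed
qed

section \<open>The kernel norm bound\<close>

definition exp_rem :: "real \<Rightarrow> real" where
  "exp_rem x = (if x = 0 then 1 / 2 else (exp x - 1 - x) / x\<^sup>2)"

lemma exp_eq_exp_rem: "exp x = 1 + x + x\<^sup>2 * exp_rem x"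
  by (simp add: exp_rem_def)

lemma isCont_exp_rem: "isCont exp_rem 0"
proof -
  have "((\<lambda>x::real. (exp x - 1 - x) / x\<^sup>2) \<longlongrightarrow> 1 / 2) (at 0)"
  proof (rule lhopital)
    have "((\<lambda>h::real. (exp (0 + h) - exp 0) / h) \<longlongrightarrow> exp 0) (at 0)"
      using DERIV_exp[of "0::real"] by (simp only: DERIV_def)
    then have "((\<lambda>h::real. (exp h - 1) / h * (1 / 2)) \<longlongrightarrow> 1 * (1 / 2)) (at 0)"
      by (intro tendsto_mult tendsto_const) simp
    then show "((\<lambda>x::real. (exp x - 1) / (2 * x)) \<longlongrightarrow> 1 / 2) (at 0)" by (simp add: field_simps)
    show "((\<lambda>x::real. exp x - 1 - x) \<longlongrightarrow> 0) (at 0)"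
      by (auto intro!: tendsto_eq_intros)
    show "((\<lambda>x::real. x\<^sup>2) \<longlongrightarrow> 0) (at 0)"
      by (auto intro!: tendsto_eq_intros)
    show "\<forall>\<^sub>F x::real in at 0. x\<^sup>2 \<noteq> 0" "\<forall>\<^sub>F x::real in at 0. 2 * x \<noteq> 0"
      by (auto simp: eventually_at_filter)
  qed (auto intro!: derivative_eq_intros always_eventually)
  moreover have "\<forall>\<^sub>F x in at 0. (exp x - 1 - x) / x\<^sup>2 = exp_rem x"
    by (auto simp: eventually_at_filter exp_rem_def)
  ultimately have "(exp_rem \<longlongrightarrow> 1 / 2) (at 0)" by (rule Lim_transform_eventually)
  then show ?thesis by (simp add: isCont_def exp_rem_def[of 0])
qed

lemma exp_rem_tendsto:
  assumes "(f \<longlongrightarrow> 0) F" shows "((\<lambda>s. exp_rem (f s)) \<longlongrightarrow> 1 / 2) F"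
  using isCont_tendsto_compose[OF isCont_exp_rem assms] by (simp add: exp_rem_def[of 0])

lemma exp_first_difference:
  fixes t B :: "'b \<Rightarrow> real"
  assumes "(t \<longlongrightarrow> 0) F" "\<forall>\<^sub>F s in F. t s \<noteq> 0" "(B \<longlongrightarrow> b) F"
  shows "((\<lambda>s. (exp (t s * B s) - 1) / t s) \<longlongrightarrow> b) F"
proof (rule Lim_transform_eventually)
  have "((\<lambda>s. t s * B s) \<longlongrightarrow> 0) F" using tendsto_mult[OF assms(1,3)] by simp
  then have "((\<lambda>s. B s + t s * (B s)\<^sup>2 * exp_rem (t s * B s)) \<longlongrightarrow> b + 0 * b\<^sup>2 * (1 / 2)) F"
    by (intro tendsto_intros assms exp_rem_tendsto)
  then show "((\<lambda>s. B s + t s * (B s)\<^sup>2 * exp_rem (t s * B s)) \<longlongrightarrow> b) F" by simp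
  show "\<forall>\<^sub>F s in F. B s + t s * (B s)\<^sup>2 * exp_rem (t s * B s) = (exp (t s * B s) - 1) / t s"
    using assms(2) by eventually_elim (simp add: exp_eq_exp_rem[of "_ * _"] field_simps power2_eq_square)
qed

lemma exp_second_difference:
  fixes t B C :: "'b \<Rightarrow> real"
  assumes "(t \<longlongrightarrow> 0) F" "\<forall>\<^sub>F s in F. t s \<noteq> 0" "(B \<longlongrightarrow> b) F" "(C \<longlongrightarrow> c) F"
  shows "((\<lambda>s. (exp (2 * t s * B s + (t s)\<^sup>2 * C s) - 2 * exp (t s * B s) + 1) / (t s)\<^sup>2) \<longlongrightarrow> b\<^sup>2 + c) F"
proof (rule Lim_transform_eventually)
  let ?x = "\<lambda>s. 2 * t s * B s + (t s)\<^sup>2 * C s"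
  let ?G = "\<lambda>s. C s + (2 * B s + t s * C s)\<^sup>2 * exp_rem (?x s) - 2 * (B s)\<^sup>2 * exp_rem (t s * B s)"
  have "((\<lambda>s. t s * B s) \<longlongrightarrow> 0 * b) F" "(?x \<longlongrightarrow> 2 * 0 * b + 0\<^sup>2 * c) F"
    by (intro tendsto_intros assms)+
  then have x: "((\<lambda>s. t s * B s) \<longlongrightarrow> 0) F" "(?x \<longlongrightarrow> 0) F" by simp_all
  have "(?G \<longlongrightarrow> c + (2 * b + 0 * c)\<^sup>2 * (1 / 2) - 2 * b\<^sup>2 * (1 / 2)) F"
    by (intro tendsto_intros assms exp_rem_tendsto x)
  then show "(?G \<longlongrightarrow> b\<^sup>2 + c) F" by (simp add: power2_eq_square)
  show "\<forall>\<^sub>F s in F. ?G s = (exp (?x s) - 2 * exp (t s * B s) + 1) / (t s)\<^sup>2"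
    using assms(2)
  proof eventually_elim
    case (elim s)
    have "exp (?x s) - 2 * exp (t s * B s) + 1 = (t s)\<^sup>2 * ?G s"
      unfolding exp_eq_exp_rem[of "?x s"] exp_eq_exp_rem[of "t s * B s"]
      by (simp add: power2_eq_square algebra_simps)
    then show ?case using elim by simp
  qed
qed

text \<open>
  The squared norm of \<open>\<alpha>\<^sub>1 e(u\<^sub>1) + \<alpha>\<^sub>0 e(u\<^sub>0) + \<beta> \<partial>\<^sub>g e(u\<^sub>0)\<close> in the Hilbert space with
  reproducing kernel \<open>exp \<langle>u, v\<rangle>\<close>.
\<close>
definition exp_norm ::
  "'a measure \<Rightarrow> real \<Rightarrow> ('a \<Rightarrow> real) \<Rightarrow> real \<Rightarrow> ('a \<Rightarrow> real) \<Rightarrow> real \<Rightarrow> ('a \<Rightarrow> real) \<Rightarrow> real" where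
  "exp_norm \<rho> \<alpha>\<^sub>1 u\<^sub>1 \<alpha>\<^sub>0 u\<^sub>0 \<beta> g =
    \<alpha>\<^sub>1\<^sup>2 * exp (inner_on \<rho> u\<^sub>1 u\<^sub>1) + 2 * \<alpha>\<^sub>1 * \<alpha>\<^sub>0 * exp (inner_on \<rho> u\<^sub>1 u\<^sub>0) + \<alpha>\<^sub>0\<^sup>2 * exp (inner_on \<rho> u\<^sub>0 u\<^sub>0)
    + 2 * \<alpha>\<^sub>1 * \<beta> * (exp (inner_on \<rho> u\<^sub>1 u\<^sub>0) * inner_on \<rho> u\<^sub>1 g)
    + 2 * \<alpha>\<^sub>0 * \<beta> * (exp (inner_on \<rho> u\<^sub>0 u\<^sub>0) * inner_on \<rho> u\<^sub>0 g)
    + \<beta>\<^sup>2 * (exp (inner_on \<rho> u\<^sub>0 u\<^sub>0) * ((inner_on \<rho> u\<^sub>0 g)\<^sup>2 + inner_on \<rho> g g))"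

lemma exp_span_combination_bound:
  assumes \<rho>: "sets \<rho> = sets X" and f: "f \<in> exp_span X \<rho>"
    and Pr: "exp_law X \<rho> (\<lambda>_. 0) Pr"
    and u: "square_integrable \<rho> u\<^sub>1" "square_integrable \<rho> u\<^sub>0"
    and Q: "exp_law X \<rho> u\<^sub>1 Q\<^sub>1" "exp_law X \<rho> u\<^sub>0 Q\<^sub>0"
    and p: "square_integrable \<rho> p" "integrable \<rho> p" "shift_law X \<rho> u\<^sub>0 p Qp"
    and m: "square_integrable \<rho> m" "integrable \<rho> m" "shift_law X \<rho> u\<^sub>0 m Qm"
    and g: "g = (\<lambda>x. p x + - 1 * m x)"
  shows "(\<alpha>\<^sub>1 * (\<integral>\<phi>. f \<phi> \<partial>Q\<^sub>1) + (\<alpha>\<^sub>0 - \<beta> * (\<integral>x. g x \<partial>\<rho>)) * (\<integral>\<phi>. f \<phi> \<partial>Q\<^sub>0)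
      + \<beta> * (\<integral>\<phi>. f \<phi> \<partial>Qp) - \<beta> * (\<integral>\<phi>. f \<phi> \<partial>Qm))\<^sup>2
    \<le> exp_norm \<rho> \<alpha>\<^sub>1 u\<^sub>1 \<alpha>\<^sub>0 u\<^sub>0 \<beta> g * (\<integral>\<phi>. (f \<phi>)\<^sup>2 \<partial>Pr)"
proof (rule exp_span_extension[OF \<rho> f], goal_cases)
  case (1 F DF)
  note F = 1
  have gs: "square_integrable \<rho> g"
    unfolding g by (intro square_integrable_add square_integrable_cmult p m)
  define N where "N s = (\<alpha>\<^sub>1\<^sup>2 * exp (inner_on \<rho> u\<^sub>1 u\<^sub>1) + 2 * \<alpha>\<^sub>1 * \<alpha>\<^sub>0 * exp (inner_on \<rho> u\<^sub>1 u\<^sub>0) + \<alpha>\<^sub>0\<^sup>2 * exp (inner_on \<rho> u\<^sub>0 u\<^sub>0)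
    + 2 * \<alpha>\<^sub>1 * \<beta> * (exp (inner_on \<rho> u\<^sub>1 u\<^sub>0) * ((exp (s * inner_on \<rho> u\<^sub>1 g) - 1) / s))
    + 2 * \<alpha>\<^sub>0 * \<beta> * (exp (inner_on \<rho> u\<^sub>0 u\<^sub>0) * ((exp (s * inner_on \<rho> u\<^sub>0 g) - 1) / s))
    + \<beta>\<^sup>2 * (exp (inner_on \<rho> u\<^sub>0 u\<^sub>0) * ((exp (2 * s * inner_on \<rho> u\<^sub>0 g + s\<^sup>2 * inner_on \<rho> g g)
        - 2 * exp (s * inner_on \<rho> u\<^sub>0 g) + 1) / s\<^sup>2)))" for s
  let ?us = "\<lambda>s x. u\<^sub>0 x + s * g x"
  have bound: "(\<alpha>\<^sub>1 * F u\<^sub>1 + \<alpha>\<^sub>0 * F u\<^sub>0 + \<beta> * ((F (?us s) - F u\<^sub>0) / s))\<^sup>2 \<le> N s * (\<integral>\<phi>. (f \<phi>)\<^sup>2 \<partial>Pr)"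
    if s: "s \<noteq> 0" for s
  proof -
    define y where "y j = (if j = 0 then u\<^sub>1 else if j = 1 then u\<^sub>0 else ?us s)" for j :: nat
    define a where "a j = (if j = 0 then \<alpha>\<^sub>1 else if j = 1 then \<alpha>\<^sub>0 - \<beta> / s else \<beta> / s)" for j :: nat
    have us: "square_integrable \<rho> (?us s)"
      by (intro square_integrable_add square_integrable_cmult u gs)
    have y: "square_integrable \<rho> (y j)" for j using u us by (simp add: y_def)
    have i1: "inner_on \<rho> u\<^sub>1 (?us s) = inner_on \<rho> u\<^sub>1 u\<^sub>0 + s * inner_on \<rho> u\<^sub>1 g"
      and i2: "inner_on \<rho> u\<^sub>0 (?us s) = inner_on \<rho> u\<^sub>0 u\<^sub>0 + s * inner_on \<rho> u\<^sub>0 g"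
      and i3: "inner_on \<rho> g (?us s) = inner_on \<rho> u\<^sub>0 g + s * inner_on \<rho> g g"
      using u gs by (simp_all add: inner_on_add_right inner_on_commute[of \<rho> g u\<^sub>0])
    have i4: "inner_on \<rho> (?us s) (?us s)
        = inner_on \<rho> u\<^sub>0 u\<^sub>0 + (2 * s * inner_on \<rho> u\<^sub>0 g + s\<^sup>2 * inner_on \<rho> g g)"
      using u gs us by (simp add: inner_on_add_left i2 i3 power2_eq_square algebra_simps)
    have i5: "inner_on \<rho> (?us s) u\<^sub>1 = inner_on \<rho> u\<^sub>1 (?us s)" "inner_on \<rho> (?us s) u\<^sub>0 = inner_on \<rho> u\<^sub>0 (?us s)"
      "inner_on \<rho> u\<^sub>0 u\<^sub>1 = inner_on \<rho> u\<^sub>1 u\<^sub>0"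
      by (rule inner_on_commute)+
    have "(\<Sum>j\<in>{..<3}. a j * F (y j))\<^sup>2 \<le>
        (\<Sum>i\<in>{..<3}. \<Sum>j\<in>{..<3}. a i * a j * exp (inner_on \<rho> (y i) (y j))) * (\<integral>\<phi>. (f \<phi>)\<^sup>2 \<partial>Pr)"
      by (rule F(5)[OF Pr finite_lessThan y])
    moreover have "(\<Sum>j\<in>{..<3}. a j * F (y j)) = \<alpha>\<^sub>1 * F u\<^sub>1 + \<alpha>\<^sub>0 * F u\<^sub>0 + \<beta> * ((F (?us s) - F u\<^sub>0) / s)"
      using s by (simp add: numeral_3_eq_3 a_def y_def field_simps)
    moreover have "(\<Sum>i\<in>{..<3}. \<Sum>j\<in>{..<3}. a i * a j * exp (inner_on \<rho> (y i) (y j))) = N s"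
    proof -
      define r where "r = \<beta> / s"
      define A B C where "A = exp (inner_on \<rho> u\<^sub>1 u\<^sub>0)" and "B = exp (inner_on \<rho> u\<^sub>0 u\<^sub>0)"
        and "C = exp (inner_on \<rho> u\<^sub>1 u\<^sub>1)"
      define D E G where "D = exp (s * inner_on \<rho> u\<^sub>1 g)" and "E = exp (s * inner_on \<rho> u\<^sub>0 g)"
        and "G = exp (2 * s * inner_on \<rho> u\<^sub>0 g + s\<^sup>2 * inner_on \<rho> g g)"
      have "N s = \<alpha>\<^sub>1\<^sup>2 * C + 2 * \<alpha>\<^sub>1 * \<alpha>\<^sub>0 * A + \<alpha>\<^sub>0\<^sup>2 * B + 2 * \<alpha>\<^sub>1 * r * (A * (D - 1))
          + 2 * \<alpha>\<^sub>0 * r * (B * (E - 1)) + r\<^sup>2 * (B * (G - 2 * E + 1))"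
        unfolding N_def A_def B_def C_def D_def E_def G_def r_def
        by (simp add: power_divide)
      moreover have "(\<Sum>i\<in>{..<3}. \<Sum>j\<in>{..<3}. a i * a j * exp (inner_on \<rho> (y i) (y j)))
        = \<alpha>\<^sub>1\<^sup>2 * C + 2 * \<alpha>\<^sub>1 * (\<alpha>\<^sub>0 - r) * A + 2 * \<alpha>\<^sub>1 * r * (A * D) + (\<alpha>\<^sub>0 - r)\<^sup>2 * B
          + 2 * (\<alpha>\<^sub>0 - r) * r * (B * E) + r\<^sup>2 * (B * G)"
        unfolding A_def B_def C_def D_def E_def G_def r_def a_def y_def
        by (simp add: numeral_3_eq_3 i4 i5 exp_add power2_eq_square) (simp add: i1 i2 exp_add algebra_simps)
      ultimately show ?thesis by (simp add: power2_eq_square algebra_simps)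
    qed
    ultimately show ?thesis by simp
  qed
  have lim0: "((\<lambda>s::real. s) \<longlongrightarrow> 0) (at 0)" and ne: "\<forall>\<^sub>F s::real in at 0. s \<noteq> 0"
    by (auto simp: eventually_at_filter)
  have "(N \<longlongrightarrow> exp_norm \<rho> \<alpha>\<^sub>1 u\<^sub>1 \<alpha>\<^sub>0 u\<^sub>0 \<beta> g) (at 0)"
    unfolding N_def exp_norm_def
    by (intro tendsto_intros exp_first_difference exp_second_difference lim0 ne)
  then have limN: "((\<lambda>s. N s * (\<integral>\<phi>. (f \<phi>)\<^sup>2 \<partial>Pr)) \<longlongrightarrow> exp_norm \<rho> \<alpha>\<^sub>1 u\<^sub>1 \<alpha>\<^sub>0 u\<^sub>0 \<beta> g * (\<integral>\<phi>. (f \<phi>)\<^sup>2 \<partial>Pr)) (at 0)"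
    by (intro tendsto_intros)
  have "((\<lambda>s. (F (?us s) - F u\<^sub>0) / s) \<longlongrightarrow> DF u\<^sub>0 g) (at 0)"
    using F(3)[OF u(2) gs] by (simp add: DERIV_def)
  then have "((\<lambda>s. (\<alpha>\<^sub>1 * F u\<^sub>1 + \<alpha>\<^sub>0 * F u\<^sub>0 + \<beta> * ((F (?us s) - F u\<^sub>0) / s))\<^sup>2)
      \<longlongrightarrow> (\<alpha>\<^sub>1 * F u\<^sub>1 + \<alpha>\<^sub>0 * F u\<^sub>0 + \<beta> * DF u\<^sub>0 g)\<^sup>2) (at 0)"
    by (intro tendsto_intros)
  then have "(\<alpha>\<^sub>1 * F u\<^sub>1 + \<alpha>\<^sub>0 * F u\<^sub>0 + \<beta> * DF u\<^sub>0 g)\<^sup>2 \<le> exp_norm \<rho> \<alpha>\<^sub>1 u\<^sub>1 \<alpha>\<^sub>0 u\<^sub>0 \<beta> g * (\<integral>\<phi>. (f \<phi>)\<^sup>2 \<partial>Pr)"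
    by (rule tendsto_le[OF _ limN, rotated]) (use bound ne in \<open>auto elim: eventually_mono\<close>)
  moreover have DFg: "DF u\<^sub>0 g = DF u\<^sub>0 p - DF u\<^sub>0 m"
    unfolding g using F(4)[OF p(1) m(1), of u\<^sub>0 "- 1"] by simp
  have int: "(\<integral>x. g x \<partial>\<rho>) = (\<integral>x. p x \<partial>\<rho>) - (\<integral>x. m x \<partial>\<rho>)"
    unfolding g using p(2) m(2) by simp
  have "\<alpha>\<^sub>1 * (\<integral>\<phi>. f \<phi> \<partial>Q\<^sub>1) + (\<alpha>\<^sub>0 - \<beta> * (\<integral>x. g x \<partial>\<rho>)) * (\<integral>\<phi>. f \<phi> \<partial>Q\<^sub>0)
      + \<beta> * (\<integral>\<phi>. f \<phi> \<partial>Qp) - \<beta> * (\<integral>\<phi>. f \<phi> \<partial>Qm) = \<alpha>\<^sub>1 * F u\<^sub>1 + \<alpha>\<^sub>0 * F u\<^sub>0 + \<beta> * DF u\<^sub>0 g"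
    unfolding F(1)[OF Q(1)] F(1)[OF Q(2)] F(2)[OF p(3,1,2)] F(2)[OF m(3,1,2)] DFg int
    by (simp add: algebra_simps)
  ultimately show ?case by simp
qed

lemma exp_span_bound_extend:
  fixes M :: "nat \<Rightarrow> 'a measure measure" and q :: "nat \<Rightarrow> real"
  assumes \<rho>: "sets \<rho> = sets X" "sigma_finite_measure \<rho>"
    and M: "\<And>i. finite_measure (M i)" "\<And>i. sets (M i) = sets (point_measure_algebra X)"
    and Pr: "finite_measure Pr" "sets Pr = sets (point_measure_algebra X)"
    and bound: "\<And>f. f \<in> exp_span X \<rho> \<Longrightarrow>
      (\<Sum>i<n. q i * (\<integral>\<phi>. f \<phi> \<partial>M i))\<^sup>2 \<le> K * (\<integral>\<phi>. (f \<phi>)\<^sup>2 \<partial>Pr)"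
    and f: "f \<in> borel_measurable (point_measure_algebra X)" "integrable Pr (\<lambda>\<phi>. (f \<phi>)\<^sup>2)"
    and fi: "\<And>i. i < n \<Longrightarrow> integrable (M i) f"
  shows "(\<Sum>i<n. q i * (\<integral>\<phi>. f \<phi> \<partial>M i))\<^sup>2 \<le> K * (\<integral>\<phi>. (f \<phi>)\<^sup>2 \<partial>Pr)"
proof -
  let ?N = "point_measure_algebra X"
  have bounded: "(\<Sum>i<n. q i * (\<integral>\<phi>. f \<phi> \<partial>M i))\<^sup>2 \<le> K * (\<integral>\<phi>. (f \<phi>)\<^sup>2 \<partial>Pr)"
    if f: "f \<in> borel_measurable ?N" and C: "\<And>\<phi>. \<bar>f \<phi>\<bar> \<le> C" for f C
  proof -
    define Ms where "Ms = insert Pr (M ` {..<n})"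
    have Ms: "finite Ms" "\<And>M. M \<in> Ms \<Longrightarrow> finite_measure M" "\<And>M. M \<in> Ms \<Longrightarrow> sets M = sets ?N"
      using M Pr by (auto simp: Ms_def)
    interpret function_algebra ?N Ms "exp_span X \<rho>"
      using \<rho>(1) Ms by (rule exp_span_function_algebra)
    have "\<exists>g\<in>exp_span X \<rho>. \<forall>M\<in>Ms. (\<integral>\<phi>. (f \<phi> - g \<phi>)\<^sup>2 \<partial>M) < 1 / Suc k" for k
      using exp_span_L2_dense[OF \<rho> Ms f C] by simp
    then obtain g where g: "\<And>k. g k \<in> exp_span X \<rho>"
      "\<And>k M. M \<in> Ms \<Longrightarrow> (\<integral>\<phi>. (f \<phi> - g k \<phi>)\<^sup>2 \<partial>M) < 1 / Suc k"
      by metis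
    have fb: "f \<in> bfun" using f C by (auto simp: bfun_def)
    have diffb: "(\<lambda>\<phi>. f \<phi> - g k \<phi>) \<in> bfun" for k by (intro bfun_minus fb A_bfun g)
    have L2: "(\<lambda>k. \<integral>\<phi>. (f \<phi> - g k \<phi>)\<^sup>2 \<partial>M) \<longlonglongrightarrow> 0" if "M \<in> Ms" for M
    proof (rule Lim_null_comparison)
      show "\<forall>\<^sub>F k in sequentially. norm (\<integral>\<phi>. (f \<phi> - g k \<phi>)\<^sup>2 \<partial>M) \<le> 1 / Suc k"
        using g(2)[OF that] by (auto intro!: always_eventually less_imp_le)
      show "(\<lambda>k. 1 / real (Suc k)) \<longlonglongrightarrow> 0" by (rule LIMSEQ_Suc[OF lim_1_over_n])
    qed
    have L1: "(\<lambda>k. \<integral>\<phi>. \<bar>f \<phi> - g k \<phi>\<bar> \<partial>M) \<longlonglongrightarrow> 0" if M: "M \<in> Ms" for M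
    proof -
      interpret finite_measure M by (rule Ms(2)[OF M])
      have "(\<integral>\<phi>. \<bar>f \<phi> - g k \<phi>\<bar> \<partial>M)\<^sup>2 \<le> (\<integral>\<phi>. (f \<phi> - g k \<phi>)\<^sup>2 \<partial>M) * measure M (space M)" for k
      proof -
        have "square_integrable M (\<lambda>\<phi>. \<bar>f \<phi> - g k \<phi>\<bar>)" "square_integrable M (\<lambda>_. 1)"
          using bfun_integrable[OF diffb M, of k] bfun_square_integrable[OF diffb M, of k]
          by (auto simp: square_integrable_def)
        from inner_on_Cauchy_Schwarz[OF this] show ?thesis
          by (simp add: inner_on_def flip: power2_eq_square)
      qed
      then have "(\<lambda>k. (\<integral>\<phi>. \<bar>f \<phi> - g k \<phi>\<bar> \<partial>M)\<^sup>2) \<longlonglongrightarrow> 0"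
        using tendsto_mult[OF L2[OF M] tendsto_const[of "measure M (space M)"]]
        by (intro Lim_null_comparison[of "\<lambda>k. (\<integral>\<phi>. \<bar>f \<phi> - g k \<phi>\<bar> \<partial>M)\<^sup>2"]) auto
      then show ?thesis by simp
    qed
    have lim: "(\<lambda>k. \<integral>\<phi>. g k \<phi> \<partial>M) \<longlonglongrightarrow> (\<integral>\<phi>. f \<phi> \<partial>M)" if M: "M \<in> Ms" for M
    proof (rule Lim_null[THEN iffD2], rule Lim_null_comparison[OF _ L1[OF M]])
      have "norm ((\<integral>\<phi>. g k \<phi> \<partial>M) - (\<integral>\<phi>. f \<phi> \<partial>M)) \<le> (\<integral>\<phi>. \<bar>f \<phi> - g k \<phi>\<bar> \<partial>M)" for k
      proof -
        have "(\<integral>\<phi>. g k \<phi> \<partial>M) - (\<integral>\<phi>. f \<phi> \<partial>M) = - (\<integral>\<phi>. f \<phi> - g k \<phi> \<partial>M)"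
          using bfun_integrable[OF fb M] bfun_integrable[OF A_bfun[OF g(1)] M] by simp
        then show ?thesis using integral_abs_bound[of M "\<lambda>\<phi>. f \<phi> - g k \<phi>"] by simp
      qed
      then show "\<forall>\<^sub>F k in sequentially. norm ((\<integral>\<phi>. g k \<phi> \<partial>M) - (\<integral>\<phi>. f \<phi> \<partial>M)) \<le> (\<integral>\<phi>. \<bar>f \<phi> - g k \<phi>\<bar> \<partial>M)"
        by simp
    qed
    have "Pr \<in> Ms" by (simp add: Ms_def)
    have lim2: "(\<lambda>k. \<integral>\<phi>. (g k \<phi>)\<^sup>2 \<partial>Pr) \<longlonglongrightarrow> (\<integral>\<phi>. (f \<phi>)\<^sup>2 \<partial>Pr)"
    proof (rule Lim_null[THEN iffD2], rule Lim_null_comparison)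
      show "(\<lambda>k. (\<integral>\<phi>. (f \<phi> - g k \<phi>)\<^sup>2 \<partial>Pr) + 2 * C * (\<integral>\<phi>. \<bar>f \<phi> - g k \<phi>\<bar> \<partial>Pr)) \<longlonglongrightarrow> 0"
        using tendsto_add[OF L2[OF \<open>Pr \<in> Ms\<close>] tendsto_mult[OF tendsto_const[of "2 * C"] L1[OF \<open>Pr \<in> Ms\<close>]]]
        by simp
      have "norm ((\<integral>\<phi>. (g k \<phi>)\<^sup>2 \<partial>Pr) - (\<integral>\<phi>. (f \<phi>)\<^sup>2 \<partial>Pr))
        \<le> (\<integral>\<phi>. (f \<phi> - g k \<phi>)\<^sup>2 \<partial>Pr) + 2 * C * (\<integral>\<phi>. \<bar>f \<phi> - g k \<phi>\<bar> \<partial>Pr)" for k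
      proof -
        note int = bfun_square_integrable[OF A_bfun[OF g(1)] \<open>Pr \<in> Ms\<close>, of k]
          bfun_square_integrable[OF fb \<open>Pr \<in> Ms\<close>] bfun_square_integrable[OF diffb \<open>Pr \<in> Ms\<close>, of k]
          bfun_integrable[OF diffb \<open>Pr \<in> Ms\<close>, of k]
        have "norm ((\<integral>\<phi>. (g k \<phi>)\<^sup>2 \<partial>Pr) - (\<integral>\<phi>. (f \<phi>)\<^sup>2 \<partial>Pr)) = \<bar>\<integral>\<phi>. (g k \<phi>)\<^sup>2 - (f \<phi>)\<^sup>2 \<partial>Pr\<bar>"
          using int by simp
        also have "\<dots> \<le> (\<integral>\<phi>. \<bar>(g k \<phi>)\<^sup>2 - (f \<phi>)\<^sup>2\<bar> \<partial>Pr)" by (rule integral_abs_bound)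
        also have "\<dots> \<le> (\<integral>\<phi>. (f \<phi> - g k \<phi>)\<^sup>2 + 2 * C * \<bar>f \<phi> - g k \<phi>\<bar> \<partial>Pr)"
        proof (rule integral_mono)
          fix \<phi>
          have "(g k \<phi>)\<^sup>2 - (f \<phi>)\<^sup>2 = (f \<phi> - g k \<phi>)\<^sup>2 - 2 * (f \<phi> * (f \<phi> - g k \<phi>))"
            by (simp add: power2_eq_square algebra_simps)
          also have "\<bar>\<dots>\<bar> \<le> (f \<phi> - g k \<phi>)\<^sup>2 + 2 * \<bar>f \<phi> * (f \<phi> - g k \<phi>)\<bar>"
            using zero_le_power2[of "f \<phi> - g k \<phi>"] by linarith
          also have "\<bar>f \<phi> * (f \<phi> - g k \<phi>)\<bar> \<le> C * \<bar>f \<phi> - g k \<phi>\<bar>"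
            unfolding abs_mult using C by (intro mult_right_mono) auto
          finally show "\<bar>(g k \<phi>)\<^sup>2 - (f \<phi>)\<^sup>2\<bar> \<le> (f \<phi> - g k \<phi>)\<^sup>2 + 2 * C * \<bar>f \<phi> - g k \<phi>\<bar>" by simp
        qed (use int in auto)
        also have "\<dots> = (\<integral>\<phi>. (f \<phi> - g k \<phi>)\<^sup>2 \<partial>Pr) + 2 * C * (\<integral>\<phi>. \<bar>f \<phi> - g k \<phi>\<bar> \<partial>Pr)"
          using int by simp
        finally show ?thesis .
      qed
      then show "\<forall>\<^sub>F k in sequentially. norm ((\<integral>\<phi>. (g k \<phi>)\<^sup>2 \<partial>Pr) - (\<integral>\<phi>. (f \<phi>)\<^sup>2 \<partial>Pr))
        \<le> (\<integral>\<phi>. (f \<phi> - g k \<phi>)\<^sup>2 \<partial>Pr) + 2 * C * (\<integral>\<phi>. \<bar>f \<phi> - g k \<phi>\<bar> \<partial>Pr)" by simp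
    qed
    show ?thesis
    proof (rule LIMSEQ_le)
      show "(\<lambda>k. (\<Sum>i<n. q i * (\<integral>\<phi>. g k \<phi> \<partial>M i))\<^sup>2) \<longlonglongrightarrow> (\<Sum>i<n. q i * (\<integral>\<phi>. f \<phi> \<partial>M i))\<^sup>2"
        by (intro tendsto_intros lim) (auto simp: Ms_def)
      show "(\<lambda>k. K * (\<integral>\<phi>. (g k \<phi>)\<^sup>2 \<partial>Pr)) \<longlonglongrightarrow> K * (\<integral>\<phi>. (f \<phi>)\<^sup>2 \<partial>Pr)"
        by (intro tendsto_intros lim2)
    qed (use bound[OF g(1)] in auto)
  qed
  define tr where "tr k \<phi> = max (- real k) (min (real k) (f \<phi>))" for k \<phi>
  have tr_lim: "(\<lambda>k. tr k \<phi>) \<longlonglongrightarrow> f \<phi>" for \<phi>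
  proof (rule tendsto_eventually)
    obtain k\<^sub>0 where "\<bar>f \<phi>\<bar> \<le> real k\<^sub>0" using real_arch_simple by blast
    then have "tr k \<phi> = f \<phi>" if "k \<ge> k\<^sub>0" for k
      using that by (auto simp: tr_def max_def min_def)
    then show "\<forall>\<^sub>F k in sequentially. tr k \<phi> = f \<phi>" by (auto simp: eventually_sequentially)
  qed
  have tr_le: "\<bar>tr k \<phi>\<bar> \<le> \<bar>f \<phi>\<bar>" "\<bar>tr k \<phi>\<bar> \<le> real k" for k \<phi>
    by (auto simp: tr_def max_def min_def)
  have tr_meas: "tr k \<in> borel_measurable ?N" for k
    unfolding tr_def[abs_def] using f(1) by measurable
  show ?thesis
  proof (rule LIMSEQ_le)
    show "(\<lambda>k. (\<Sum>i<n. q i * (\<integral>\<phi>. tr k \<phi> \<partial>M i))\<^sup>2) \<longlonglongrightarrow> (\<Sum>i<n. q i * (\<integral>\<phi>. f \<phi> \<partial>M i))\<^sup>2"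
    proof (intro tendsto_intros)
      fix i assume "i \<in> {..<n}"
      then have "integrable (M i) (\<lambda>\<phi>. \<bar>f \<phi>\<bar>)" using fi by simp
      moreover have "f \<in> borel_measurable (M i)" "tr k \<in> borel_measurable (M i)" for k
        using f(1) tr_meas[of k] by (simp_all only: measurable_cong_sets[OF M(2) refl])
      ultimately show "(\<lambda>k. \<integral>\<phi>. tr k \<phi> \<partial>M i) \<longlonglongrightarrow> (\<integral>\<phi>. f \<phi> \<partial>M i)"
        using tr_lim tr_le
        by (intro integral_dominated_convergence[where w = "\<lambda>\<phi>. \<bar>f \<phi>\<bar>"]) auto
    qed
    show "(\<lambda>k. K * (\<integral>\<phi>. (tr k \<phi>)\<^sup>2 \<partial>Pr)) \<longlonglongrightarrow> K * (\<integral>\<phi>. (f \<phi>)\<^sup>2 \<partial>Pr)"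
    proof (intro tendsto_intros integral_dominated_convergence[where w = "\<lambda>\<phi>. (f \<phi>)\<^sup>2"] AE_I2)
      show "norm ((tr k \<phi>)\<^sup>2) \<le> (f \<phi>)\<^sup>2" for k \<phi>
        using tr_le(1)[of k \<phi>] by (simp add: abs_le_square_iff)
      show "(\<lambda>\<phi>. (f \<phi>)\<^sup>2) \<in> borel_measurable Pr" "(\<lambda>\<phi>. (tr k \<phi>)\<^sup>2) \<in> borel_measurable Pr" for k
        unfolding measurable_cong_sets[OF Pr(2) refl] using f(1) tr_meas by measurable
    qed (use f(2) tr_lim in auto)
    show "\<exists>N. \<forall>k\<ge>N. (\<Sum>i<n. q i * (\<integral>\<phi>. tr k \<phi> \<partial>M i))\<^sup>2 \<le> K * (\<integral>\<phi>. (tr k \<phi>)\<^sup>2 \<partial>Pr)"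
      using bounded[OF tr_meas tr_le(2)] by auto
  qed
qed

lemma exp_span_bound_integrable:
  fixes f :: "'a measure \<Rightarrow> real"
  assumes \<rho>: "sets \<rho> = sets X" "sigma_finite_measure \<rho>"
    and Q: "finite_measure Q" "sets Q = sets (point_measure_algebra X)"
    and Pr: "prob_space Pr" "sets Pr = sets (point_measure_algebra X)"
    and bound: "\<And>f. f \<in> exp_span X \<rho> \<Longrightarrow> (\<integral>\<phi>. f \<phi> \<partial>Q)\<^sup>2 \<le> K * (\<integral>\<phi>. (f \<phi>)\<^sup>2 \<partial>Pr)"
    and f: "f \<in> borel_measurable (point_measure_algebra X)" "integrable Pr (\<lambda>\<phi>. (f \<phi>)\<^sup>2)"
  shows "integrable Q f"
proof -
  interpret Q: finite_measure Q by fact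
  interpret Pr: prob_space Pr by fact
  have "0 \<le> (\<integral>\<phi>. (1::real) \<partial>Q)\<^sup>2" by simp
  also have "\<dots> \<le> K * (\<integral>\<phi>. 1\<^sup>2 \<partial>Pr)" by (rule bound[OF exp_span_const])
  finally have K: "0 \<le> K" by (simp add: Pr.prob_space)
  define D where "D = K * (\<integral>\<phi>. (f \<phi>)\<^sup>2 \<partial>Pr)"
  define tr where "tr k \<phi> = min (real k) \<bar>f \<phi>\<bar>" for k \<phi>
  have trN: "tr k \<in> borel_measurable (point_measure_algebra X)" for k
    unfolding tr_def[abs_def] using f(1) by measurable
  then have trQ: "tr k \<in> borel_measurable Q" and trPr: "tr k \<in> borel_measurable Pr" for k
    by (simp_all only: measurable_cong_sets[OF Q(2) refl] measurable_cong_sets[OF Pr(2) refl])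
  have fQ: "f \<in> borel_measurable Q" and fPr: "f \<in> borel_measurable Pr"
    using f(1) by (simp_all only: measurable_cong_sets[OF Q(2) refl] measurable_cong_sets[OF Pr(2) refl])
  have tr0: "0 \<le> tr k \<phi>" "tr k \<phi> \<le> real k" "tr k \<phi> \<le> \<bar>f \<phi>\<bar>" for k \<phi> by (auto simp: tr_def)
  have tr_int: "integrable Q (tr k)" for k
    using tr0[of k] trQ by (intro Q.integrable_const_bound[of _ "real k"]) auto
  have sq_le: "(tr k \<phi>)\<^sup>2 \<le> (f \<phi>)\<^sup>2" for k \<phi>
    using tr0[of k \<phi>] by (metis abs_le_square_iff abs_of_nonneg)
  have tr2: "integrable Pr (\<lambda>\<phi>. (tr k \<phi>)\<^sup>2)" for k
    using f(2) trPr sq_le by (intro Bochner_Integration.integrable_bound[OF f(2)]) auto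
  have le: "(\<integral>\<phi>. tr k \<phi> \<partial>Q) \<le> sqrt D" for k
  proof (rule real_le_rsqrt)
    have "(\<Sum>i<Suc 0. 1 * (\<integral>\<phi>. tr k \<phi> \<partial>Q))\<^sup>2 \<le> K * (\<integral>\<phi>. (tr k \<phi>)\<^sup>2 \<partial>Pr)"
    proof (rule exp_span_bound_extend[OF \<rho> Q Pr.finite_measure_axioms Pr(2) _ trN tr2 tr_int])
      fix f assume "f \<in> exp_span X \<rho>"
      from bound[OF this] show "(\<Sum>i<Suc 0. 1 * (\<integral>\<phi>. f \<phi> \<partial>Q))\<^sup>2 \<le> K * (\<integral>\<phi>. (f \<phi>)\<^sup>2 \<partial>Pr)" by simp
    qed
    also have "\<dots> \<le> D"
      unfolding D_def using tr2 f(2) sq_le K by (intro mult_left_mono integral_mono) auto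
    finally show "(\<integral>\<phi>. tr k \<phi> \<partial>Q)\<^sup>2 \<le> D" by simp
  qed
  have "(\<lambda>k. \<integral>\<^sup>+\<phi>. ennreal (tr k \<phi>) \<partial>Q) \<longlonglongrightarrow> (\<integral>\<^sup>+\<phi>. ennreal \<bar>f \<phi>\<bar> \<partial>Q)"
  proof (rule nn_integral_LIMSEQ)
    show "incseq (\<lambda>k \<phi>. ennreal (tr k \<phi>))"
      by (auto simp: incseq_def le_fun_def tr_def intro!: ennreal_leI)
    show "(\<lambda>\<phi>. ennreal (tr k \<phi>)) \<in> borel_measurable Q" for k using trQ by measurable
    show "(\<lambda>k. ennreal (tr k \<phi>)) \<longlonglongrightarrow> ennreal \<bar>f \<phi>\<bar>" for \<phi>
    proof (rule tendsto_eventually)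
      obtain k\<^sub>0 where "\<bar>f \<phi>\<bar> \<le> real k\<^sub>0" using real_arch_simple by blast
      then have "tr k \<phi> = \<bar>f \<phi>\<bar>" if "k \<ge> k\<^sub>0" for k
        using that by (auto simp: tr_def min_def)
      then show "\<forall>\<^sub>F k in sequentially. ennreal (tr k \<phi>) = ennreal \<bar>f \<phi>\<bar>"
        by (auto simp: eventually_sequentially intro!: exI[of _ k\<^sub>0])
    qed
  qed
  then have "(\<integral>\<^sup>+\<phi>. ennreal \<bar>f \<phi>\<bar> \<partial>Q) \<le> ennreal (sqrt D)"
  proof (rule LIMSEQ_le_const2, intro exI allI impI)
    fix k
    have "(\<integral>\<^sup>+\<phi>. ennreal (tr k \<phi>) \<partial>Q) = ennreal (\<integral>\<phi>. tr k \<phi> \<partial>Q)"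
      using tr_int tr0 by (intro nn_integral_eq_integral) auto
    also have "\<dots> \<le> ennreal (sqrt D)" by (intro ennreal_leI le)
    finally show "(\<integral>\<^sup>+\<phi>. ennreal (tr k \<phi>) \<partial>Q) \<le> ennreal (sqrt D)" .
  qed
  then show ?thesis
    using fQ by (auto simp: integrable_iff_bounded intro: le_less_trans)
qed

section \<open>Adding a random point\<close>

lemma sets_point_measures: "\<phi> \<in> space (point_measure_algebra X) \<Longrightarrow> sets \<phi> = sets X"
  by (simp add: space_point_measure_algebra point_measures_sets)

lemma measurable_add_return:
  assumes "sets M = sets X" "sets Q = sets (point_measure_algebra X)"
  shows "(\<lambda>(x, \<phi>). add_measure \<phi> (return X x)) \<in> measurable (M \<Otimes>\<^sub>M Q) (point_measure_algebra X)"
proof -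
  let ?N = "point_measure_algebra X"
  have "(\<lambda>(x, \<phi>). add_measure \<phi> (return X x)) \<in> measurable (X \<Otimes>\<^sub>M ?N) ?N"
    unfolding point_measure_algebra_def[of X, THEN arg_cong[where f = "measurable (X \<Otimes>\<^sub>M ?N)"]]
  proof (rule measurable_SUP2)
    fix B assume B [measurable]: "B \<in> sets X"
    have "(\<lambda>(x, \<phi>). emeasure \<phi> B + indicator B x) \<in> borel_measurable (X \<Otimes>\<^sub>M ?N)"
      by measurable
    then have "(\<lambda>p. emeasure (case p of (x, \<phi>) \<Rightarrow> add_measure \<phi> (return X x)) B) \<in> borel_measurable (X \<Otimes>\<^sub>M ?N)"
    proof (rule measurable_cong[THEN iffD1, rotated])
      fix p assume "p \<in> space (X \<Otimes>\<^sub>M ?N)"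
      then show "(case p of (x, \<phi>) \<Rightarrow> emeasure \<phi> B + indicator B x) =
          emeasure (case p of (x, \<phi>) \<Rightarrow> add_measure \<phi> (return X x)) B"
        using B sets_point_measures[of "snd p" X]
        by (cases p) (simp add: space_pair_measure emeasure_add_measure)
    qed
    then show "(\<lambda>(x, \<phi>). add_measure \<phi> (return X x))
        \<in> X \<Otimes>\<^sub>M ?N \<rightarrow>\<^sub>M vimage_algebra (point_measures X) (\<lambda>\<phi>. emeasure \<phi> B) borel"
      by (intro measurable_vimage_algebra2)
        (auto simp: space_pair_measure space_point_measure_algebra add_return_in_point_measures)
  qed auto
  moreover have "measurable (M \<Otimes>\<^sub>M Q) ?N = measurable (X \<Otimes>\<^sub>M ?N) ?N"
    by (rule measurable_cong_sets[OF sets_pair_measure_cong[OF assms] refl])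
  ultimately show ?thesis by simp
qed

definition shift_measure ::
  "'a measure \<Rightarrow> 'a measure \<Rightarrow> 'a measure measure \<Rightarrow> ('a \<Rightarrow> real) \<Rightarrow> 'a measure measure" where
  "shift_measure X \<rho> Q g = distr (density \<rho> (\<lambda>x. ennreal (g x)) \<Otimes>\<^sub>M Q) (point_measure_algebra X)
     (\<lambda>(x, \<phi>). add_measure \<phi> (return X x))"

lemma sets_shift_measure [simp]: "sets (shift_measure X \<rho> Q g) = sets (point_measure_algebra X)"
  by (simp add: shift_measure_def)

lemma finite_measure_density:
  assumes "integrable \<rho> g" "\<And>x. 0 \<le> g x"
  shows "finite_measure (density \<rho> (\<lambda>x. ennreal (g x)))"
proof (rule finite_measureI)
  have "emeasure (density \<rho> (\<lambda>x. ennreal (g x))) (space \<rho>) = (\<integral>\<^sup>+x. ennreal (g x) * indicator (space \<rho>) x \<partial>\<rho>)"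
    using assms by (intro emeasure_density) auto
  also have "\<dots> = (\<integral>\<^sup>+x. ennreal (g x) \<partial>\<rho>)"
    by (intro nn_integral_cong) (simp add: indicator_def)
  also have "\<dots> = ennreal (\<integral>x. g x \<partial>\<rho>)"
    using assms by (intro nn_integral_eq_integral) auto
  finally show "emeasure (density \<rho> (\<lambda>x. ennreal (g x))) (space (density \<rho> (\<lambda>x. ennreal (g x)))) \<noteq> \<infinity>"
    by simp
qed

context
  fixes X \<rho> :: "'a measure" and Q :: "'a measure measure" and g :: "'a \<Rightarrow> real"
  assumes \<rho>: "sets \<rho> = sets X" and Q: "finite_measure Q" "sets Q = sets (point_measure_algebra X)"
    and g: "integrable \<rho> g" "\<And>x. 0 \<le> g x"
begin

lemma shift_measure_map [measurable]:
  "(\<lambda>(x, \<phi>). add_measure \<phi> (return X x)) \<in>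
    measurable (density \<rho> (\<lambda>x. ennreal (g x)) \<Otimes>\<^sub>M Q) (point_measure_algebra X)"
  by (rule measurable_add_return) (simp_all add: \<rho> Q)

lemma finite_shift_measure: "finite_measure (shift_measure X \<rho> Q g)"
  unfolding shift_measure_def
  by (intro finite_measure.finite_measure_distr finite_measure_pair_measure Q
      finite_measure_density g shift_measure_map)

lemma integrable_shift_measure:
  assumes f: "f \<in> borel_measurable (point_measure_algebra X)"
    and int: "integrable (shift_measure X \<rho> Q g) f"
  shows "AE x in \<rho>. 0 < g x \<longrightarrow> integrable Q (\<lambda>\<phi>. f (add_measure \<phi> (return X x)))"
    and "integrable \<rho> (\<lambda>x. g x * (\<integral>\<phi>. f (add_measure \<phi> (return X x)) \<partial>Q))"
    and "(\<integral>\<phi>. f \<phi> \<partial>shift_measure X \<rho> Q g) = (\<integral>x. g x * (\<integral>\<phi>. f (add_measure \<phi> (return X x)) \<partial>Q) \<partial>\<rho>)"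
proof -
  let ?D = "density \<rho> (\<lambda>x. ennreal (g x))"
  interpret D: finite_measure ?D by (intro finite_measure_density g)
  interpret Q: finite_measure Q by (rule Q)
  interpret pair_sigma_finite ?D Q ..
  have int': "integrable (?D \<Otimes>\<^sub>M Q) (\<lambda>p. f (case p of (x, \<phi>) \<Rightarrow> add_measure \<phi> (return X x)))"
    using int f unfolding shift_measure_def by (subst (asm) integrable_distr_eq) auto
  have gm: "g \<in> borel_measurable \<rho>" "(\<lambda>x. ennreal (g x)) \<in> borel_measurable \<rho>" using g by auto
  have "AE x in ?D. integrable Q (\<lambda>\<phi>. f (add_measure \<phi> (return X x)))"
    using AE_integrable_fst'[OF int'] by simp
  then show "AE x in \<rho>. 0 < g x \<longrightarrow> integrable Q (\<lambda>\<phi>. f (add_measure \<phi> (return X x)))"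
    using gm by (simp add: AE_density)
  have fst: "integrable ?D (\<lambda>x. \<integral>\<phi>. f (add_measure \<phi> (return X x)) \<partial>Q)"
    using integrable_fst'[OF int'] by simp
  have "(\<lambda>x. \<integral>\<phi>. f (add_measure \<phi> (return X x)) \<partial>Q) \<in> borel_measurable ?D"
    using fst by (rule borel_measurable_integrable)
  then have km: "(\<lambda>x. \<integral>\<phi>. f (add_measure \<phi> (return X x)) \<partial>Q) \<in> borel_measurable \<rho>" by simp
  show "integrable \<rho> (\<lambda>x. g x * (\<integral>\<phi>. f (add_measure \<phi> (return X x)) \<partial>Q))"
    using fst integrable_density[OF km gm(1)] g(2) by simp
  have "(\<integral>\<phi>. f \<phi> \<partial>shift_measure X \<rho> Q g) = (\<integral>p. f (case p of (x, \<phi>) \<Rightarrow> add_measure \<phi> (return X x)) \<partial>(?D \<Otimes>\<^sub>M Q))"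
    unfolding shift_measure_def by (rule integral_distr[OF shift_measure_map f])
  also have "\<dots> = (\<integral>x. (\<integral>\<phi>. f (add_measure \<phi> (return X x)) \<partial>Q) \<partial>?D)"
    using integral_fst'[OF int'] by simp
  also have "\<dots> = (\<integral>x. g x * (\<integral>\<phi>. f (add_measure \<phi> (return X x)) \<partial>Q) \<partial>\<rho>)"
    using integral_density[OF km gm(1)] g(2) by simp
  finally show "(\<integral>\<phi>. f \<phi> \<partial>shift_measure X \<rho> Q g) = (\<integral>x. g x * (\<integral>\<phi>. f (add_measure \<phi> (return X x)) \<partial>Q) \<partial>\<rho>)" .
qed

lemma shift_law_shift_measure:
  assumes "exp_law X \<rho> u Q"
  shows "shift_law X \<rho> u g (shift_measure X \<rho> Q g)"
  unfolding shift_law_def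
proof (intro conjI ballI finite_shift_measure)
  fix w assume w: "w \<in> test_functions \<rho>"
  have w': "simple_function X w" "\<And>x. 0 \<le> w x" using w test_functions_iff[OF \<rho>] by auto
  have "(\<integral>\<phi>. exp_functional w \<phi> \<partial>shift_measure X \<rho> Q g)
      = (\<integral>x. g x * (\<integral>\<phi>. exp_functional w (add_measure \<phi> (return X x)) \<partial>Q) \<partial>\<rho>)"
    by (intro integrable_shift_measure exp_functional_measurable w'
        exp_functional_integrable[OF \<rho> w finite_shift_measure]) simp
  also have "\<dots> = (\<integral>x. (exp (- w x) * g x) * (\<integral>\<phi>. exp_functional w \<phi> \<partial>Q) \<partial>\<rho>)"
  proof (intro Bochner_Integration.integral_cong refl)
    fix x assume "x \<in> space \<rho>"
    then have x: "x \<in> space X" using sets_eq_imp_space_eq[OF \<rho>] by simp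
    have "(\<integral>\<phi>. exp_functional w (add_measure \<phi> (return X x)) \<partial>Q) = (\<integral>\<phi>. exp_functional w \<phi> * exp (- w x) \<partial>Q)"
    proof (intro Bochner_Integration.integral_cong refl exp_functional_add_return w' x)
      fix \<phi> assume "\<phi> \<in> space Q"
      then show "sets \<phi> = sets X" using sets_eq_imp_space_eq[OF Q(2)] by (simp add: sets_point_measures)
    qed
    then show "g x * (\<integral>\<phi>. exp_functional w (add_measure \<phi> (return X x)) \<partial>Q)
        = (exp (- w x) * g x) * (\<integral>\<phi>. exp_functional w \<phi> \<partial>Q)" by simp
  qed
  also have "\<dots> = (\<integral>x. exp (- w x) * g x \<partial>\<rho>) * (\<integral>\<phi>. exp_functional w \<phi> \<partial>Q)" by simp
  finally show "(\<integral>\<phi>. exp_functional w \<phi> \<partial>shift_measure X \<rho> Q g) = (\<integral>x. exp (- w x) * g x \<partial>\<rho>) *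
      (exp (\<integral>x. (exp (- w x) - 1) \<partial>\<rho>) * exp (inner_on \<rho> u (\<lambda>x. exp (- w x) - 1)))"
    using assms w by (simp add: exp_law_def)
qed simp

end

lemma exp_law_integrable:
  fixes f :: "'a measure \<Rightarrow> real"
  assumes \<rho>: "sets \<rho> = sets X" "sigma_finite_measure \<rho>"
    and Pr: "prob_space Pr" "exp_law X \<rho> (\<lambda>_. 0) Pr"
    and u: "square_integrable \<rho> u" and Q: "exp_law X \<rho> u Q"
    and f: "f \<in> borel_measurable (point_measure_algebra X)" "integrable Pr (\<lambda>\<phi>. (f \<phi>)\<^sup>2)"
  shows "integrable Q f"
proof (rule exp_span_bound_integrable[OF \<rho> _ _ Pr(1) _ _ f])
  have z: "square_integrable \<rho> (\<lambda>_. 0)" "integrable \<rho> (\<lambda>_. 0 :: real)"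
    by (simp_all add: square_integrable_def)
  have zl: "shift_law X \<rho> u (\<lambda>_. 0) (null_measure (point_measure_algebra X))"
    by (auto simp: shift_law_def intro!: finite_measureI)
  fix f :: "'a measure \<Rightarrow> real" assume "f \<in> exp_span X \<rho>"
  from exp_span_combination_bound[OF \<rho>(1) this Pr(2) u u Q Q z zl z zl refl, of 1 0 0]
  show "(\<integral>\<phi>. f \<phi> \<partial>Q)\<^sup>2 \<le> exp_norm \<rho> 1 u 0 u 0 (\<lambda>x. 0 + -1 * 0) * (\<integral>\<phi>. (f \<phi>)\<^sup>2 \<partial>Pr)"
    by simp
qed (use Q Pr(2) in \<open>auto simp: exp_law_def\<close>)

lemma shift_law_integrable:
  fixes f :: "'a measure \<Rightarrow> real"
  assumes \<rho>: "sets \<rho> = sets X" "sigma_finite_measure \<rho>"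
    and Pr: "prob_space Pr" "exp_law X \<rho> (\<lambda>_. 0) Pr"
    and u: "square_integrable \<rho> u" and Q: "exp_law X \<rho> u Q"
    and g: "square_integrable \<rho> g" "integrable \<rho> g" and S: "shift_law X \<rho> u g S"
    and f: "f \<in> borel_measurable (point_measure_algebra X)" "integrable Pr (\<lambda>\<phi>. (f \<phi>)\<^sup>2)"
  shows "integrable S f"
proof (rule exp_span_bound_integrable[OF \<rho> _ _ Pr(1) _ _ f])
  have z: "square_integrable \<rho> (\<lambda>_. 0)" "integrable \<rho> (\<lambda>_. 0 :: real)"
    by (simp_all add: square_integrable_def)
  have zl: "shift_law X \<rho> u (\<lambda>_. 0) (null_measure (point_measure_algebra X))"
    by (auto simp: shift_law_def intro!: finite_measureI)
  fix f :: "'a measure \<Rightarrow> real" assume "f \<in> exp_span X \<rho>"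
  from exp_span_combination_bound[OF \<rho>(1) this Pr(2) u u Q Q g S z zl refl, of 0 "\<integral>x. g x \<partial>\<rho>" 1]
  show "(\<integral>\<phi>. f \<phi> \<partial>S)\<^sup>2 \<le> exp_norm \<rho> 0 u (\<integral>x. g x \<partial>\<rho>) u 1 (\<lambda>x. g x + -1 * 0) * (\<integral>\<phi>. (f \<phi>)\<^sup>2 \<partial>Pr)"
    by simp
qed (use S Pr(2) in \<open>auto simp: exp_law_def shift_law_def\<close>)

section \<open>The derivative\<close>

lemma square_integrable_truncation:
  assumes \<rho>: "sigma_finite_measure \<rho>" and g: "g \<in> borel_measurable \<rho>"
  obtains t :: "nat \<Rightarrow> 'a \<Rightarrow> real" where
    "\<And>n. square_integrable \<rho> (t n)" "\<And>n. integrable \<rho> (t n)"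
    "\<And>n x. \<bar>t n x\<bar> \<le> \<bar>g x\<bar>" "\<And>n x. t n x * g x = (t n x)\<^sup>2"
    "\<And>x. x \<in> space \<rho> \<Longrightarrow> (\<lambda>n. t n x) \<longlonglongrightarrow> g x"
    "\<And>x. incseq (\<lambda>n. (t n x)\<^sup>2)"
proof -
  obtain F :: "nat \<Rightarrow> 'a set" where F: "range F \<subseteq> sets \<rho>" "(\<Union>i. F i) = space \<rho>"
    "\<And>i. emeasure \<rho> (F i) \<noteq> \<infinity>" "incseq F"
    using sigma_finite_measure.sigma_finite_incseq[OF \<rho>] by metis
  define A where "A n = {x\<in>F n. \<bar>g x\<bar> \<le> real n}" for n
  define t where "t n x = g x * indicator (A n) x" for n x
  have Fn: "F n \<in> sets \<rho>" for n using F(1) by auto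
  have A: "A n \<in> sets \<rho>" for n
  proof -
    have "A n = F n \<inter> {x\<in>space \<rho>. \<bar>g x\<bar> \<le> real n}"
      using sets.sets_into_space[OF Fn[of n]] by (auto simp: A_def)
    also have "\<dots> \<in> sets \<rho>" using g Fn by measurable
    finally show ?thesis .
  qed
  have tm: "t n \<in> borel_measurable \<rho>" for n
    unfolding t_def[abs_def] using A g by measurable
  have bnd: "integrable \<rho> (\<lambda>x. real n * indicator (F n) x :: real)" for n :: nat
    using F(3)[of n] Fn[of n] by (auto simp: top.not_eq_extremum)
  show thesis
  proof
    have "\<bar>t n x\<bar> \<le> real n * indicator (F n) x" for n x
      by (auto simp: t_def A_def indicator_def)
    then show "integrable \<rho> (t n)" for n
      by (intro Bochner_Integration.integrable_bound[OF bnd[of n] tm] AE_I2) (simp add: abs_of_nonneg)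
    have "(t n x)\<^sup>2 \<le> real n * (real n * indicator (F n) x)" for n x
      by (auto simp: t_def A_def indicator_def power2_eq_square abs_le_iff[symmetric]
          intro!: abs_le_square_iff[THEN iffD1, of "g x" "real n", unfolded power2_eq_square])
    then show "square_integrable \<rho> (t n)" for n
      unfolding square_integrable_def using tm
      by (intro conjI Bochner_Integration.integrable_bound[OF integrable_mult_right[OF bnd[of n], of "real n"]])
        (auto simp: abs_of_nonneg)
    show "\<bar>t n x\<bar> \<le> \<bar>g x\<bar>" "t n x * g x = (t n x)\<^sup>2" for n x
      by (auto simp: t_def indicator_def power2_eq_square)
    have mono: "A n \<subseteq> A m" if "n \<le> m" for n m
      using incseqD[OF F(4) that] that by (auto simp: A_def)
    show "(\<lambda>n. t n x) \<longlonglongrightarrow> g x" if x: "x \<in> space \<rho>" for x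
    proof (rule tendsto_eventually)
      obtain i where i: "x \<in> F i" using x F(2) by auto
      obtain k where k: "\<bar>g x\<bar> \<le> real k" using real_arch_simple by blast
      have "x \<in> A (max i k)" using i k incseqD[OF F(4), of i "max i k"] by (auto simp: A_def)
      then have "x \<in> A n" if "max i k \<le> n" for n using mono[OF that] by auto
      then have "t n x = g x" if "max i k \<le> n" for n using that by (simp add: t_def)
      then show "\<forall>\<^sub>F n in sequentially. t n x = g x"
        unfolding eventually_sequentially by (intro exI[of _ "max i k"]) auto
    qed
    show "incseq (\<lambda>n. (t n x)\<^sup>2)" for x
      using mono by (auto simp: incseq_def t_def indicator_def)
  qed
qed

lemma inner_on_tendsto:
  assumes v: "square_integrable \<rho> v" and g: "square_integrable \<rho> g"
    and t: "\<And>n. t n \<in> borel_measurable \<rho>" "\<And>n x. \<bar>t n x\<bar> \<le> \<bar>g x\<bar>"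
      "\<And>x. x \<in> space \<rho> \<Longrightarrow> (\<lambda>n. t n x) \<longlonglongrightarrow> g x"
  shows "(\<lambda>n. inner_on \<rho> v (t n)) \<longlonglongrightarrow> inner_on \<rho> v g"
    and "(\<lambda>n. inner_on \<rho> (t n) (t n)) \<longlonglongrightarrow> inner_on \<rho> g g"
proof -
  have m: "v \<in> borel_measurable \<rho>" "g \<in> borel_measurable \<rho>"
    using v g by (auto simp: square_integrable_def)
  show "(\<lambda>n. inner_on \<rho> v (t n)) \<longlonglongrightarrow> inner_on \<rho> v g"
    unfolding inner_on_def
  proof (rule integral_dominated_convergence[where w = "\<lambda>x. \<bar>v x * g x\<bar>"])
    show "integrable \<rho> (\<lambda>x. \<bar>v x * g x\<bar>)" using square_integrable_mult[OF v g] by simp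
    show "AE x in \<rho>. norm (v x * t n x) \<le> \<bar>v x * g x\<bar>" for n
      using t(2) by (auto simp: abs_mult intro!: mult_left_mono)
  qed (use m t in \<open>auto intro!: tendsto_mult\<close>)
  show "(\<lambda>n. inner_on \<rho> (t n) (t n)) \<longlonglongrightarrow> inner_on \<rho> g g"
    unfolding inner_on_def
  proof (rule integral_dominated_convergence[where w = "\<lambda>x. \<bar>g x * g x\<bar>"])
    show "integrable \<rho> (\<lambda>x. \<bar>g x * g x\<bar>)" using square_integrable_mult[OF g g] by simp
    show "AE x in \<rho>. norm (t n x * t n x) \<le> \<bar>g x * g x\<bar>" for n
      unfolding real_norm_def abs_mult using t(2) by (intro AE_I2 mult_mono) auto
  qed (use m t in \<open>auto intro!: tendsto_mult\<close>)
qed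

locale poisson_perturbation =
  fixes X \<rho> :: "'a measure" and Pr Q\<^sub>0 :: "'a measure measure" and u\<^sub>0 :: "'a \<Rightarrow> real"
    and f :: "'a measure \<Rightarrow> real"
  assumes sets_\<rho>: "sets \<rho> = sets X" and sigma_finite_\<rho>: "sigma_finite_measure \<rho>"
    and prob_Pr: "prob_space Pr" and law_Pr: "exp_law X \<rho> (\<lambda>_. 0) Pr"
    and prob_Q\<^sub>0: "prob_space Q\<^sub>0" and law_Q\<^sub>0: "exp_law X \<rho> u\<^sub>0 Q\<^sub>0"
    and u\<^sub>0: "square_integrable \<rho> u\<^sub>0"
    and f_measurable: "f \<in> borel_measurable (point_measure_algebra X)"
    and f_square: "integrable Pr (\<lambda>\<phi>. (f \<phi>)\<^sup>2)"
begin

definition mean_diff :: "'a \<Rightarrow> real" where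
  "mean_diff x = (\<integral>\<phi>. diff_op X x f \<phi> \<partial>Q\<^sub>0)"

lemma sets_Q\<^sub>0: "sets Q\<^sub>0 = sets (point_measure_algebra X)"
  using law_Q\<^sub>0 by (simp add: exp_law_def)

lemma finite_Q\<^sub>0: "finite_measure Q\<^sub>0"
  using law_Q\<^sub>0 by (simp add: exp_law_def)

lemma integrable_Q:
  assumes "square_integrable \<rho> u" "exp_law X \<rho> u Q"
  shows "integrable Q f"
  by (rule exp_law_integrable[OF sets_\<rho> sigma_finite_\<rho> prob_Pr law_Pr assms f_measurable f_square])

lemma mean_diff_measurable: "mean_diff \<in> borel_measurable \<rho>"
proof -
  interpret Q: prob_space Q\<^sub>0 by (rule prob_Q\<^sub>0)
  have "(\<lambda>p. f (case p of (x, \<phi>) \<Rightarrow> add_measure \<phi> (return X x))) \<in> borel_measurable (\<rho> \<Otimes>\<^sub>M Q\<^sub>0)"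
    by (rule measurable_compose[OF measurable_add_return[OF sets_\<rho> sets_Q\<^sub>0] f_measurable])
  moreover have "(\<lambda>p. f (snd p)) \<in> borel_measurable (\<rho> \<Otimes>\<^sub>M Q\<^sub>0)"
  proof (rule measurable_compose[OF measurable_snd])
    show "f \<in> borel_measurable Q\<^sub>0"
      using f_measurable by (simp only: measurable_cong_sets[OF sets_Q\<^sub>0 refl])
  qed
  ultimately have "(\<lambda>p. f (case p of (x, \<phi>) \<Rightarrow> add_measure \<phi> (return X x)) - f (snd p))
      \<in> borel_measurable (\<rho> \<Otimes>\<^sub>M Q\<^sub>0)" by (rule borel_measurable_diff)
  also have "(\<lambda>p. f (case p of (x, \<phi>) \<Rightarrow> add_measure \<phi> (return X x)) - f (snd p))
      = (\<lambda>(x, \<phi>). diff_op X x f \<phi>)" by (auto simp: diff_op_def)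
  finally show ?thesis
    unfolding mean_diff_def[abs_def] by (rule Q.borel_measurable_lebesgue_integral)
qed

lemma shift_integrable:
  assumes "square_integrable \<rho> g" "integrable \<rho> g" "\<And>x. 0 \<le> g x"
  shows "integrable (shift_measure X \<rho> Q\<^sub>0 g) f"
  by (rule shift_law_integrable[OF sets_\<rho> sigma_finite_\<rho> prob_Pr law_Pr u\<^sub>0 law_Q\<^sub>0 assms(1,2)
      shift_law_shift_measure[OF sets_\<rho> finite_Q\<^sub>0 sets_Q\<^sub>0 assms(2,3) law_Q\<^sub>0] f_measurable f_square])

lemma mean_diff_nonneg_weight:
  assumes g: "square_integrable \<rho> g" "integrable \<rho> g" "\<And>x. 0 \<le> g x"
  shows "integrable \<rho> (\<lambda>x. mean_diff x * g x)"
    and "(\<integral>x. mean_diff x * g x \<partial>\<rho>) =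
      (\<integral>\<phi>. f \<phi> \<partial>shift_measure X \<rho> Q\<^sub>0 g) - (\<integral>x. g x \<partial>\<rho>) * (\<integral>\<phi>. f \<phi> \<partial>Q\<^sub>0)"
proof -
  note S = integrable_shift_measure[OF sets_\<rho> finite_Q\<^sub>0 sets_Q\<^sub>0 g(2,3) f_measurable shift_integrable[OF g]]
  let ?s = "\<lambda>x. \<integral>\<phi>. f (add_measure \<phi> (return X x)) \<partial>Q\<^sub>0"
  have int: "integrable \<rho> (\<lambda>x. g x * ?s x - g x * (\<integral>\<phi>. f \<phi> \<partial>Q\<^sub>0))"
    using S(2) g(2) by auto
  have eq: "AE x in \<rho>. g x * ?s x - g x * (\<integral>\<phi>. f \<phi> \<partial>Q\<^sub>0) = mean_diff x * g x"
    using S(1)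
  proof eventually_elim
    case (elim x)
    show ?case
    proof (cases "g x = 0")
      case False
      then have "integrable Q\<^sub>0 (\<lambda>\<phi>. f (add_measure \<phi> (return X x)))"
        using elim g(3)[of x] by auto
      then have "mean_diff x = ?s x - (\<integral>\<phi>. f \<phi> \<partial>Q\<^sub>0)"
        using integrable_Q[OF u\<^sub>0 law_Q\<^sub>0] by (simp add: mean_diff_def diff_op_def)
      then show ?thesis by (simp add: right_diff_distrib mult.commute)
    qed simp
  qed
  have m: "(\<lambda>x. mean_diff x * g x) \<in> borel_measurable \<rho>"
    using mean_diff_measurable g(1) by (auto simp: square_integrable_def)
  show "integrable \<rho> (\<lambda>x. mean_diff x * g x)"
    by (rule integrable_cong_AE_imp[OF int m]) (use eq in auto)
  have "(\<integral>x. mean_diff x * g x \<partial>\<rho>) = (\<integral>x. g x * ?s x - g x * (\<integral>\<phi>. f \<phi> \<partial>Q\<^sub>0) \<partial>\<rho>)"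
    by (rule integral_cong_AE[OF m borel_measurable_integrable[OF int]]) (use eq in auto)
  also have "\<dots> = (\<integral>\<phi>. f \<phi> \<partial>shift_measure X \<rho> Q\<^sub>0 g) - (\<integral>x. g x \<partial>\<rho>) * (\<integral>\<phi>. f \<phi> \<partial>Q\<^sub>0)"
    using S(2,3) g(2) by simp
  finally show "(\<integral>x. mean_diff x * g x \<partial>\<rho>) =
      (\<integral>\<phi>. f \<phi> \<partial>shift_measure X \<rho> Q\<^sub>0 g) - (\<integral>x. g x \<partial>\<rho>) * (\<integral>\<phi>. f \<phi> \<partial>Q\<^sub>0)" .
qed

lemma AE_diff_op_integrable: "AE x in \<rho>. integrable Q\<^sub>0 (diff_op X x f)"
proof -
  obtain g :: "'a \<Rightarrow> real" where g: "g \<in> borel_measurable \<rho>" "\<And>x. 0 < g x" "\<And>x. g x \<le> 1" "integrable \<rho> g"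
    using sigma_finite_measure.obtain_positive_integrable_function[OF sigma_finite_\<rho>] by metis
  have "square_integrable \<rho> g"
    unfolding square_integrable_def
  proof (intro conjI g(1) Bochner_Integration.integrable_bound[OF g(4)] AE_I2)
    show "norm ((g x)\<^sup>2) \<le> norm (g x)" for x
      using g(2,3)[of x] by (simp add: power2_eq_square mult_left_le less_imp_le)
  qed (use g in auto)
  then have "integrable (shift_measure X \<rho> Q\<^sub>0 g) f"
    using g by (intro shift_integrable) (auto intro: less_imp_le)
  from integrable_shift_measure(1)[OF sets_\<rho> finite_Q\<^sub>0 sets_Q\<^sub>0 g(4) less_imp_le[OF g(2)] f_measurable this]
  show ?thesis
  proof eventually_elim
    case (elim x)
    then have "integrable Q\<^sub>0 (\<lambda>\<phi>. f (add_measure \<phi> (return X x)) - f \<phi>)"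
      using g(2) integrable_Q[OF u\<^sub>0 law_Q\<^sub>0] by auto
    then show ?case by (simp add: diff_op_def[abs_def])
  qed
qed

lemma combination_bound_integrable_weight:
  assumes u: "square_integrable \<rho> u" and Q: "exp_law X \<rho> u Q"
    and g: "square_integrable \<rho> g" "integrable \<rho> g"
  shows "(\<alpha>\<^sub>1 * (\<integral>\<phi>. f \<phi> \<partial>Q) + \<alpha>\<^sub>0 * (\<integral>\<phi>. f \<phi> \<partial>Q\<^sub>0) + \<beta> * (\<integral>x. mean_diff x * g x \<partial>\<rho>))\<^sup>2
    \<le> exp_norm \<rho> \<alpha>\<^sub>1 u \<alpha>\<^sub>0 u\<^sub>0 \<beta> g * (\<integral>\<phi>. (f \<phi>)\<^sup>2 \<partial>Pr)"
proof -
  define p m where "p x = max (g x) 0" and "m x = max (- g x) 0" for x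
  have pm: "p \<in> borel_measurable \<rho>" "m \<in> borel_measurable \<rho>"
    using g(1) unfolding p_def[abs_def] m_def[abs_def] by (auto simp: square_integrable_def)
  have bd: "\<bar>p x\<bar> \<le> \<bar>g x\<bar>" "\<bar>m x\<bar> \<le> \<bar>g x\<bar>" "0 \<le> p x" "0 \<le> m x" for x
    by (auto simp: p_def m_def)
  have p: "square_integrable \<rho> p" "integrable \<rho> p" and m: "square_integrable \<rho> m" "integrable \<rho> m"
    using bd pm by (auto intro: square_integrable_bound[OF g(1)] Bochner_Integration.integrable_bound[OF g(2)])
  have gpm: "g = (\<lambda>x. p x + - 1 * m x)" by (auto simp: p_def m_def max_def)
  let ?S = "shift_measure X \<rho> Q\<^sub>0"
  note Sp = shift_law_shift_measure[OF sets_\<rho> finite_Q\<^sub>0 sets_Q\<^sub>0 p(2) bd(3) law_Q\<^sub>0]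
    and Sm = shift_law_shift_measure[OF sets_\<rho> finite_Q\<^sub>0 sets_Q\<^sub>0 m(2) bd(4) law_Q\<^sub>0]
  define M where "M i = (if i = 0 then Q else if i = 1 then Q\<^sub>0 else if i = 2 then ?S p else ?S m)" for i :: nat
  define q where "q i = (if i = 0 then \<alpha>\<^sub>1 else if i = 1 then \<alpha>\<^sub>0 - \<beta> * (\<integral>x. g x \<partial>\<rho>) else if i = 2 then \<beta> else - \<beta>)" for i :: nat
  have sum: "(\<Sum>i<4. q i * (\<integral>\<phi>. e \<phi> \<partial>M i)) = \<alpha>\<^sub>1 * (\<integral>\<phi>. e \<phi> \<partial>Q) + (\<alpha>\<^sub>0 - \<beta> * (\<integral>x. g x \<partial>\<rho>)) * (\<integral>\<phi>. e \<phi> \<partial>Q\<^sub>0)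
      + \<beta> * (\<integral>\<phi>. e \<phi> \<partial>?S p) - \<beta> * (\<integral>\<phi>. e \<phi> \<partial>?S m)" for e :: "'a measure \<Rightarrow> real"
    by (simp add: eval_nat_numeral M_def q_def)
  have bound: "(\<Sum>i<4. q i * (\<integral>\<phi>. f \<phi> \<partial>M i))\<^sup>2 \<le> exp_norm \<rho> \<alpha>\<^sub>1 u \<alpha>\<^sub>0 u\<^sub>0 \<beta> g * (\<integral>\<phi>. (f \<phi>)\<^sup>2 \<partial>Pr)"
  proof (rule exp_span_bound_extend[OF sets_\<rho> sigma_finite_\<rho> _ _ _ _ _ f_measurable f_square])
    show "finite_measure (M i)" "sets (M i) = sets (point_measure_algebra X)" for i
      using Q law_Q\<^sub>0 Sp Sm by (auto simp: M_def exp_law_def shift_law_def)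
    show "finite_measure Pr" "sets Pr = sets (point_measure_algebra X)"
      using law_Pr by (auto simp: exp_law_def)
    show "(\<Sum>i<4. q i * (\<integral>\<phi>. e \<phi> \<partial>M i))\<^sup>2 \<le> exp_norm \<rho> \<alpha>\<^sub>1 u \<alpha>\<^sub>0 u\<^sub>0 \<beta> g * (\<integral>\<phi>. (e \<phi>)\<^sup>2 \<partial>Pr)"
      if "e \<in> exp_span X \<rho>" for e
      unfolding sum
      by (rule exp_span_combination_bound[OF sets_\<rho> that law_Pr u u\<^sub>0 Q law_Q\<^sub>0 p Sp m Sm gpm])
    show "integrable (M i) f" for i
      using integrable_Q[OF u Q] integrable_Q[OF u\<^sub>0 law_Q\<^sub>0] shift_integrable[OF p bd(3)]
        shift_integrable[OF m bd(4)] by (simp add: M_def)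
  qed
  have "(\<integral>x. mean_diff x * g x \<partial>\<rho>)
      = (\<integral>x. mean_diff x * p x \<partial>\<rho>) - (\<integral>x. mean_diff x * m x \<partial>\<rho>)"
    unfolding gpm using mean_diff_nonneg_weight(1)[OF p bd(3)] mean_diff_nonneg_weight(1)[OF m bd(4)]
    by (simp add: algebra_simps)
  moreover have "(\<integral>x. g x \<partial>\<rho>) = (\<integral>x. p x \<partial>\<rho>) - (\<integral>x. m x \<partial>\<rho>)"
    unfolding gpm using p(2) m(2) by simp
  ultimately have "(\<Sum>i<4. q i * (\<integral>\<phi>. f \<phi> \<partial>M i))
      = \<alpha>\<^sub>1 * (\<integral>\<phi>. f \<phi> \<partial>Q) + \<alpha>\<^sub>0 * (\<integral>\<phi>. f \<phi> \<partial>Q\<^sub>0) + \<beta> * (\<integral>x. mean_diff x * g x \<partial>\<rho>)"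
    unfolding sum mean_diff_nonneg_weight(2)[OF p bd(3)] mean_diff_nonneg_weight(2)[OF m bd(4)]
    by (simp only:) (simp add: algebra_simps)
  with bound show ?thesis by (simp only:)
qed

text \<open>Duality: the bound is tested against truncations of \<open>mean_diff\<close> itself.\<close>
lemma mean_diff_square_integrable: "square_integrable \<rho> mean_diff"
proof (rule square_integrable_truncation[OF sigma_finite_\<rho> mean_diff_measurable], goal_cases)
  case (1 t)
  note t = 1
  define D where "D = exp (inner_on \<rho> u\<^sub>0 u\<^sub>0) * (inner_on \<rho> u\<^sub>0 u\<^sub>0 + 1) * (\<integral>\<phi>. (f \<phi>)\<^sup>2 \<partial>Pr)"
  have "(\<integral>x. (t n x)\<^sup>2 \<partial>\<rho>) \<le> D" for n
  proof -
    define N where "N = (\<integral>x. (t n x)\<^sup>2 \<partial>\<rho>)"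
    have N: "N = inner_on \<rho> (t n) (t n)" by (simp add: N_def inner_on_def power2_eq_square)
    have "(\<integral>x. mean_diff x * t n x \<partial>\<rho>) = N"
      unfolding N_def t(4)[symmetric] by (simp add: mult.commute)
    then have "N\<^sup>2 \<le> exp_norm \<rho> 0 u\<^sub>0 0 u\<^sub>0 1 (t n) * (\<integral>\<phi>. (f \<phi>)\<^sup>2 \<partial>Pr)"
      using combination_bound_integrable_weight[OF u\<^sub>0 law_Q\<^sub>0 t(1,2), of 0 0 1 n] by simp
    also have "exp_norm \<rho> 0 u\<^sub>0 0 u\<^sub>0 1 (t n) = exp (inner_on \<rho> u\<^sub>0 u\<^sub>0) * ((inner_on \<rho> u\<^sub>0 (t n))\<^sup>2 + N)"
      by (simp add: exp_norm_def N)
    also have "\<dots> * (\<integral>\<phi>. (f \<phi>)\<^sup>2 \<partial>Pr) \<le> exp (inner_on \<rho> u\<^sub>0 u\<^sub>0) * (inner_on \<rho> u\<^sub>0 u\<^sub>0 * N + N) * (\<integral>\<phi>. (f \<phi>)\<^sup>2 \<partial>Pr)"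
      using inner_on_Cauchy_Schwarz[OF u\<^sub>0 t(1), of n]
      by (intro mult_right_mono mult_left_mono add_right_mono) (auto simp: N)
    also have "\<dots> = N * D" by (simp add: D_def algebra_simps)
    finally have *: "N * N \<le> N * D" by (simp add: power2_eq_square)
    have "0 \<le> N" by (simp add: N_def)
    moreover have "0 \<le> D" by (simp add: D_def inner_on_self_nonneg)
    ultimately show ?thesis using * unfolding N_def[symmetric] by (cases "N = 0") auto
  qed
  have lim: "(\<lambda>n. \<integral>\<^sup>+x. ennreal ((t n x)\<^sup>2) \<partial>\<rho>) \<longlonglongrightarrow> (\<integral>\<^sup>+x. ennreal ((mean_diff x)\<^sup>2) \<partial>\<rho>)"
  proof -
    have "(\<lambda>n. \<integral>\<^sup>+x. ennreal ((t n x)\<^sup>2) * indicator (space \<rho>) x \<partial>\<rho>)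
        \<longlonglongrightarrow> (\<integral>\<^sup>+x. ennreal ((mean_diff x)\<^sup>2) * indicator (space \<rho>) x \<partial>\<rho>)"
    proof (rule nn_integral_LIMSEQ)
      show "incseq (\<lambda>n x. ennreal ((t n x)\<^sup>2) * indicator (space \<rho>) x)"
        using incseqD[OF t(6)] by (auto simp: incseq_def le_fun_def intro!: mult_right_mono ennreal_leI)
      show "(\<lambda>x. ennreal ((t n x)\<^sup>2) * indicator (space \<rho>) x) \<in> borel_measurable \<rho>" for n
        using t(1)[of n] by (auto simp: square_integrable_def)
      show "(\<lambda>n. ennreal ((t n x)\<^sup>2) * indicator (space \<rho>) x) \<longlonglongrightarrow> ennreal ((mean_diff x)\<^sup>2) * indicator (space \<rho>) x" for x
        using t(5)[of x] by (cases "x \<in> space \<rho>") (auto intro!: tendsto_intros)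
    qed
    moreover have "(\<integral>\<^sup>+x. ennreal (c x) * indicator (space \<rho>) x \<partial>\<rho>) = (\<integral>\<^sup>+x. ennreal (c x) \<partial>\<rho>)" for c
      by (intro nn_integral_cong) simp
    ultimately show ?thesis by simp
  qed
  have "(\<integral>\<^sup>+x. ennreal ((mean_diff x)\<^sup>2) \<partial>\<rho>) \<le> ennreal D"
  proof (rule LIMSEQ_le_const2[OF lim], intro exI allI impI)
    fix n
    have "(\<integral>\<^sup>+x. ennreal ((t n x)\<^sup>2) \<partial>\<rho>) = ennreal (\<integral>x. (t n x)\<^sup>2 \<partial>\<rho>)"
      using t(1)[of n] by (intro nn_integral_eq_integral) (auto simp: square_integrable_def)
    also have "\<dots> \<le> ennreal D" by (rule ennreal_leI) fact
    finally show "(\<integral>\<^sup>+x. ennreal ((t n x)\<^sup>2) \<partial>\<rho>) \<le> ennreal D" .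
  qed
  then show ?case
    using mean_diff_measurable
    by (auto simp: square_integrable_def integrable_iff_bounded intro: le_less_trans)
qed

lemma combination_bound:
  assumes u: "square_integrable \<rho> u" and Q: "exp_law X \<rho> u Q" and g: "square_integrable \<rho> g"
  shows "(\<alpha>\<^sub>1 * (\<integral>\<phi>. f \<phi> \<partial>Q) + \<alpha>\<^sub>0 * (\<integral>\<phi>. f \<phi> \<partial>Q\<^sub>0) + \<beta> * (\<integral>x. mean_diff x * g x \<partial>\<rho>))\<^sup>2
    \<le> exp_norm \<rho> \<alpha>\<^sub>1 u \<alpha>\<^sub>0 u\<^sub>0 \<beta> g * (\<integral>\<phi>. (f \<phi>)\<^sup>2 \<partial>Pr)"
proof -
  have gm: "g \<in> borel_measurable \<rho>" using g by (simp add: square_integrable_def)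
  show ?thesis
  proof (rule square_integrable_truncation[OF sigma_finite_\<rho> gm], goal_cases)
    case (1 t)
    note t = 1
    have tm: "t n \<in> borel_measurable \<rho>" for n using t(1) by (simp add: square_integrable_def)
    note lim = inner_on_tendsto[OF _ g tm t(3,5)]
    show ?case
    proof (rule LIMSEQ_le)
      show "(\<lambda>n. (\<alpha>\<^sub>1 * (\<integral>\<phi>. f \<phi> \<partial>Q) + \<alpha>\<^sub>0 * (\<integral>\<phi>. f \<phi> \<partial>Q\<^sub>0) + \<beta> * (\<integral>x. mean_diff x * t n x \<partial>\<rho>))\<^sup>2)
          \<longlonglongrightarrow> (\<alpha>\<^sub>1 * (\<integral>\<phi>. f \<phi> \<partial>Q) + \<alpha>\<^sub>0 * (\<integral>\<phi>. f \<phi> \<partial>Q\<^sub>0) + \<beta> * (\<integral>x. mean_diff x * g x \<partial>\<rho>))\<^sup>2"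
        by (intro tendsto_intros lim(1)[OF mean_diff_square_integrable, unfolded inner_on_def])
      show "(\<lambda>n. exp_norm \<rho> \<alpha>\<^sub>1 u \<alpha>\<^sub>0 u\<^sub>0 \<beta> (t n) * (\<integral>\<phi>. (f \<phi>)\<^sup>2 \<partial>Pr))
          \<longlonglongrightarrow> exp_norm \<rho> \<alpha>\<^sub>1 u \<alpha>\<^sub>0 u\<^sub>0 \<beta> g * (\<integral>\<phi>. (f \<phi>)\<^sup>2 \<partial>Pr)"
        unfolding exp_norm_def by (intro tendsto_intros lim(1)[OF u] lim(1)[OF u\<^sub>0] lim(2)[OF u\<^sub>0])
      show "\<exists>N. \<forall>n\<ge>N. (\<alpha>\<^sub>1 * (\<integral>\<phi>. f \<phi> \<partial>Q) + \<alpha>\<^sub>0 * (\<integral>\<phi>. f \<phi> \<partial>Q\<^sub>0) + \<beta> * (\<integral>x. mean_diff x * t n x \<partial>\<rho>))\<^sup>2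
          \<le> exp_norm \<rho> \<alpha>\<^sub>1 u \<alpha>\<^sub>0 u\<^sub>0 \<beta> (t n) * (\<integral>\<phi>. (f \<phi>)\<^sup>2 \<partial>Pr)"
        using combination_bound_integrable_weight[OF u Q t(1,2)] by blast
    qed
  qed
qed

end

lemma exp_norm_difference_quotient:
  assumes u: "square_integrable \<rho> u" and g: "square_integrable \<rho> g" and h: "square_integrable \<rho> h"
    and t: "t \<noteq> 0"
  defines "B \<equiv> inner_on \<rho> u g" and "C \<equiv> inner_on \<rho> g g" and "D \<equiv> inner_on \<rho> g h"
  shows "exp_norm \<rho> (1 / t) (\<lambda>x. u x + t * g x) (- (1 / t)) u (- 1) h =
    exp (inner_on \<rho> u u) * ((exp (2 * t * B + t\<^sup>2 * C) - 2 * exp (t * B) + 1) / t\<^sup>2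
      - 2 * (exp (t * B) * D + inner_on \<rho> u h * ((exp (t * B) - 1) / t))
      + ((inner_on \<rho> u h)\<^sup>2 + inner_on \<rho> h h))"
proof -
  define r E G where "r = 1 / t" and "E = exp (t * B)" and "G = exp (2 * t * B + t\<^sup>2 * C)"
  let ?u = "\<lambda>x. u x + t * g x"
  have us: "square_integrable \<rho> ?u" by (intro square_integrable_add square_integrable_cmult u g)
  have gu: "inner_on \<rho> g u = B" unfolding B_def by (rule inner_on_commute)
  have i1: "inner_on \<rho> ?u u = inner_on \<rho> u u + t * B"
    using u g by (simp add: inner_on_add_left gu)
  have i2: "inner_on \<rho> ?u h = inner_on \<rho> u h + t * D"
    using u g h by (simp add: inner_on_add_left D_def)
  have i3: "inner_on \<rho> ?u g = B + t * C"
    using u g by (simp add: inner_on_add_left B_def C_def)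
  have i4: "inner_on \<rho> ?u ?u = inner_on \<rho> u u + (2 * t * B + t\<^sup>2 * C)"
    using inner_on_add_right[OF us u g, of t] by (simp add: i1 i3 power2_eq_square algebra_simps)
  have rt: "r * t = 1" using t by (simp add: r_def)
  have "exp_norm \<rho> r ?u (- r) u (- 1) h = exp (inner_on \<rho> u u) *
      (r\<^sup>2 * G - 2 * r\<^sup>2 * E + r\<^sup>2 - 2 * r * (E * inner_on \<rho> u h) - 2 * (r * t) * (E * D)
        + 2 * r * inner_on \<rho> u h + ((inner_on \<rho> u h)\<^sup>2 + inner_on \<rho> h h))"
    unfolding exp_norm_def i4 exp_add i1 i2 E_def[symmetric] G_def[symmetric]
    unfolding G_def exp_add by (simp add: power2_eq_square algebra_simps)
  also have "\<dots> = exp (inner_on \<rho> u u) * ((G - 2 * E + 1) * r\<^sup>2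
      - 2 * (E * D + inner_on \<rho> u h * ((E - 1) * r)) + ((inner_on \<rho> u h)\<^sup>2 + inner_on \<rho> h h))"
    unfolding rt by (simp add: algebra_simps)
  finally show ?thesis
    by (simp add: r_def E_def[symmetric] G_def[symmetric] power_divide)
qed

lemma exp_norm_difference_quotient_tendsto:
  fixes t B C D :: "'b \<Rightarrow> real"
  assumes t: "(t \<longlongrightarrow> 0) F" "\<forall>\<^sub>F s in F. t s \<noteq> 0"
    and B: "(B \<longlongrightarrow> b) F" and C: "(C \<longlongrightarrow> c) F" and D: "(D \<longlongrightarrow> c) F"
  shows "((\<lambda>s. a * ((exp (2 * t s * B s + (t s)\<^sup>2 * C s) - 2 * exp (t s * B s) + 1) / (t s)\<^sup>2
      - 2 * (exp (t s * B s) * D s + b * ((exp (t s * B s) - 1) / t s)) + (b\<^sup>2 + c))) \<longlongrightarrow> 0) F"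
proof -
  have "((\<lambda>s. a * ((exp (2 * t s * B s + (t s)\<^sup>2 * C s) - 2 * exp (t s * B s) + 1) / (t s)\<^sup>2
      - 2 * (exp (t s * B s) * D s + b * ((exp (t s * B s) - 1) / t s)) + (b\<^sup>2 + c)))
      \<longlongrightarrow> a * ((b\<^sup>2 + c) - 2 * (exp (0 * b) * c + b * b) + (b\<^sup>2 + c))) F"
    by (intro tendsto_add tendsto_diff tendsto_mult tendsto_exp tendsto_const D t(1) B
        exp_second_difference[OF t B C] exp_first_difference[OF t B])
  then show ?thesis by (simp add: power2_eq_square algebra_simps)
qed

lemma tendsto_integral_at_within:
  fixes f :: "real \<Rightarrow> 'a \<Rightarrow> real"
  assumes f: "\<And>y. y \<in> I \<Longrightarrow> f y \<in> borel_measurable M" and l: "l \<in> borel_measurable M"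
    and lim: "AE x in M. ((\<lambda>y. f y x) \<longlongrightarrow> l x) (at a within I)"
    and w: "integrable M w" "\<And>y. y \<in> I \<Longrightarrow> AE x in M. \<bar>f y x\<bar> \<le> w x"
  shows "((\<lambda>y. \<integral>x. f y x \<partial>M) \<longlongrightarrow> (\<integral>x. l x \<partial>M)) (at a within I)"
  unfolding tendsto_at_iff_sequentially comp_def
proof (intro allI impI)
  fix Y :: "nat \<Rightarrow> real" assume Y: "\<forall>i. Y i \<in> I - {a}" "Y \<longlonglongrightarrow> a"
  show "(\<lambda>n. \<integral>x. f (Y n) x \<partial>M) \<longlonglongrightarrow> (\<integral>x. l x \<partial>M)"
  proof (rule integral_dominated_convergence[OF l _ w(1)])
    show "AE x in M. (\<lambda>n. f (Y n) x) \<longlonglongrightarrow> l x"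
      using lim
    proof eventually_elim
      case (elim x)
      then show ?case using Y unfolding tendsto_at_iff_sequentially comp_def by blast
    qed
  qed (use f w(2) Y(1) in auto)
qed

lemma diff_op_measurable:
  assumes "x \<in> space X" and f: "f \<in> borel_measurable (point_measure_algebra X)"
  shows "diff_op X x f \<in> borel_measurable (point_measure_algebra X)"
proof -
  let ?N = "point_measure_algebra X"
  have "(\<lambda>\<phi>. case (x, \<phi>) of (x, \<phi>) \<Rightarrow> add_measure \<phi> (return X x)) \<in> measurable ?N ?N"
    by (rule measurable_compose[OF measurable_Pair1'[OF assms(1)] measurable_add_return[OF refl refl]])
  then have "(\<lambda>\<phi>. add_measure \<phi> (return X x)) \<in> measurable ?N ?N" by simp
  from measurable_compose[OF this f] show ?thesis
    unfolding diff_op_def[abs_def] using f by (rule borel_measurable_diff)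
qed

lemma square_integrableI:
  assumes "u \<in> borel_measurable M" "(\<integral>\<^sup>+x. ennreal ((u x)\<^sup>2) \<partial>M) < \<infinity>"
  shows "square_integrable M u"
  using assms by (auto simp: square_integrable_def integrable_iff_bounded)

theorem theorem6p5:
  fixes X lam \<rho> :: "'a measure"
    and \<Omega> :: "'w measure"
    and \<Phi> :: "'w \<Rightarrow> 'a measure"
    and P :: "'a measure \<Rightarrow> 'w measure"
    and hlam h :: "'a \<Rightarrow> real"
    and \<theta>\<^sub>0 :: real
    and I :: "real set"
    and R\<^sub>\<theta> :: "real \<Rightarrow> 'a \<Rightarrow> real"
    and R :: "'a \<Rightarrow> real"
    and lam\<^sub>\<theta> :: "real \<Rightarrow> 'a measure"
    and f :: "'a measure \<Rightarrow> real"
  assumes setting: "poisson_family \<Omega> X \<Phi> P"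
    and lambda: "sets lam = sets X" "sigma_finite_measure lam"
    and rho: "sets \<rho> = sets X" "sigma_finite_measure \<rho>"
    and ac: "absolutely_continuous \<rho> lam"
    and h_lambda: "hlam \<in> borel_measurable X" "AE x in \<rho>. 0 \<le> hlam x"
      "lam = density \<rho> (\<lambda>x. ennreal (hlam x))"
    and h: "h \<in> borel_measurable X"
    and square_int:
      "(\<integral>\<^sup>+x. ennreal ((1 - hlam x)\<^sup>2) \<partial>\<rho>) + (\<integral>\<^sup>+x. ennreal ((h x)\<^sup>2) \<partial>\<rho>) < \<infinity>"
    and I: "is_interval I" "interior I \<noteq> {}" "\<theta>\<^sub>0 \<in> I"
    and R_meas: "\<And>\<theta>. \<theta> \<in> I \<Longrightarrow> R\<^sub>\<theta> \<theta> \<in> borel_measurable X"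
    and nonneg: "\<And>\<theta>. \<theta> \<in> I \<Longrightarrow> AE x in \<rho>. hlam x + (\<theta> - \<theta>\<^sub>0) * (h x + R\<^sub>\<theta> \<theta> x) \<ge> 0"
    and lim: "AE x in \<rho>. ((\<lambda>\<theta>. R\<^sub>\<theta> \<theta> x) \<longlongrightarrow> 0) (at \<theta>\<^sub>0 within I)"
    and R: "R \<in> borel_measurable X" "\<And>x. x \<in> space X \<Longrightarrow> 0 \<le> R x"
      "\<And>\<theta>. \<theta> \<in> I \<Longrightarrow> AE x in \<rho>. \<bar>R\<^sub>\<theta> \<theta> x\<bar> \<le> R x"
      "(\<integral>\<^sup>+x. ennreal ((R x)\<^sup>2) \<partial>\<rho>) < \<infinity>"
    and lambda_theta: "\<And>\<theta>. \<theta> \<in> I \<Longrightarrow>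
      lam\<^sub>\<theta> \<theta> = density \<rho> (\<lambda>x. ennreal (hlam x + (\<theta> - \<theta>\<^sub>0) * (h x + R\<^sub>\<theta> \<theta> x)))"
    and f: "f \<in> borel_measurable (point_measure_algebra X)"
      "(\<integral>\<^sup>+\<omega>. ennreal ((f (\<Phi> \<omega>))\<^sup>2) \<partial>P \<rho>) < \<infinity>"
  shows
    \<comment> \<open>all expectations and integrals in the formula exist\<close>
    "(\<forall>\<theta>\<in>I. integrable (P (lam\<^sub>\<theta> \<theta>)) (\<lambda>\<omega>. f (\<Phi> \<omega>))) \<and>
     (AE x in density \<rho> (\<lambda>x. ennreal \<bar>h x\<bar>). integrable (P lam) (\<lambda>\<omega>. diff_op X x f (\<Phi> \<omega>))) \<and>
     integrable \<rho> (\<lambda>x. (\<integral>\<omega>. diff_op X x f (\<Phi> \<omega>) \<partial>P lam) * h x) \<and>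
     ((\<lambda>\<theta>. \<integral>\<omega>. f (\<Phi> \<omega>) \<partial>P (lam\<^sub>\<theta> \<theta>)) has_real_derivative
        (\<integral>x. (\<integral>\<omega>. diff_op X x f (\<Phi> \<omega>) \<partial>P lam) * h x \<partial>\<rho>)) (at \<theta>\<^sub>0 within I)"
proof -
  let ?N = "point_measure_algebra X"
  have bm: "borel_measurable X = (borel_measurable \<rho> :: ('a \<Rightarrow> real) set)"
    by (rule measurable_cong_sets[OF rho(1)[symmetric] refl])
  note hm = h[unfolded bm] and hlm = h_lambda(1)[unfolded bm] and Rm = R(1)[unfolded bm]
    and R\<theta>m = R_meas[unfolded bm]
  have sp: "space \<rho> = space X" using rho(1) by (rule sets_eq_imp_space_eq)
  define u\<^sub>0 where "u\<^sub>0 x = hlam x - 1" for x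
  define g where "g \<theta> x = h x + R\<^sub>\<theta> \<theta> x" for \<theta> x
  define k where "k \<theta> x = hlam x + (\<theta> - \<theta>\<^sub>0) * g \<theta> x" for \<theta> x
  have u0: "square_integrable \<rho> u\<^sub>0"
    using square_int hlm unfolding u\<^sub>0_def
    by (intro square_integrableI) (auto simp: power2_commute[of _ 1])
  have hs: "square_integrable \<rho> h"
    using square_int hm by (intro square_integrableI) auto
  have Rs: "square_integrable \<rho> R" using R(4) Rm by (intro square_integrableI)
  have R\<theta>s: "square_integrable \<rho> (R\<^sub>\<theta> \<theta>)" if "\<theta> \<in> I" for \<theta>
    by (rule square_integrable_bound[OF Rs R\<theta>m[OF that]]) (use R(3)[OF that] in \<open>auto elim!: eventually_mono\<close>)
  have gs: "square_integrable \<rho> (g \<theta>)" if "\<theta> \<in> I" for \<theta>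
    unfolding g_def using square_integrable_add[OF hs R\<theta>s[OF that]] by simp
  have k_u: "k \<theta> x - 1 = u\<^sub>0 x + (\<theta> - \<theta>\<^sub>0) * g \<theta> x" for \<theta> x by (simp add: k_def u\<^sub>0_def)
  have ks: "square_integrable \<rho> (\<lambda>x. k \<theta> x - 1)" if "\<theta> \<in> I" for \<theta>
    unfolding k_u by (intro square_integrable_add square_integrable_cmult u0 gs that)
  have km: "k \<theta> \<in> borel_measurable \<rho>" if "\<theta> \<in> I" for \<theta>
    unfolding k_def[abs_def] using hlm gs[OF that] by (auto simp: square_integrable_def)
  have \<Phi>: "\<Phi> \<in> measurable \<Omega> ?N" and Pf: "\<And>\<mu>. sets \<mu> = sets X \<Longrightarrow> sigma_finite_measure \<mu> \<Longrightarrow>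
      sets (P \<mu>) = sets \<Omega> \<and> poisson_process (P \<mu>) X \<mu> \<Phi>"
    using setting by (auto simp: poisson_family_def)
  define Q where "Q c = distr (P (density \<rho> (\<lambda>x. ennreal (c x)))) ?N \<Phi>" for c
  have Q: "exp_law X \<rho> (\<lambda>x. c x - 1) (Q c)" "prob_space (Q c)"
      "\<Phi> \<in> measurable (P (density \<rho> (\<lambda>x. ennreal (c x)))) ?N"
    if c: "c \<in> borel_measurable \<rho>" "AE x in \<rho>. 0 \<le> c x" "square_integrable \<rho> (\<lambda>x. c x - 1)" for c
  proof -
    let ?\<mu> = "density \<rho> (\<lambda>x. ennreal (c x))"
    have "sigma_finite_measure ?\<mu>"
      using c(1) by (subst sigma_finite_measure.sigma_finite_iff_density_finite[OF rho(2)]) auto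
    then have \<mu>: "sets (P ?\<mu>) = sets \<Omega>" "poisson_process (P ?\<mu>) X ?\<mu> \<Phi>"
      using Pf[of ?\<mu>] rho(1) by auto
    then have m: "\<Phi> \<in> measurable (P ?\<mu>) ?N" and "prob_space (P ?\<mu>)" by (auto simp: poisson_process_def)
    then show "\<Phi> \<in> measurable (P ?\<mu>) ?N" "prob_space (Q c)"
      unfolding Q_def by (auto intro: prob_space.prob_space_distr)
    show "exp_law X \<rho> (\<lambda>x. c x - 1) (Q c)"
      unfolding Q_def by (rule poisson_process_exp_law[OF \<mu>(2) rho(1) c])
  qed
  have \<rho>1: "density \<rho> (\<lambda>x. ennreal 1) = \<rho>" by (simp add: density_1)
  have one: "(\<lambda>_. 1) \<in> borel_measurable \<rho>" "AE x in \<rho>. 0 \<le> (1::real)" "square_integrable \<rho> (\<lambda>_. 1 - 1)"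
    by (simp_all add: square_integrable_def)
  note Q1 = Q[OF one]
  have k0: "k \<theta>\<^sub>0 = hlam" by (simp add: k_def[abs_def])
  have kth: "lam\<^sub>\<theta> \<theta> = density \<rho> (\<lambda>x. ennreal (k \<theta> x))" if "\<theta> \<in> I" for \<theta>
    using lambda_theta[OF that] by (simp add: k_def g_def)
  have k_nonneg: "AE x in \<rho>. 0 \<le> k \<theta> x" if "\<theta> \<in> I" for \<theta>
    using nonneg[OF that] by (simp add: k_def g_def)
  note Qk = Q[OF km k_nonneg ks]
  note Q0 = Qk[OF I(3) I(3) I(3), unfolded k0]
  have f_sq: "integrable (Q (\<lambda>_. 1)) (\<lambda>\<phi>. (f \<phi>)\<^sup>2)"
  proof -
    have m: "(\<lambda>\<omega>. f (\<Phi> \<omega>)) \<in> borel_measurable (P \<rho>)"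
      using measurable_compose[OF Q1(3) f(1)] by (simp only: \<rho>1)
    have "integrable (P \<rho>) (\<lambda>\<omega>. (f (\<Phi> \<omega>))\<^sup>2)"
      using square_integrableI[OF m f(2)] by (simp add: square_integrable_def)
    then show ?thesis
      unfolding Q_def \<rho>1 using Q1(3)[unfolded \<rho>1] f(1) by (subst integrable_distr_eq) auto
  qed
  interpret poisson_perturbation X \<rho> "Q (\<lambda>_. 1)" "Q hlam" u\<^sub>0 f
  proof (rule poisson_perturbation.intro)
    show "exp_law X \<rho> (\<lambda>_. 0) (Q (\<lambda>_. 1))" using Q1(1) by simp
    show "exp_law X \<rho> u\<^sub>0 (Q hlam)" using Q0(1) by (simp add: u\<^sub>0_def[abs_def])
  qed (rule rho Q1(2) Q0(2) u0 f(1) f_sq)+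
  have lam: "lam = density \<rho> (\<lambda>x. ennreal (hlam x))" by (fact h_lambda(3))
  note \<Phi>lam = Q0(3)[folded lam]
  have Qlam: "Q hlam = distr (P lam) ?N \<Phi>" by (simp add: Q_def lam)
  have int_f: "integrable (P (lam\<^sub>\<theta> \<theta>)) (\<lambda>\<omega>. f (\<Phi> \<omega>))"
    and exp_f: "(\<integral>\<omega>. f (\<Phi> \<omega>) \<partial>P (lam\<^sub>\<theta> \<theta>)) = (\<integral>\<phi>. f \<phi> \<partial>Q (k \<theta>))" if \<theta>: "\<theta> \<in> I" for \<theta>
  proof -
    note m = Qk(3)[OF \<theta> \<theta> \<theta>]
    show "integrable (P (lam\<^sub>\<theta> \<theta>)) (\<lambda>\<omega>. f (\<Phi> \<omega>))"
      using integrable_Q[OF ks[OF \<theta>] Qk(1)[OF \<theta> \<theta> \<theta>]] unfolding kth[OF \<theta>] Q_def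
      by (simp add: integrable_distr_eq[OF m f(1)])
    show "(\<integral>\<omega>. f (\<Phi> \<omega>) \<partial>P (lam\<^sub>\<theta> \<theta>)) = (\<integral>\<phi>. f \<phi> \<partial>Q (k \<theta>))"
      unfolding kth[OF \<theta>] Q_def by (rule integral_distr[OF m f(1), symmetric])
  qed
  have diff_mean: "(\<integral>\<omega>. diff_op X x f (\<Phi> \<omega>) \<partial>P lam) = mean_diff x" if "x \<in> space \<rho>" for x
    unfolding mean_diff_def unfolding Qlam
    by (rule integral_distr[OF \<Phi>lam diff_op_measurable[OF _ f(1)], symmetric]) (use that sp in simp)
  have "AE x in \<rho>. integrable (P lam) (\<lambda>\<omega>. diff_op X x f (\<Phi> \<omega>))"
    using AE_diff_op_integrable AE_space
  proof eventually_elim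
    case (elim x)
    then have "diff_op X x f \<in> borel_measurable ?N" using sp by (intro diff_op_measurable f(1)) simp
    from integrable_distr_eq[OF \<Phi>lam this] elim(1) show ?case unfolding Qlam by simp
  qed
  then have AE_int: "AE x in density \<rho> (\<lambda>x. ennreal \<bar>h x\<bar>). integrable (P lam) (\<lambda>\<omega>. diff_op X x f (\<Phi> \<omega>))"
    using hm by (subst AE_density) (auto elim!: eventually_mono)
  have int_mean: "integrable \<rho> (\<lambda>x. (\<integral>\<omega>. diff_op X x f (\<Phi> \<omega>) \<partial>P lam) * h x)"
    using square_integrable_mult[OF mean_diff_square_integrable hs]
    by (subst Bochner_Integration.integrable_cong[OF refl, of _ _ "\<lambda>x. mean_diff x * h x"])
      (simp_all add: diff_mean)
  define K where "K = (\<integral>x. mean_diff x * h x \<partial>\<rho>)"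
  have K: "(\<integral>x. (\<integral>\<omega>. diff_op X x f (\<Phi> \<omega>) \<partial>P lam) * h x \<partial>\<rho>) = K"
    unfolding K_def by (intro Bochner_Integration.integral_cong refl) (simp add: diff_mean)
  define A where "A \<theta> = (\<integral>\<phi>. f \<phi> \<partial>Q (k \<theta>))" for \<theta>
  define Z where "Z \<theta> = exp_norm \<rho> (1 / (\<theta> - \<theta>\<^sub>0)) (\<lambda>x. u\<^sub>0 x + (\<theta> - \<theta>\<^sub>0) * g \<theta> x)
      (- (1 / (\<theta> - \<theta>\<^sub>0))) u\<^sub>0 (- 1) h" for \<theta>
  let ?F = "at \<theta>\<^sub>0 within I"
  have ev: "\<forall>\<^sub>F \<theta> in ?F. \<theta> \<in> I \<and> \<theta> \<noteq> \<theta>\<^sub>0" by (auto simp: eventually_at_filter)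
  have bound: "((A \<theta> - A \<theta>\<^sub>0) / (\<theta> - \<theta>\<^sub>0) - K)\<^sup>2 \<le> Z \<theta> * (\<integral>\<phi>. (f \<phi>)\<^sup>2 \<partial>Q (\<lambda>_. 1))" if "\<theta> \<in> I" for \<theta>
    using combination_bound[OF ks[OF that] Qk(1)[OF that that that] hs,
        of "1 / (\<theta> - \<theta>\<^sub>0)" "- (1 / (\<theta> - \<theta>\<^sub>0))" "- 1"]
    unfolding k_u Z_def A_def K_def k0 by (simp add: diff_divide_distrib)
  have g_lim: "AE x in \<rho>. ((\<lambda>\<theta>. g \<theta> x) \<longlongrightarrow> h x) ?F"
    using lim
  proof eventually_elim
    case (elim x)
    from tendsto_add[OF tendsto_const[of "h x"] elim] show ?case by (simp add: g_def)
  qed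
  define w where "w x = \<bar>h x\<bar> + R x" for x
  have ws: "square_integrable \<rho> w"
  proof -
    have "square_integrable \<rho> (\<lambda>x. \<bar>h x\<bar>)"
      using hs by (rule square_integrable_bound) (use hm in auto)
    then show ?thesis using square_integrable_add[OF _ Rs] by (simp add: w_def[abs_def])
  qed
  have g_le: "AE x in \<rho>. \<bar>g \<theta> x\<bar> \<le> w x" if "\<theta> \<in> I" for \<theta>
    using R(3)[OF that]
  proof eventually_elim
    case (elim x)
    then show ?case unfolding g_def w_def by linarith
  qed
  have gm: "g \<theta> \<in> borel_measurable \<rho>" if "\<theta> \<in> I" for \<theta>
    using gs[OF that] by (simp add: square_integrable_def)
  have inner_lim: "((\<lambda>\<theta>. inner_on \<rho> v (g \<theta>)) \<longlongrightarrow> inner_on \<rho> v h) ?F" if v: "square_integrable \<rho> v" for v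
    unfolding inner_on_def
  proof (rule tendsto_integral_at_within[where w = "\<lambda>x. \<bar>v x\<bar> * w x"])
    have vm: "v \<in> borel_measurable \<rho>" using v by (simp add: square_integrable_def)
    show "(\<lambda>x. v x * g \<theta> x) \<in> borel_measurable \<rho>" if "\<theta> \<in> I" for \<theta>
      using vm gm[OF that] by measurable
    show "(\<lambda>x. v x * h x) \<in> borel_measurable \<rho>" using vm hm by measurable
    show "AE x in \<rho>. ((\<lambda>\<theta>. v x * g \<theta> x) \<longlongrightarrow> v x * h x) ?F"
      using g_lim by eventually_elim (intro tendsto_intros)
    have "square_integrable \<rho> (\<lambda>x. \<bar>v x\<bar>)"
      using v by (rule square_integrable_bound) (use vm in auto)
    then show "integrable \<rho> (\<lambda>x. \<bar>v x\<bar> * w x)" using ws by (rule square_integrable_mult)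
    show "AE x in \<rho>. \<bar>v x * g \<theta> x\<bar> \<le> \<bar>v x\<bar> * w x" if "\<theta> \<in> I" for \<theta>
      using g_le[OF that] by eventually_elim (simp add: abs_mult mult_left_mono)
  qed
  have norm_lim: "((\<lambda>\<theta>. inner_on \<rho> (g \<theta>) (g \<theta>)) \<longlongrightarrow> inner_on \<rho> h h) ?F"
    unfolding inner_on_def
  proof (rule tendsto_integral_at_within[where w = "\<lambda>x. w x * w x"])
    show "(\<lambda>x. g \<theta> x * g \<theta> x) \<in> borel_measurable \<rho>" if "\<theta> \<in> I" for \<theta>
      using gm[OF that] by measurable
    show "(\<lambda>x. h x * h x) \<in> borel_measurable \<rho>" using hm by measurable
    show "AE x in \<rho>. ((\<lambda>\<theta>. g \<theta> x * g \<theta> x) \<longlongrightarrow> h x * h x) ?F"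
      using g_lim by eventually_elim (intro tendsto_intros)
    show "integrable \<rho> (\<lambda>x. w x * w x)" using ws ws by (rule square_integrable_mult)
    show "AE x in \<rho>. \<bar>g \<theta> x * g \<theta> x\<bar> \<le> w x * w x" if "\<theta> \<in> I" for \<theta>
      using g_le[OF that]
    proof eventually_elim
      case (elim x)
      then show ?case unfolding abs_mult by (intro mult_mono) auto
    qed
  qed
  have "(Z \<longlongrightarrow> 0) ?F"
  proof (rule Lim_transform_eventually)
    let ?b = "inner_on \<rho> u\<^sub>0 h" and ?c = "inner_on \<rho> h h"
    let ?G = "\<lambda>\<theta>. exp (inner_on \<rho> u\<^sub>0 u\<^sub>0) *
      ((exp (2 * (\<theta> - \<theta>\<^sub>0) * inner_on \<rho> u\<^sub>0 (g \<theta>) + (\<theta> - \<theta>\<^sub>0)\<^sup>2 * inner_on \<rho> (g \<theta>) (g \<theta>))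
          - 2 * exp ((\<theta> - \<theta>\<^sub>0) * inner_on \<rho> u\<^sub>0 (g \<theta>)) + 1) / (\<theta> - \<theta>\<^sub>0)\<^sup>2
        - 2 * (exp ((\<theta> - \<theta>\<^sub>0) * inner_on \<rho> u\<^sub>0 (g \<theta>)) * inner_on \<rho> (g \<theta>) h
          + ?b * ((exp ((\<theta> - \<theta>\<^sub>0) * inner_on \<rho> u\<^sub>0 (g \<theta>)) - 1) / (\<theta> - \<theta>\<^sub>0)))
        + (?b\<^sup>2 + ?c))"
    show "(?G \<longlongrightarrow> 0) ?F"
    proof (rule exp_norm_difference_quotient_tendsto)
      have "((\<lambda>\<theta>. \<theta> - \<theta>\<^sub>0) \<longlongrightarrow> \<theta>\<^sub>0 - \<theta>\<^sub>0) ?F" by (intro tendsto_intros)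
      then show "((\<lambda>\<theta>. \<theta> - \<theta>\<^sub>0) \<longlongrightarrow> 0) ?F" by simp
      show "\<forall>\<^sub>F \<theta> in ?F. \<theta> - \<theta>\<^sub>0 \<noteq> 0" using ev by eventually_elim simp
      show "((\<lambda>\<theta>. inner_on \<rho> u\<^sub>0 (g \<theta>)) \<longlongrightarrow> ?b) ?F" by (rule inner_lim[OF u0])
      show "((\<lambda>\<theta>. inner_on \<rho> (g \<theta>) (g \<theta>)) \<longlongrightarrow> ?c) ?F" by (rule norm_lim)
      show "((\<lambda>\<theta>. inner_on \<rho> (g \<theta>) h) \<longlongrightarrow> ?c) ?F"
        using inner_lim[OF hs] by (subst inner_on_commute)
    qed
    show "\<forall>\<^sub>F \<theta> in ?F. ?G \<theta> = Z \<theta>"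
      using ev
    proof eventually_elim
      case (elim \<theta>)
      then have "\<theta> \<in> I" "\<theta> - \<theta>\<^sub>0 \<noteq> 0" by auto
      from exp_norm_difference_quotient[OF u0 gs[OF this(1)] hs this(2)]
      show ?case unfolding Z_def by (rule sym)
    qed
  qed
  then have "((\<lambda>\<theta>. Z \<theta> * (\<integral>\<phi>. (f \<phi>)\<^sup>2 \<partial>Q (\<lambda>_. 1))) \<longlongrightarrow> 0) ?F"
    by (rule tendsto_mult_left_zero)
  then have "((\<lambda>\<theta>. ((A \<theta> - A \<theta>\<^sub>0) / (\<theta> - \<theta>\<^sub>0) - K)\<^sup>2) \<longlongrightarrow> 0) ?F"
  proof (rule Lim_null_comparison[rotated])
    show "\<forall>\<^sub>F \<theta> in ?F. norm (((A \<theta> - A \<theta>\<^sub>0) / (\<theta> - \<theta>\<^sub>0) - K)\<^sup>2) \<le> Z \<theta> * (\<integral>\<phi>. (f \<phi>)\<^sup>2 \<partial>Q (\<lambda>_. 1))"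
      using ev
    proof eventually_elim
      case (elim \<theta>)
      then show ?case using bound[of \<theta>] by simp
    qed
  qed
  then have "((\<lambda>\<theta>. (A \<theta> - A \<theta>\<^sub>0) / (\<theta> - \<theta>\<^sub>0) - K) \<longlongrightarrow> 0) ?F" by simp
  then have "((\<lambda>\<theta>. (A \<theta> - A \<theta>\<^sub>0) / (\<theta> - \<theta>\<^sub>0)) \<longlongrightarrow> K) ?F" by (simp add: Lim_null[symmetric])
  then have "(A has_real_derivative K) ?F" by (simp add: has_field_derivative_iff)
  then have deriv: "((\<lambda>\<theta>. \<integral>\<omega>. f (\<Phi> \<omega>) \<partial>P (lam\<^sub>\<theta> \<theta>)) has_real_derivative K) ?F"
    by (rule has_field_derivative_transform_within[OF _ zero_less_one I(3)]) (simp add: exp_f A_def)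
  show ?thesis
    unfolding K by (intro conjI ballI int_f AE_int int_mean deriv)
qed

end
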